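(* Fix real parameters $p > 1$, $q > 1$ and $T > 0$. For each positive integer $n$, set $B = n^p$, $\gamma = n^{-q}$ and $d = n^T$. Let the training inputs be the regularly spaced points $x_{\mathsf{train},i} = -1 + 2i/n$ ($i = 1,\dots,n$) with all labels equal to $+1$, let $\boldsymbol{\phi}(x) = \left[\tfrac{1}{\sqrt{2}}, \sin(\pi x), \cos(\pi x), \ldots, \sin(\tfrac{B}{2}\pi x), \cos(\tfrac{B}{2}\pi x)\right] \in \mathbb{R}^B$ be the Fourier feature map, and let $\boldsymbol{\Sigma} = \mathrm{diag}(\lambda_1,\dots,\lambda_B)$ with $\lambda_1 = \gamma B$ and $\lambda_j = \frac{(1-\gamma)B}{B-1}$ for $j \ge 2$. Let $\widehat{f}(x) = \langle\widehat{\boldsymbol{\alpha}}_2, \boldsymbol{\phi}(x)\rangle$ where $\widehat{\boldsymbol{\alpha}}_2 = \arg\min_{\boldsymbol{\alpha}}\|\boldsymbol{\Sigma}^{-1/2}\boldsymbol{\alpha}\|_2$ subject to $\boldsymbol{\phi}(x_{\mathsf{train},i})^\top\boldsymbol{\alpha} = 1$ for all $i$. Draw $\boldsymbol{z}_1,\dots,\boldsymbol{z}_d$ i.i.d. from $\mathcal{N}(\boldsymbol{0},\boldsymbol{\Sigma})$ and define the random-Fourier-sum features $\boldsymbol{\phi}^{\mathsf{RFS}}(x)\in\mathbb{R}^d$ by $\boldsymbol{\phi}^{\mathsf{RFS}}_i(x) = \langle \boldsymbol{z}_i, \boldsymbol{\phi}(x)\rangle$. Let $\widehat{\boldsymbol{\beta}}_2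 = \arg\min_{\boldsymbol{\beta}\in\mathbb{R}^d}\|\boldsymbol{\beta}\|_2$ subject to $\boldsymbol{\phi}^{\mathsf{RFS}}(x_{\mathsf{train},i})^\top\boldsymbol{\beta} = 1$ for all $i$, and $\widehat{g}(x) = \langle\widehat{\boldsymbol{\beta}}_2, \boldsymbol{\phi}^{\mathsf{RFS}}(x)\rangle$. Then: (1) if $T > 6p - 1$, then $\lim_{n\to\infty}\mathcal{C}(\widehat{f}) = \lim_{n\to\infty}\mathcal{C}(\widehat{g})$; (2) if $T > 6p + 1 - 2q$, then $\lim_{n\to\infty}\mathcal{C}_{\mathsf{adv}}(\widehat{f}, 1/n) = \lim_{n\to\infty}\mathcal{C}_{\mathsf{adv}}(\widehat{g}, 1/n)$.
   Context: All risks are computed over a test point $x\sim\mathrm{Unif}[-1,1]$ with ground truth $f^\ast\equiv 1$: the classification risk is $\mathcal{C}(f) = \mathbb{P}[\mathrm{sgn}(f(x))\neq\mathrm{sgn}(f^\ast(x))]$ and the adversarial risk with radius $\epsilon$ is $\mathcal{C}_{\mathsf{adv}}(f,\epsilon) = \mathbb{E}\left[\max_{\tilde{x}:\,|\tilde{x}-x|\le\epsilon}\mathbb{I}[\mathrm{sgn}(f(\tilde{x}))\neq\mathrm{sgn}(f^\ast(x))]\right]$. The function $\widehat{g}$ is random through the draw of $\boldsymbol{z}_1,\dots,\boldsymbol{z}_d$.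
   Formalization: The listed feature map has B+1 entries, not B, and n^p, n^T need not be integers; so B is taken as 2⌊n^p/2⌋+1 (frequencies up to ⌊n^p/2⌋), also in the λ_j, and d as ⌊n^T⌋; limits of the random risks of ĝ are in probability. *)

theory Defs
  imports "HOL-Probability.Probability"
begin

text \<open>Number of Fourier frequencies K and feature dimension B = 2K+1
  (constant feature, then sin/cos for frequencies 1..K), with K = floor(n^p/2).\<close>
definition nfreq :: "real \<Rightarrow> nat \<Rightarrow> nat" where
  "nfreq p n = nat \<lfloor>real n powr p / 2\<rfloor>"

definition dimB :: "real \<Rightarrow> nat \<Rightarrow> nat" where
  "dimB p n = 2 * nfreq p n + 1"

definition gam :: "real \<Rightarrow> nat \<Rightarrow> real" where
  "gam q n = real n powr (- q)"

definition dimD :: "real \<Rightarrow> nat \<Rightarrow> nat" where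
  "dimD T n = nat \<lfloor>real n powr T\<rfloor>"

definition xtrain :: "nat \<Rightarrow> nat \<Rightarrow> real" where
  "xtrain n i = -1 + 2 * real i / real n"

definition phi :: "real \<Rightarrow> nat \<Rightarrow> real" where
  "phi x (j::nat) = (if j = 0 then 1 / sqrt 2
              else if odd j then sin (real ((j + 1) div 2) * pi * x)
              else cos (real (j div 2) * pi * x))"

definition lam :: "real \<Rightarrow> real \<Rightarrow> nat \<Rightarrow> nat \<Rightarrow> real" where
  "lam p q n j = (if j = 0 then gam q n * real (dimB p n)
                  else (1 - gam q n) * real (dimB p n) / (real (dimB p n) - 1))"

definition alpha_hat :: "real \<Rightarrow> real \<Rightarrow> nat \<Rightarrow> nat \<Rightarrow> real" where
  "alpha_hat p q n = (ARG_MIN (\<lambda>\<alpha>. \<Sum>j<dimB p n. (\<alpha> j)\<^sup>2 / lam p q n j) \<alpha>.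
       (\<forall>i\<in>{1..n}. (\<Sum>j<dimB p n. phi (xtrain n i) j * \<alpha> j) = 1)
     \<and> (\<forall>j\<ge>dimB p n. \<alpha> j = 0))"

definition fhat :: "real \<Rightarrow> real \<Rightarrow> nat \<Rightarrow> real \<Rightarrow> real" where
  "fhat p q n x = (\<Sum>j<dimB p n. alpha_hat p q n j * phi x j)"

text \<open>Probability space of the Gaussian draws: z i j (i < d, j < B) are
  independent with z i j ~ N(0, lam j), i.e. z_1..z_d iid N(0, Sigma).\<close>
definition Zspace :: "real \<Rightarrow> real \<Rightarrow> real \<Rightarrow> nat \<Rightarrow> (nat \<Rightarrow> nat \<Rightarrow> real) measure" where
  "Zspace p q T n = PiM {..<dimD T n} (\<lambda>i. PiM {..<dimB p n}
      (\<lambda>j. density lborel (normal_density 0 (sqrt (lam p q n j)))))"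

definition phiRFS :: "real \<Rightarrow> nat \<Rightarrow> (nat \<Rightarrow> nat \<Rightarrow> real) \<Rightarrow> real \<Rightarrow> nat \<Rightarrow> real" where
  "phiRFS p n z x i = (\<Sum>j<dimB p n. z i j * phi x j)"

definition beta_hat :: "real \<Rightarrow> real \<Rightarrow> nat \<Rightarrow> (nat \<Rightarrow> nat \<Rightarrow> real) \<Rightarrow> nat \<Rightarrow> real" where
  "beta_hat p T n z = (ARG_MIN (\<lambda>\<beta>. \<Sum>i<dimD T n. (\<beta> i)\<^sup>2) \<beta>.
       (\<forall>k\<in>{1..n}. (\<Sum>i<dimD T n. phiRFS p n z (xtrain n k) i * \<beta> i) = 1)
     \<and> (\<forall>i\<ge>dimD T n. \<beta> i = 0))"

definition ghat :: "real \<Rightarrow> real \<Rightarrow> nat \<Rightarrow> (nat \<Rightarrow> nat \<Rightarrow> real) \<Rightarrow> real \<Rightarrow> real" where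
  "ghat p T n z x = (\<Sum>i<dimD T n. beta_hat p T n z i * phiRFS p n z x i)"

section \<open>Risks (test point uniform on [-1,1], ground truth f* = 1)\<close>

definition class_risk :: "(real \<Rightarrow> real) \<Rightarrow> real" where
  "class_risk f = measure lborel {x \<in> {-1..1}. sgn (f x) \<noteq> sgn (1::real)} / 2"

definition adv_risk :: "(real \<Rightarrow> real) \<Rightarrow> real \<Rightarrow> real" where
  "adv_risk f eps = measure lborel
     {x \<in> {-1..1}. \<exists>y. \<bar>y - x\<bar> \<le> eps \<and> sgn (f y) \<noteq> sgn (1::real)} / 2"

section \<open>Convergence in probability (with outer probability, so no measurability is presupposed)\<close>

definition outer_prob :: "'a measure \<Rightarrow> 'a set \<Rightarrow> real" where
  "outer_prob M S = Inf {measure M A | A. A \<in> sets M \<and> S \<inter> space M \<subseteq> A}"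

definition conv_in_prob :: "(nat \<Rightarrow> 'a measure) \<Rightarrow> (nat \<Rightarrow> 'a \<Rightarrow> real) \<Rightarrow> real \<Rightarrow> bool" where
  "conv_in_prob M X L \<longleftrightarrow> (\<forall>e>0.
     (\<lambda>n. outer_prob (M n) {\<omega> \<in> space (M n). \<bar>X n \<omega> - L\<bar> > e}) \<longlonglongrightarrow> 0)"

end

theory Submission
  imports Defs "HOL-Real_Asymp.Real_Asymp"
begin

text \<open>
  The training inputs alias all frequencies modulo \<open>n\<close>, so \<open>fhat\<close> is, up to scaling, a Dirichlet kernel with
  about \<open>n powr (p - 1) / 2\<close> terms in the variable \<open>n * pi * (x + 1)\<close>, plus a constant of order \<open>n powr (p - q)\<close>.

  Adversarial risk: both limits are 1, for every \<open>T > 0\<close>. Next to each training input \<open>fhat\<close> is nonpositive at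
  any fixed number \<open>m\<close> of points at distance \<open>o(1/n)\<close>. The weights \<open>beta_hat\<close> depend only on the random
  features at the training inputs, and given those, \<open>ghat - fhat\<close> is a centred Gaussian process (the posterior
  process of Gaussian process regression) whose values at the \<open>m\<close> points are almost uncorrelated. They are
  therefore unlikely to be all positive, whatever the scale of the process; no concentration is needed. If the
  interpolation problem has no solution, \<open>beta_hat\<close> is a fixed unspecified vector and the same bound applies.

  Classification risk: the empirical covariance of the random features is close to \<open>Sigma\<close> in Frobenius norm, so
  that \<open>ghat - fhat\<close> is uniformly negligible against the typical size \<open>n powr (1 - p)\<close> of \<open>fhat\<close>. The
  measure of \<open>{x. fhat x \<le> \<tau>}\<close> is that of \<open>sin (N * t) \<le> a * sin t\<close> over a period, where the threshold
  \<open>a\<close> tends to 1, 0 or minus infinity according to \<open>q > p\<close>, \<open>q = p\<close> or \<open>q < p\<close>; the limits are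
  3/4, 1/2 and 0.
\<close>

section \<open>Orthogonal invariance of the Gaussian product measure\<close>

text \<open>Two obstacles shape the adversarial part. \<open>beta_hat\<close> is given by
  \<open>ARG_MIN\<close>, so nothing is known a priori about its measurability; before conditioning
  it has to be replaced by a measurable function of the training features, which explicit iterates
  supply. The independence behind the conditioning is that of orthogonal families of Gaussian
  functionals. It is derived from Householder reflections, so that only Fubini and one-dimensional
  integrals enter. A single point beside a training input would leave a failure probability of about
  one half; \<open>m\<close> nearly uncorrelated points bring it to order \<open>1 / sqrt m\<close>.
  Fixing \<open>m\<close> from the target accuracy before \<open>n\<close> grows, and using Markov's
  inequality over the training inputs, avoids any joint analysis of different training inputs. In
  the classification part both interpolants are written through dual weights on the training inputs.
  The two weight vectors solve linear systems with the same right-hand side, so coercivity of the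
  empirical form controls their difference. The comparison then costs a tolerance, which is why
  sublevel sets at moving thresholds are studied.\<close>

definition ip :: "'i set \<Rightarrow> ('i \<Rightarrow> real) \<Rightarrow> ('i \<Rightarrow> real) \<Rightarrow> real" where
  "ip I f g = (\<Sum>i\<in>I. f i * g i)"

lemma ip_commute: "ip I f g = ip I g f"
  by (simp add: ip_def mult.commute)

lemma ip_cong: "(\<And>i. i \<in> I \<Longrightarrow> f i = f' i) \<Longrightarrow> (\<And>i. i \<in> I \<Longrightarrow> g i = g' i) \<Longrightarrow> ip I f g = ip I f' g'"
  by (auto simp: ip_def intro!: sum.cong)

lemma ip_add_left: "ip I (\<lambda>i. f i + g i) h = ip I f h + ip I g h"
  by (simp add: ip_def sum.distrib algebra_simps)

lemma ip_diff_left: "ip I (\<lambda>i. f i - g i) h = ip I f h - ip I g h"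
  by (simp add: ip_def sum_subtractf algebra_simps)

lemma ip_scale_left: "ip I (\<lambda>i. c * f i) h = c * ip I f h"
  by (simp add: ip_def sum_distrib_left algebra_simps)

lemma ip_add_right: "ip I h (\<lambda>i. f i + g i) = ip I h f + ip I h g"
  by (simp add: ip_def sum.distrib algebra_simps)

lemma ip_diff_right: "ip I h (\<lambda>i. f i - g i) = ip I h f - ip I h g"
  by (simp add: ip_def sum_subtractf algebra_simps)

lemma ip_scale_right: "ip I h (\<lambda>i. c * f i) = c * ip I h f"
  by (simp add: ip_def sum_distrib_left algebra_simps)

lemma ip_sum_left: "ip I (\<lambda>i. \<Sum>k\<in>S. a k * u k i) h = (\<Sum>k\<in>S. a k * ip I (u k) h)"
  by (simp add: ip_def sum_distrib_left sum_distrib_right mult.assoc) (rule sum.swap)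

lemma ip_sum_right: "ip I h (\<lambda>i. \<Sum>k\<in>S. a k * u k i) = (\<Sum>k\<in>S. a k * ip I h (u k))"
  using ip_sum_left[where I=I and S=S and a=a and u=u and h=h] by (simp add: ip_commute)

lemmas ip_linear = ip_add_left ip_add_right ip_diff_left ip_diff_right ip_scale_left ip_scale_right
  ip_sum_left ip_sum_right

lemma ip_self_nonneg: "ip I f f \<ge> 0"
  by (simp add: ip_def sum_nonneg)

lemma ip_self_eq_0_iff: "finite I \<Longrightarrow> ip I f f = 0 \<longleftrightarrow> (\<forall>i\<in>I. f i = 0)"
  by (simp add: ip_def sum_nonneg_eq_0_iff)

lemma ip_Cauchy_Schwarz: "(ip I f g)\<^sup>2 \<le> ip I f f * ip I g g"
  using Cauchy_Schwarz_ineq_sum[of f g I] by (simp add: ip_def power2_eq_square)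

lemma abs_ip_le: "\<bar>ip I f g\<bar> \<le> sqrt (ip I f f) * sqrt (ip I g g)"
  using real_sqrt_le_mono[OF ip_Cauchy_Schwarz[of I f g]] by (simp add: real_sqrt_mult)

lemma measurable_ip[measurable (raw)]:
  assumes "\<And>i. i \<in> I \<Longrightarrow> (\<lambda>x. f x i) \<in> borel_measurable M" "\<And>i. i \<in> I \<Longrightarrow> (\<lambda>x. g x i) \<in> borel_measurable M"
  shows "(\<lambda>x. ip I (f x) (g x)) \<in> borel_measurable M"
  unfolding ip_def using assms by measurable

section \<open>Measure-preserving maps: shears and reflections of Lebesgue measure\<close>

definition mpres :: "'a measure \<Rightarrow> ('a \<Rightarrow> 'a) \<Rightarrow> bool" where
  "mpres M f \<longleftrightarrow> f \<in> measurable M M \<and> distr M M f = M"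

lemma mpres_comp: "mpres M f \<Longrightarrow> mpres M g \<Longrightarrow> mpres M (f \<circ> g)"
  unfolding mpres_def by (metis distr_distr measurable_comp)

lemma mpres_id: "mpres M (\<lambda>x. x)"
  unfolding mpres_def by (simp add: distr_id)

lemma mpres_cong: "(\<And>x. x \<in> space M \<Longrightarrow> f x = g x) \<Longrightarrow> mpres M f \<Longrightarrow> mpres M g"
  unfolding mpres_def by (metis distr_cong measurable_cong)

lemma mpresI_nn_integral:
  assumes f: "f \<in> measurable M M"
    and eq: "\<And>F. F \<in> borel_measurable M \<Longrightarrow> (\<integral>\<^sup>+x. F (f x) \<partial>M) = (\<integral>\<^sup>+x. F x \<partial>M)"
  shows "mpres M f"
proof -
  have "distr M M f = M"
  proof (rule measure_eqI)
    fix A assume "A \<in> sets (distr M M f)"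
    then have A: "A \<in> sets M" by simp
    have "emeasure (distr M M f) A = (\<integral>\<^sup>+x. indicator A x \<partial>distr M M f)"
      using A by simp
    also have "\<dots> = (\<integral>\<^sup>+x. indicator A (f x) \<partial>M)"
      using A by (intro nn_integral_distr f) simp
    also have "\<dots> = (\<integral>\<^sup>+x. indicator A x \<partial>M)"
      using A by (intro eq) simp
    finally show "emeasure (distr M M f) A = emeasure M A"
      using A by simp
  qed simp
  with f show ?thesis by (simp add: mpres_def)
qed

lemma mpres_nn_integral:
  assumes "mpres M f" "F \<in> borel_measurable M"
  shows "(\<integral>\<^sup>+x. F (f x) \<partial>M) = (\<integral>\<^sup>+x. F x \<partial>M)"
  using assms nn_integral_distr[of f M M F] by (simp add: mpres_def)

abbreviation lebPi :: "'i set \<Rightarrow> ('i \<Rightarrow> real) measure" where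
  "lebPi I \<equiv> PiM I (\<lambda>_. lborel)"

lemma nn_integral_lebPi_translate:
  assumes "finite J" "F \<in> borel_measurable (lebPi J)"
  shows "(\<integral>\<^sup>+w. F (\<lambda>i\<in>J. w i + c i) \<partial>lebPi J) = (\<integral>\<^sup>+w. F w \<partial>lebPi J)"
  using assms
proof (induction J arbitrary: F rule: finite_induct)
  case empty
  interpret product_sigma_finite "\<lambda>_. lborel :: real measure" by standard
  show ?case by (simp add: PiM_empty nn_integral_count_space_finite)
next
  case (insert a J)
  interpret product_sigma_finite "\<lambda>_. lborel :: real measure" by standard
  note [measurable] = insert.prems
  have m1: "(\<lambda>w. F (\<lambda>i\<in>insert a J. w i + c i)) \<in> borel_measurable (lebPi (insert a J))"
    by measurable
  have "(\<integral>\<^sup>+w. F (\<lambda>i\<in>insert a J. w i + c i) \<partial>lebPi (insert a J)) =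
      (\<integral>\<^sup>+x. (\<integral>\<^sup>+y. F (\<lambda>i\<in>insert a J. (x(a := y)) i + c i) \<partial>lborel) \<partial>lebPi J)"
    by (rule product_nn_integral_insert[OF insert.hyps m1])
  also have "\<dots> = (\<integral>\<^sup>+x. (\<integral>\<^sup>+y. F ((\<lambda>i\<in>J. x i + c i)(a := c a + 1 * y)) \<partial>lborel) \<partial>lebPi J)"
    using insert.hyps
    by (intro nn_integral_cong arg_cong[where f=F]) (auto simp: fun_eq_iff)
  also have "\<dots> = (\<integral>\<^sup>+x. (\<integral>\<^sup>+y. F ((\<lambda>i\<in>J. x i + c i)(a := y)) \<partial>lborel) \<partial>lebPi J)"
  proof (rule nn_integral_cong)
    fix x :: "'a \<Rightarrow> real"
    have "(\<lambda>i\<in>J. x i + c i) \<in> space (lebPi J)" by (simp add: space_PiM)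
    then have [measurable]: "(\<lambda>y. F ((\<lambda>i\<in>J. x i + c i)(a := y))) \<in> borel_measurable borel"
      by measurable
    show "(\<integral>\<^sup>+y. F ((\<lambda>i\<in>J. x i + c i)(a := c a + 1 * y)) \<partial>lborel) = (\<integral>\<^sup>+y. F ((\<lambda>i\<in>J. x i + c i)(a := y)) \<partial>lborel)"
      by (subst nn_integral_real_affine[of _ 1 "c a"]) auto
  qed
  also have "\<dots> = (\<integral>\<^sup>+x. (\<integral>\<^sup>+y. F (x(a := y)) \<partial>lborel) \<partial>lebPi J)"
    by (rule insert.IH[of "\<lambda>x. \<integral>\<^sup>+y. F (x(a := y)) \<partial>lborel"]) measurable
  also have "\<dots> = (\<integral>\<^sup>+w. F w \<partial>lebPi (insert a J))"
    by (rule product_nn_integral_insert[symmetric]) (use insert in auto)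
  finally show ?case .
qed

text \<open>For a fixed value of coordinate \<open>a\<close> the map translates the remaining
  coordinates, so integrating over those first reduces it to translation invariance.\<close>

lemma mpres_shear_others:
  assumes "finite J" "a \<notin> J"
  shows "mpres (lebPi (insert a J)) (\<lambda>x. \<lambda>i\<in>insert a J. if i = a then x a else x i + c i * x a)"
proof (rule mpresI_nn_integral)
  interpret product_sigma_finite "\<lambda>_. lborel :: real measure" by standard
  show m: "(\<lambda>x. \<lambda>i\<in>insert a J. if i = a then x a else x i + c i * x a)
    \<in> lebPi (insert a J) \<rightarrow>\<^sub>M lebPi (insert a J)"
    by measurable
  fix F :: "('a \<Rightarrow> real) \<Rightarrow> ennreal" assume F[measurable]: "F \<in> borel_measurable (lebPi (insert a J))"
  have "(\<integral>\<^sup>+x. F (\<lambda>i\<in>insert a J. if i = a then x a else x i + c i * x a) \<partial>lebPi (insert a J)) =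
     (\<integral>\<^sup>+y. (\<integral>\<^sup>+x. F (\<lambda>i\<in>insert a J. if i = a then (x(a := y)) a else (x(a := y)) i + c i * (x(a := y)) a) \<partial>lebPi J) \<partial>lborel)"
    by (rule product_nn_integral_insert_rev[OF assms]) (rule measurable_compose[OF m F])
  also have "\<dots> = (\<integral>\<^sup>+y. (\<integral>\<^sup>+x. F ((\<lambda>i\<in>J. x i + c i * y)(a := y)) \<partial>lebPi J) \<partial>lborel)"
    using assms by (intro nn_integral_cong arg_cong[where f=F]) (auto simp: fun_eq_iff)
  also have "\<dots> = (\<integral>\<^sup>+y. (\<integral>\<^sup>+x. F (x(a := y)) \<partial>lebPi J) \<partial>lborel)"
    by (intro nn_integral_cong nn_integral_lebPi_translate[OF assms(1)]) measurable
  also have "\<dots> = (\<integral>\<^sup>+x. F x \<partial>lebPi (insert a J))"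
    by (rule product_nn_integral_insert_rev[OF assms F, symmetric])
  finally show "(\<integral>\<^sup>+x. F (\<lambda>i\<in>insert a J. if i = a then x a else x i + c i * x a) \<partial>lebPi (insert a J)) =
     (\<integral>\<^sup>+x. F x \<partial>lebPi (insert a J))" .
qed

text \<open>With the other coordinates fixed, coordinate \<open>a\<close> undergoes an affine map of
  slope -1.\<close>

lemma mpres_reflect_shear_one:
  assumes "finite J" "a \<notin> J"
  shows "mpres (lebPi (insert a J)) (\<lambda>x. \<lambda>i\<in>insert a J. if i = a then (\<Sum>b\<in>J. l b * x b) - x a else x i)"
proof (rule mpresI_nn_integral)
  interpret product_sigma_finite "\<lambda>_. lborel :: real measure" by standard
  show m: "(\<lambda>x. \<lambda>i\<in>insert a J. if i = a then (\<Sum>b\<in>J. l b * x b) - x a else x i)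
    \<in> lebPi (insert a J) \<rightarrow>\<^sub>M lebPi (insert a J)"
    by measurable
  fix F :: "('a \<Rightarrow> real) \<Rightarrow> ennreal" assume F[measurable]: "F \<in> borel_measurable (lebPi (insert a J))"
  have "(\<integral>\<^sup>+x. F (\<lambda>i\<in>insert a J. if i = a then (\<Sum>b\<in>J. l b * x b) - x a else x i) \<partial>lebPi (insert a J)) =
     (\<integral>\<^sup>+x. (\<integral>\<^sup>+y. F (\<lambda>i\<in>insert a J. if i = a then (\<Sum>b\<in>J. l b * (x(a := y)) b) - (x(a := y)) a else (x(a := y)) i) \<partial>lborel) \<partial>lebPi J)"
    by (rule product_nn_integral_insert[OF assms]) (rule measurable_compose[OF m F])
  also have "\<dots> = (\<integral>\<^sup>+x. (\<integral>\<^sup>+y. F (x(a := (\<Sum>b\<in>J. l b * x b) + (-1) * y)) \<partial>lborel) \<partial>lebPi J)"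
  proof (intro nn_integral_cong arg_cong[where f=F])
    fix x :: "'a \<Rightarrow> real" and y :: real assume x: "x \<in> space (lebPi J)"
    have s: "(\<Sum>b\<in>J. l b * (x(a := y)) b) = (\<Sum>b\<in>J. l b * x b)"
      using assms by (intro sum.cong) auto
    show "(\<lambda>i\<in>insert a J. if i = a then (\<Sum>b\<in>J. l b * (x(a := y)) b) - (x(a := y)) a else (x(a := y)) i) =
      x(a := (\<Sum>b\<in>J. l b * x b) + (-1) * y)"
      unfolding s using x assms by (auto simp: fun_eq_iff space_PiM PiE_def extensional_def)
  qed
  also have "\<dots> = (\<integral>\<^sup>+x. (\<integral>\<^sup>+y. F (x(a := y)) \<partial>lborel) \<partial>lebPi J)"
  proof (rule nn_integral_cong)
    fix x :: "'a \<Rightarrow> real" assume "x \<in> space (lebPi J)"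
    then have [measurable]: "(\<lambda>y. F (x(a := y))) \<in> borel_measurable borel"
      by measurable
    show "(\<integral>\<^sup>+y. F (x(a := (\<Sum>b\<in>J. l b * x b) + (-1) * y)) \<partial>lborel) = (\<integral>\<^sup>+y. F (x(a := y)) \<partial>lborel)"
      by (subst (2) nn_integral_real_affine[of _ "-1" "\<Sum>b\<in>J. l b * x b"]) auto
  qed
  also have "\<dots> = (\<integral>\<^sup>+x. F x \<partial>lebPi (insert a J))"
    by (rule product_nn_integral_insert[OF assms F, symmetric])
  finally show "(\<integral>\<^sup>+x. F (\<lambda>i\<in>insert a J. if i = a then (\<Sum>b\<in>J. l b * x b) - x a else x i) \<partial>lebPi (insert a J)) =
     (\<integral>\<^sup>+x. F x \<partial>lebPi (insert a J))" .
qed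

text \<open>For \<open>u = 0\<close> this is the identity, thanks to \<open>x / 0 = 0\<close>.\<close>

definition hrefl :: "'i set \<Rightarrow> ('i \<Rightarrow> real) \<Rightarrow> ('i \<Rightarrow> real) \<Rightarrow> 'i \<Rightarrow> real" where
  "hrefl I u x = (\<lambda>i\<in>I. x i - 2 * ip I x u / ip I u u * u i)"

lemma ip_hrefl: "ip I (hrefl I u x) (hrefl I u y) = ip I x y"
proof -
  have "ip I (hrefl I u x) (hrefl I u y) = ip I (\<lambda>i. x i - (2 * ip I x u / ip I u u) * u i)
      (\<lambda>i. y i - (2 * ip I y u / ip I u u) * u i)"
    by (intro ip_cong) (auto simp: hrefl_def)
  also have "\<dots> = ip I x y"
    unfolding ip_linear ip_commute[of I u x] ip_commute[of I u y] by (cases "ip I u u = 0") auto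
  finally show ?thesis .
qed

text \<open>A reflection is a product of three shears, each of which preserves Lebesgue measure by Fubini and
  translation invariance.\<close>

lemma mpres_hrefl_lebPi:
  assumes "finite I"
  shows "mpres (lebPi I) (hrefl I u)"
proof (cases "\<forall>i\<in>I. u i = 0")
  case True
  then have "hrefl I u x = x" if "x \<in> space (lebPi I)" for x
    using that by (auto simp: hrefl_def space_PiM PiE_def extensional_def fun_eq_iff)
  then show ?thesis using mpres_cong[OF _ mpres_id] by metis
next
  case False
  then obtain a where a: "a \<in> I" "u a \<noteq> 0" by blast
  define J where "J = I - {a}"
  have I: "I = insert a J" "a \<notin> J" "finite J" using a assms by (auto simp: J_def)
  define \<kappa> where "\<kappa> = 2 / ip I u u"
  have u0: "ip I u u \<noteq> 0" using a assms by (auto simp: ip_self_eq_0_iff)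
  have uu: "ip I u u = u a * u a + ip J u u" using I by (simp add: ip_def)
  define S where "S = (\<lambda>c x. \<lambda>i\<in>insert a J. if i = a then x a else x i + c i * x a :: real)"
  define T where "T = (\<lambda>x. \<lambda>i\<in>insert a J. if i = a then (\<Sum>b\<in>J. (- \<kappa> * u a * u b) * x b) - x a else x i :: real)"
  define c where "c = (\<lambda>i. u i / u a)"
  \<comment> \<open>A reflection moves points along \<open>u\<close>, hence fixes
    \<open>x i - c i * x a\<close> for \<open>i \<noteq> a\<close>. The inner shear passes to these
    invariants, \<open>T\<close> updates coordinate \<open>a\<close> alone, and the outer shear
    restores the other coordinates.\<close>
  have "mpres (lebPi I) (S c \<circ> (T \<circ> S (\<lambda>i. - c i)))"
    unfolding I(1) S_def T_def
    by (intro mpres_comp mpres_shear_others[OF I(3,2)] mpres_reflect_shear_one[OF I(3,2)])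
  moreover have "(S c \<circ> (T \<circ> S (\<lambda>i. - c i))) x = hrefl I u x" if x: "x \<in> space (lebPi I)" for x
  proof -
    define t where "t = (\<Sum>b\<in>J. (- \<kappa> * u a * u b) * (x b - c b * x a)) - x a"
    have "t = - \<kappa> * u a * (\<Sum>b\<in>J. u b * x b) + \<kappa> * (\<Sum>b\<in>J. u b * u b) * x a - x a"
      using a(2) by (simp add: t_def c_def sum_distrib_left sum_distrib_right algebra_simps flip: sum.distrib sum_subtractf)
    also have "(\<Sum>b\<in>J. u b * u b) = ip I u u - u a * u a"
      using uu by (simp add: ip_def)
    also have "\<kappa> * (ip I u u - u a * u a) * x a = 2 * x a - \<kappa> * u a * (u a * x a)"
      using u0 by (simp add: \<kappa>_def field_simps)
    finally have t: "t = x a - \<kappa> * u a * ip I x u"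
      using I by (simp add: ip_def algebra_simps)
    have s: "(\<Sum>b\<in>J. (- \<kappa> * u a * u b) * S (\<lambda>i. - c i) x b) = (\<Sum>b\<in>J. (- \<kappa> * u a * u b) * (x b - c b * x a))"
      using I by (intro sum.cong) (auto simp: S_def)
    have T: "T (S (\<lambda>i. - c i) x) = (\<lambda>i\<in>insert a J. if i = a then t else x i - c i * x a)"
      unfolding T_def s using I by (auto simp: fun_eq_iff S_def t_def)
    show ?thesis
    proof
      fix i
      show "(S c \<circ> (T \<circ> S (\<lambda>i. - c i))) x i = hrefl I u x i"
      proof (cases "i \<in> I")
        case False
        then show ?thesis using I by (auto simp: S_def hrefl_def)
      next
        case True
        show ?thesis
        proof (cases "i = a")
          case True
          then show ?thesis using I T by (simp add: S_def hrefl_def t \<kappa>_def)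
        next
          case False
          then have "(S c \<circ> (T \<circ> S (\<lambda>i. - c i))) x i = x i - c i * x a + c i * t"
            using True I T by (simp add: S_def)
          also have "\<dots> = hrefl I u x i"
            using True a(2) by (simp add: t hrefl_def \<kappa>_def c_def field_simps)
          finally show ?thesis .
        qed
      qed
    qed
  qed
  ultimately show ?thesis using mpres_cong by blast
qed

section \<open>Gaussian product measure and its invariance under reflections\<close>

abbreviation gaussPi :: "'i set \<Rightarrow> ('i \<Rightarrow> real) measure" where
  "gaussPi I \<equiv> PiM I (\<lambda>_. std_normal_distribution)"

lemma prob_space_gaussPi: "prob_space (gaussPi I)"
  by (intro prob_space_PiM prob_space_normal_density) simp

lemma gaussPi_eq_density:
  assumes "finite I"
  shows "gaussPi I = density (lebPi I) (\<lambda>x. \<Prod>i\<in>I. ennreal (std_normal_density (x i)))"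
proof -
  interpret L: product_sigma_finite "\<lambda>_. lborel :: real measure" by standard
  interpret N: prob_space std_normal_distribution by (intro prob_space_normal_density) simp
  interpret G: product_sigma_finite "\<lambda>_. std_normal_distribution" by standard
  have "density (lebPi I) (\<lambda>x. \<Prod>i\<in>I. ennreal (std_normal_density (x i))) = gaussPi I"
  proof (rule G.PiM_eqI[OF assms])
    show "sets (density (lebPi I) (\<lambda>x. \<Prod>i\<in>I. ennreal (std_normal_density (x i)))) = sets (gaussPi I)"
      by (simp cong: sets_PiM_cong)
    fix A :: "'a \<Rightarrow> real set" assume A: "\<And>i. i \<in> I \<Longrightarrow> A i \<in> sets std_normal_distribution"
    then have [measurable]: "\<And>i. i \<in> I \<Longrightarrow> A i \<in> sets borel" by simp
    have "emeasure (density (lebPi I) (\<lambda>x. \<Prod>i\<in>I. ennreal (std_normal_density (x i)))) (Pi\<^sub>E I A) =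
        (\<integral>\<^sup>+x. (\<Prod>i\<in>I. ennreal (std_normal_density (x i))) * indicator (Pi\<^sub>E I A) x \<partial>lebPi I)"
      using assms by (intro emeasure_density) (auto intro!: sets_PiM_I_finite)
    also have "\<dots> = (\<integral>\<^sup>+x. (\<Prod>i\<in>I. ennreal (std_normal_density (x i)) * indicator (A i) (x i)) \<partial>lebPi I)"
    proof (rule nn_integral_cong)
      fix x assume "x \<in> space (lebPi I)"
      then have "indicator (Pi\<^sub>E I A) x = (\<Prod>i\<in>I. indicator (A i) (x i) :: ennreal)"
        using assms by (auto simp: indicator_def space_PiM PiE_def Pi_def prod_eq_1_iff)
      then show "(\<Prod>i\<in>I. ennreal (std_normal_density (x i))) * indicator (Pi\<^sub>E I A) x =
          (\<Prod>i\<in>I. ennreal (std_normal_density (x i)) * indicator (A i) (x i))"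
        by (simp add: prod.distrib)
    qed
    also have "\<dots> = (\<Prod>i\<in>I. (\<integral>\<^sup>+x. ennreal (std_normal_density x) * indicator (A i) x \<partial>lborel))"
      using assms by (intro L.product_nn_integral_prod) auto
    also have "\<dots> = (\<Prod>i\<in>I. emeasure std_normal_distribution (A i))"
      by (intro prod.cong refl emeasure_density[symmetric]) auto
    finally show "emeasure (density (lebPi I) (\<lambda>x. \<Prod>i\<in>I. ennreal (std_normal_density (x i)))) (Pi\<^sub>E I A) =
      (\<Prod>i\<in>I. emeasure std_normal_distribution (A i))" .
  qed
  then show ?thesis by simp
qed

lemma prod_std_normal_density:
  assumes "finite I"
  shows "(\<Prod>i\<in>I. ennreal (std_normal_density (x i))) = ennreal ((1 / sqrt (2 * pi)) ^ card I * exp (- ip I x x / 2))"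
proof -
  have "(\<Prod>i\<in>I. ennreal (std_normal_density (x i))) = ennreal (\<Prod>i\<in>I. std_normal_density (x i))"
    by (rule prod_ennreal) simp
  also have "(\<Prod>i\<in>I. std_normal_density (x i)) = (1 / sqrt (2 * pi)) ^ card I * (\<Prod>i\<in>I. exp (- (x i)\<^sup>2 / 2))"
    unfolding std_normal_density_def prod.distrib by simp
  also have "(\<Prod>i\<in>I. exp (- (x i)\<^sup>2 / 2)) = exp (- ip I x x / 2)"
    using assms by (simp add: exp_sum[symmetric] ip_def power2_eq_square sum_negf sum_divide_distrib)
  finally show ?thesis .
qed

text \<open>The Gaussian density depends on \<open>x\<close> only through \<open>ip I x x\<close>,
  which a reflection leaves unchanged.\<close>

lemma mpres_hrefl_gaussPi:
  assumes I: "finite I"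
  shows "mpres (gaussPi I) (hrefl I u)"
proof (rule mpresI_nn_integral)
  let ?D = "\<lambda>x. \<Prod>i\<in>I. ennreal (std_normal_density (x i))"
  have sets_eq: "sets (gaussPi I) = sets (lebPi I)" by (simp cong: sets_PiM_cong)
  have mp: "mpres (lebPi I) (hrefl I u)" by (rule mpres_hrefl_lebPi[OF I])
  then have m: "hrefl I u \<in> measurable (lebPi I) (lebPi I)" by (simp add: mpres_def)
  then show "hrefl I u \<in> measurable (gaussPi I) (gaussPi I)"
    using measurable_cong_sets[OF sets_eq sets_eq] by blast
  fix F :: "_ \<Rightarrow> ennreal" assume "F \<in> borel_measurable (gaussPi I)"
  then have F[measurable]: "F \<in> borel_measurable (lebPi I)"
    using measurable_cong_sets[OF sets_eq refl] by blast
  have D: "?D x = ?D (hrefl I u x)" for x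
    unfolding prod_std_normal_density[OF I] ip_hrefl ..
  have "(\<integral>\<^sup>+x. F (hrefl I u x) \<partial>gaussPi I) = (\<integral>\<^sup>+x. ?D x * F (hrefl I u x) \<partial>lebPi I)"
    unfolding gaussPi_eq_density[OF I] using measurable_compose[OF m F]
    by (intro nn_integral_density) auto
  also have "\<dots> = (\<integral>\<^sup>+x. ?D (hrefl I u x) * F (hrefl I u x) \<partial>lebPi I)"
    by (simp only: D[symmetric])
  also have "\<dots> = (\<integral>\<^sup>+x. ?D x * F x \<partial>lebPi I)"
    using I by (intro mpres_nn_integral[OF mp, of "\<lambda>x. ?D x * F x"]) measurable
  also have "\<dots> = (\<integral>\<^sup>+x. F x \<partial>gaussPi I)"
    unfolding gaussPi_eq_density[OF I] by (intro nn_integral_density[symmetric]) auto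
  finally show "(\<integral>\<^sup>+x. F (hrefl I u x) \<partial>gaussPi I) = (\<integral>\<^sup>+x. F x \<partial>gaussPi I)" .
qed

section \<open>Independence and moments of Gaussian linear functionals\<close>

text \<open>Together the two conditions allow \<open>ip I g c\<close> to be rewritten as
  \<open>ip I (Q g) (Q c)\<close> and then \<open>Q g\<close> to be replaced in law by
  \<open>g\<close>.\<close>

definition gisom :: "'i set \<Rightarrow> (('i \<Rightarrow> real) \<Rightarrow> 'i \<Rightarrow> real) \<Rightarrow> bool" where
  "gisom I Q \<longleftrightarrow> mpres (gaussPi I) Q \<and> (\<forall>x y. ip I (Q x) (Q y) = ip I x y)"

lemma gisom_id: "gisom I (\<lambda>x. x)"
  by (simp add: gisom_def mpres_id)

lemma gisom_comp: "gisom I P \<Longrightarrow> gisom I Q \<Longrightarrow> gisom I (P \<circ> Q)"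
  by (auto simp: gisom_def intro: mpres_comp)

lemma gisom_hrefl: "finite I \<Longrightarrow> gisom I (hrefl I u)"
  by (simp add: gisom_def mpres_hrefl_gaussPi ip_hrefl)

text \<open>The elimination move of a QR decomposition: since \<open>u\<close> vanishes outside
  \<open>K\<close>, the coordinates outside \<open>K\<close> stay untouched, while the part of
  \<open>v\<close> on \<open>K\<close> is concentrated in one entry.\<close>

lemma hrefl_to_axis:
  assumes I: "finite I" "K \<subseteq> I" "i0 \<in> K"
  obtains u where "\<And>i. i \<notin> K \<Longrightarrow> u i = 0"
    "\<And>i. i \<in> K \<Longrightarrow> hrefl I u v i = (if i = i0 then sqrt (ip K v v) else 0)"
proof
  define \<rho> where "\<rho> = sqrt (ip K v v)"
  \<comment> \<open>The vector joining \<open>v\<close> to the point of equal length on the axis; if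
    the two coincide on \<open>K\<close>, the reflection degenerates to the identity.\<close>
  define u where "u = (\<lambda>i. if i \<in> K then v i - (if i = i0 then \<rho> else 0) else 0)"
  have \<rho>2: "\<rho> * \<rho> = ip K v v" by (simp add: \<rho>_def ip_self_nonneg)
  have K: "finite K" using I finite_subset by blast
  have ipK: "ip I x u = ip K x u" for x
    unfolding ip_def using I by (intro sum.mono_neutral_right) (auto simp: u_def)
  have delta: "ip K x (\<lambda>i. if i = i0 then \<rho> else 0) = x i0 * \<rho>" for x
    using K I by (simp add: ip_def if_distrib[where f="\<lambda>t. _ * t"] sum.delta cong: if_cong)
  have xu: "ip K x u = ip K x v - x i0 * \<rho>" for x
  proof -
    have "ip K x u = ip K x (\<lambda>i. v i - (if i = i0 then \<rho> else 0))"
      by (intro ip_cong) (auto simp: u_def)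
    then show ?thesis by (simp add: ip_diff_right delta)
  qed
  have vu: "ip I v u = \<rho> * \<rho> - v i0 * \<rho>" using xu[of v] ipK \<rho>2 by simp
  have uv: "ip K u v = \<rho> * \<rho> - v i0 * \<rho>" using vu ipK[of v] ip_commute[of K u v] by simp
  have uu: "ip I u u = 2 * (\<rho> * \<rho> - v i0 * \<rho>)"
    using xu[of u] ipK uv I by (simp add: u_def algebra_simps)
  show "u i = 0" if "i \<notin> K" for i using that by (simp add: u_def)
  show "hrefl I u v i = (if i = i0 then sqrt (ip K v v) else 0)" if i: "i \<in> K" for i
  proof (cases "ip I u u = 0")
    case True
    then have "u i = 0" using I i by (auto simp: ip_self_eq_0_iff)
    then show ?thesis using True i I by (auto simp: hrefl_def u_def \<rho>_def split: if_splits)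
  next
    case False
    then have "2 * ip I v u / ip I u u = 1" unfolding vu uu by simp
    then have "hrefl I u v i = v i - u i" using i I by (auto simp: hrefl_def)
    then show ?thesis using i by (auto simp: u_def \<rho>_def)
  qed
qed

text \<open>A rank-revealing Householder QR decomposition.\<close>

lemma ortho_split:
  assumes I: "finite I" and S: "finite S"
  shows "\<exists>Q J. J \<subseteq> I \<and> gisom I Q \<and> (\<forall>a\<in>S. \<forall>i\<in>I - J. Q (c a) i = 0) \<and>
    (\<forall>w. (\<forall>a\<in>S. ip I (c a) w = 0) \<longrightarrow> (\<forall>i\<in>J. Q w i = 0))"
  using S
proof (induction S rule: finite_induct)
  case empty
  show ?case by (intro exI[of _ "\<lambda>x. x"] exI[of _ "{}"]) (auto intro: gisom_id)
next
  case (insert a S)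
  then obtain Q J where J: "J \<subseteq> I" and Q: "gisom I Q"
    and Qc: "\<And>b i. b \<in> S \<Longrightarrow> i \<in> I - J \<Longrightarrow> Q (c b) i = 0"
    and Qw: "\<And>w i. (\<forall>a\<in>S. ip I (c a) w = 0) \<Longrightarrow> i \<in> J \<Longrightarrow> Q w i = 0"
    by blast
  define v where "v = Q (c a)"
  show ?case
  proof (cases "\<forall>i\<in>I - J. v i = 0")
    case True
    then show ?thesis
      using J Q Qc Qw by (intro exI[of _ Q] exI[of _ J]) (auto simp: v_def)
  next
    case False
    then obtain i0 where i0: "i0 \<in> I - J" "v i0 \<noteq> 0" by blast
    obtain u where u0: "\<And>i. i \<notin> I - J \<Longrightarrow> u i = 0"
      and u: "\<And>i. i \<in> I - J \<Longrightarrow> hrefl I u v i = (if i = i0 then sqrt (ip (I - J) v v) else 0)"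
      using hrefl_to_axis[of I "I - J" i0 v] I i0 by auto
    have "ip (I - J) v v \<noteq> 0" using i0 I by (auto simp: ip_self_eq_0_iff)
    then have pos: "sqrt (ip (I - J) v v) \<noteq> 0" by simp
    have fixJ: "hrefl I u x i = x i" if "i \<in> J" for x i
      using u0[of i] that J by (auto simp: hrefl_def)
    define Q' where "Q' = hrefl I u \<circ> Q"
    have Q': "gisom I Q'" unfolding Q'_def by (intro gisom_comp gisom_hrefl I Q)
    have c1: "Q' (c b) i = 0" if "b \<in> S" "i \<in> I - insert i0 J" for b i
    proof -
      have "ip I (Q (c b)) u = 0"
        unfolding ip_def using Qc[OF that(1)] u0 by (intro sum.neutral) auto
      then show ?thesis using that Qc[OF that(1)] by (auto simp: Q'_def hrefl_def)
    qed
    have c2: "Q' (c a) i = 0" if "i \<in> I - insert i0 J" for i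
      using u[of i] that by (auto simp: Q'_def v_def)
    \<comment> \<open>\<open>Q' (c a)\<close> vanishes outside \<open>insert i0 J\<close> and
      \<open>Q' w\<close> vanishes on \<open>J\<close>, so orthogonality of the images reduces to a
      single product in which the pivot is nonzero.\<close>
    have c3: "Q' w i = 0" if w: "\<forall>b\<in>insert a S. ip I (c b) w = 0" and i: "i \<in> insert i0 J" for w i
    proof -
      have J0: "Q' w j = 0" if "j \<in> J" for j
        using fixJ[OF that] Qw[of w j] w that by (simp add: Q'_def)
      have "0 = ip I (Q' (c a)) (Q' w)" using Q' w by (simp add: gisom_def)
      also have "\<dots> = (\<Sum>j\<in>{i0}. Q' (c a) j * Q' w j)"
        unfolding ip_def using I i0 c2 J0 J by (intro sum.mono_neutral_right) auto
      finally have "Q' (c a) i0 * Q' w i0 = 0" by simp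
      moreover have "Q' (c a) i0 = sqrt (ip (I - J) v v)" using u[OF i0(1)] by (simp add: Q'_def v_def)
      ultimately have "Q' w i0 = 0" using pos by simp
      with J0 i show ?thesis by blast
    qed
    show ?thesis
      using J i0 Q' c1 c2 c3 by (intro exI[of _ Q'] exI[of _ "insert i0 J"]) auto
  qed
qed

lemma indep_vars_gaussPi:
  assumes "finite I"
  shows "prob_space.indep_vars (gaussPi I) (\<lambda>_. borel) (\<lambda>i g. g i) I"
proof -
  interpret prob_space "gaussPi I" by (rule prob_space_gaussPi)
  show ?thesis
  proof (cases "I = {}")
    case True
    then show ?thesis unfolding indep_vars_def indep_sets_def by simp
  next
    case False
    have comp: "distr (gaussPi I) borel (\<lambda>g. g i) = std_normal_distribution" if "i \<in> I" for i
    proof -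
      have "distr (gaussPi I) borel (\<lambda>g. g i) = distr (gaussPi I) std_normal_distribution (\<lambda>g. g i)"
        by (rule distr_cong) auto
      also have "\<dots> = std_normal_distribution"
        using that by (intro distr_PiM_component prob_space_normal_density) auto
      finally show ?thesis .
    qed
    have "distr (gaussPi I) (PiM I (\<lambda>_. borel)) (\<lambda>x. \<lambda>i\<in>I. x i) = distr (gaussPi I) (gaussPi I) (\<lambda>x. x)"
      by (rule distr_cong) (auto simp: space_PiM PiE_def extensional_def fun_eq_iff cong: sets_PiM_cong)
    also have "\<dots> = gaussPi I" by (simp add: distr_id)
    also have "\<dots> = PiM I (\<lambda>i. distr (gaussPi I) borel (\<lambda>g. g i))"
      by (intro PiM_cong refl) (simp add: comp)
    finally show ?thesis
      by (subst indep_vars_iff_distr_eq_PiM'[OF False]) auto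
  qed
qed

text \<open>After the isometry of \<open>ortho_split\<close> the first family reads only the
  coordinates in \<open>J\<close> and the second only those outside \<open>J\<close>, and disjoint
  blocks of coordinates are independent. This yields independence of whole families, not merely of
  pairs of functionals.\<close>

lemma indep_var_orthogonal_gaussPi:
  assumes I: "finite I" and S: "finite S"
    and orth: "\<And>a b. a \<in> S \<Longrightarrow> b \<in> S' \<Longrightarrow> ip I (c a) (w b) = 0"
  shows "prob_space.indep_var (gaussPi I) (PiM S (\<lambda>_. borel)) (\<lambda>g. \<lambda>a\<in>S. ip I g (c a))
    (PiM S' (\<lambda>_. borel)) (\<lambda>g. \<lambda>b\<in>S'. ip I g (w b))"
proof -
  interpret prob_space "gaussPi I" by (rule prob_space_gaussPi)
  obtain Q J where J: "J \<subseteq> I" and Q: "gisom I Q"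
    and Qc: "\<And>b i. b \<in> S \<Longrightarrow> i \<in> I - J \<Longrightarrow> Q (c b) i = 0"
    and Qw: "\<And>w i. (\<forall>a\<in>S. ip I (c a) w = 0) \<Longrightarrow> i \<in> J \<Longrightarrow> Q w i = 0"
    using ortho_split[OF I S, of c] by blast
  have Qm[measurable]: "Q \<in> measurable (gaussPi I) (gaussPi I)" and Qd: "distr (gaussPi I) (gaussPi I) Q = gaussPi I"
    using Q by (auto simp: gisom_def mpres_def)
  define Y1 where "Y1 = (\<lambda>h. \<lambda>a\<in>S. ip J h (Q (c a)))"
  define Y2 where "Y2 = (\<lambda>h. \<lambda>b\<in>S'. ip (I - J) h (Q (w b)))"
  have m1: "Y1 \<in> PiM J (\<lambda>_. borel) \<rightarrow>\<^sub>M PiM S (\<lambda>_. borel)" unfolding Y1_def by measurable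
  have m2: "Y2 \<in> PiM (I - J) (\<lambda>_. borel) \<rightarrow>\<^sub>M PiM S' (\<lambda>_. borel)" unfolding Y2_def by measurable
  have ind: "indep_var (PiM J (\<lambda>_. borel)) (\<lambda>g. restrict (\<lambda>i. g i) J)
      (PiM (I - J) (\<lambda>_. borel)) (\<lambda>g. restrict (\<lambda>i. g i) (I - J))"
    using J by (intro indep_var_restrict[OF indep_vars_gaussPi[OF I]]) auto
  define Z1 where "Z1 = Y1 \<circ> (\<lambda>g. restrict (\<lambda>i. g i) J)"
  define Z2 where "Z2 = Y2 \<circ> (\<lambda>g. restrict (\<lambda>i. g i) (I - J))"
  have indZ: "indep_var (PiM S (\<lambda>_. borel)) Z1 (PiM S' (\<lambda>_. borel)) Z2"
    unfolding Z1_def Z2_def by (rule indep_var_compose[OF ind m1 m2])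
  have rv[measurable]: "Z1 \<in> gaussPi I \<rightarrow>\<^sub>M PiM S (\<lambda>_. borel)" "Z2 \<in> gaussPi I \<rightarrow>\<^sub>M PiM S' (\<lambda>_. borel)"
    using indZ by (auto simp: indep_var_distribution_eq)
  have X1: "(\<lambda>g. \<lambda>a\<in>S. ip I g (c a)) = (\<lambda>g. Z1 (Q g))"
  proof (intro ext)
    fix g a
    have "ip I g (c a) = ip J (restrict (\<lambda>i. Q g i) J) (Q (c a))" if "a \<in> S"
    proof -
      have "ip I g (c a) = ip I (Q g) (Q (c a))" using Q by (simp add: gisom_def)
      also have "\<dots> = ip J (Q g) (Q (c a))"
        unfolding ip_def using I J Qc[OF that] by (intro sum.mono_neutral_right) auto
      also have "\<dots> = ip J (restrict (\<lambda>i. Q g i) J) (Q (c a))" by (intro ip_cong) auto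
      finally show ?thesis .
    qed
    then show "(\<lambda>a\<in>S. ip I g (c a)) a = Z1 (Q g) a" by (auto simp: Z1_def Y1_def)
  qed
  have X2: "(\<lambda>g. \<lambda>b\<in>S'. ip I g (w b)) = (\<lambda>g. Z2 (Q g))"
  proof (intro ext)
    fix g b
    have "ip I g (w b) = ip (I - J) (restrict (\<lambda>i. Q g i) (I - J)) (Q (w b))" if "b \<in> S'"
    proof -
      have "ip I g (w b) = ip I (Q g) (Q (w b))" using Q by (simp add: gisom_def)
      also have "\<dots> = ip (I - J) (Q g) (Q (w b))"
        unfolding ip_def using I J Qw[of "w b"] orth that by (intro sum.mono_neutral_right) auto
      also have "\<dots> = ip (I - J) (restrict (\<lambda>i. Q g i) (I - J)) (Q (w b))" by (intro ip_cong) auto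
      finally show ?thesis .
    qed
    then show "(\<lambda>b\<in>S'. ip I g (w b)) b = Z2 (Q g) b" by (auto simp: Z2_def Y2_def)
  qed
  have d3: "distr (gaussPi I) N (\<lambda>g. Z (Q g)) = distr (gaussPi I) N Z"
    if "Z \<in> gaussPi I \<rightarrow>\<^sub>M N" for N :: "(('b \<Rightarrow> real) \<times> ('c \<Rightarrow> real)) measure" and Z
    using distr_distr[OF that Qm] Qd by (simp add: o_def)
  have d1: "distr (gaussPi I) N (\<lambda>g. Z (Q g)) = distr (gaussPi I) N Z"
    if "Z \<in> gaussPi I \<rightarrow>\<^sub>M N" for N :: "('b \<Rightarrow> real) measure" and Z
    using distr_distr[OF that Qm] Qd by (simp add: o_def)
  have d2: "distr (gaussPi I) N (\<lambda>g. Z (Q g)) = distr (gaussPi I) N Z"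
    if "Z \<in> gaussPi I \<rightarrow>\<^sub>M N" for N :: "('c \<Rightarrow> real) measure" and Z
    using distr_distr[OF that Qm] Qd by (simp add: o_def)
  have "distr (gaussPi I) (PiM S (\<lambda>_. borel)) Z1 \<Otimes>\<^sub>M distr (gaussPi I) (PiM S' (\<lambda>_. borel)) Z2 =
      distr (gaussPi I) (PiM S (\<lambda>_. borel) \<Otimes>\<^sub>M PiM S' (\<lambda>_. borel)) (\<lambda>g. (Z1 g, Z2 g))"
    using indZ by (auto simp: indep_var_distribution_eq)
  then show ?thesis
    unfolding indep_var_distribution_eq X1 X2
    using d1[OF rv(1)] d2[OF rv(2)] d3[OF measurable_Pair[OF rv]] by simp
qed

section \<open>One-dimensional marginals and low moments\<close>

lemma distr_linear_gaussPi:
  assumes I: "finite I" "I \<noteq> {}"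
  shows "distr (gaussPi I) borel (\<lambda>g. ip I g c) = distr std_normal_distribution borel (\<lambda>x. sqrt (ip I c c) * x)"
proof -
  obtain i0 where i0: "i0 \<in> I" using I by blast
  obtain u where u: "\<And>i. i \<in> I \<Longrightarrow> hrefl I u c i = (if i = i0 then sqrt (ip I c c) else 0)"
    using hrefl_to_axis[of I I i0 c thesis] I i0 by blast
  let ?Q = "hrefl I u"
  have Q: "?Q \<in> measurable (gaussPi I) (gaussPi I)" "distr (gaussPi I) (gaussPi I) ?Q = gaussPi I"
    using gisom_hrefl[OF I(1), of u] by (auto simp: gisom_def mpres_def)
  have eq: "ip I g c = sqrt (ip I c c) * ?Q g i0" for g
  proof -
    have "ip I g c = ip I (?Q g) (?Q c)" by (simp add: ip_hrefl)
    also have "\<dots> = (\<Sum>i\<in>I. ?Q g i * (if i = i0 then sqrt (ip I c c) else 0))"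
      unfolding ip_def[of I "?Q g"] by (intro sum.cong refl) (simp only: u)
    also have "\<dots> = sqrt (ip I c c) * ?Q g i0"
      using I i0 by (simp add: if_distrib[where f="\<lambda>t. _ * t"] sum.delta cong: if_cong)
    finally show ?thesis .
  qed
  have m: "(\<lambda>h. sqrt (ip I c c) * h i0) \<in> gaussPi I \<rightarrow>\<^sub>M borel" using i0 by measurable
  have "distr (gaussPi I) borel (\<lambda>g. ip I g c) = distr (gaussPi I) borel ((\<lambda>h. sqrt (ip I c c) * h i0) \<circ> ?Q)"
    unfolding o_def by (rule distr_cong) (auto intro: eq)
  also have "\<dots> = distr (gaussPi I) borel (\<lambda>h. sqrt (ip I c c) * h i0)"
    using distr_distr[OF m Q(1)] Q(2) by simp
  also have "\<dots> = distr (distr (gaussPi I) std_normal_distribution (\<lambda>h. h i0)) borel (\<lambda>x. sqrt (ip I c c) * x)"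
    using i0 by (subst distr_distr) (auto simp: o_def)
  also have "distr (gaussPi I) std_normal_distribution (\<lambda>h. h i0) = std_normal_distribution"
    using i0 by (intro distr_PiM_component prob_space_normal_density) auto
  finally show ?thesis .
qed

lemma
  assumes I: "finite I" "I \<noteq> {}"
  shows integrable_linear_gaussPi_power: "integrable (gaussPi I) (\<lambda>g. (ip I g c) ^ k)" (is ?int)
    and expectation_linear_gaussPi_power:
      "(\<integral>g. (ip I g c) ^ k \<partial>gaussPi I) = sqrt (ip I c c) ^ k * (\<integral>x. x ^ k \<partial>std_normal_distribution)" (is ?eq)
proof -
  have m: "(\<lambda>g. ip I g c) \<in> gaussPi I \<rightarrow>\<^sub>M borel" by measurable
  have "integrable (distr std_normal_distribution borel (\<lambda>x. sqrt (ip I c c) * x)) (\<lambda>y. y ^ k)"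
    by (subst integrable_distr_eq) (auto simp: power_mult_distrib intro!: integrable_std_normal_distribution_moment)
  then show ?int
    unfolding distr_linear_gaussPi[OF I, symmetric] by (subst (asm) integrable_distr_eq) (auto simp: m)
  have "(\<integral>g. (ip I g c) ^ k \<partial>gaussPi I) = (\<integral>y. y ^ k \<partial>distr (gaussPi I) borel (\<lambda>g. ip I g c))"
    by (subst integral_distr) (auto simp: m)
  also have "\<dots> = (\<integral>x. (sqrt (ip I c c) * x) ^ k \<partial>std_normal_distribution)"
    unfolding distr_linear_gaussPi[OF I] by (subst integral_distr) auto
  finally show ?eq by (simp add: power_mult_distrib)
qed

lemma std_normal_moment_2: "(\<integral>x. x\<^sup>2 \<partial>std_normal_distribution) = 1"
  using std_normal_distribution_even_moments[of 1] by simp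

lemma std_normal_moment_4: "(\<integral>x. x ^ 4 \<partial>std_normal_distribution) = 3"
  using std_normal_distribution_even_moments[of 2] by (simp add: fact_numeral)

text \<open>Polarisation expresses the mixed moments through powers of single functionals, whose law
  is a scaled standard normal. The fourth-order identity is
  \<open>(a + b)^4 + (a - b)^4 = 2 * a^4 + 12 * a^2 * b^2 + 2 * b^4\<close>.\<close>

lemma
  assumes I: "finite I" "I \<noteq> {}"
  shows integrable_gaussPi_mixed2: "integrable (gaussPi I) (\<lambda>g. ip I g c * ip I g e)" (is ?i2)
    and expectation_gaussPi_mixed2: "(\<integral>g. ip I g c * ip I g e \<partial>gaussPi I) = ip I c e" (is ?e2)
    and integrable_gaussPi_mixed4: "integrable (gaussPi I) (\<lambda>g. (ip I g c)\<^sup>2 * (ip I g e)\<^sup>2)" (is ?i4)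
    and expectation_gaussPi_mixed4: "(\<integral>g. (ip I g c)\<^sup>2 * (ip I g e)\<^sup>2 \<partial>gaussPi I) =
      ip I c c * ip I e e + 2 * (ip I c e)\<^sup>2" (is ?e4)
proof -
  note int = integrable_linear_gaussPi_power[OF I]
  note ex = expectation_linear_gaussPi_power[OF I]
  let ?s = "\<lambda>i. c i + e i" and ?d = "\<lambda>i. c i - e i"
  have p2: "ip I g c * ip I g e = ((ip I g ?s)\<^sup>2 - (ip I g ?d)\<^sup>2) / 4" for g
    by (simp add: ip_linear power2_eq_square algebra_simps)
  have p4: "(ip I g c)\<^sup>2 * (ip I g e)\<^sup>2 =
      ((ip I g ?s) ^ 4 + (ip I g ?d) ^ 4 - 2 * (ip I g c) ^ 4 - 2 * (ip I g e) ^ 4) / 12" for g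
    by (simp add: ip_linear power2_eq_square power4_eq_xxxx algebra_simps)
  have E2: "(\<integral>g. (ip I g f)\<^sup>2 \<partial>gaussPi I) = ip I f f" for f
    by (simp add: ex std_normal_moment_2 ip_self_nonneg)
  have E4: "(\<integral>g. (ip I g f) ^ 4 \<partial>gaussPi I) = 3 * (ip I f f)\<^sup>2" for f
  proof -
    have "sqrt (ip I f f) ^ 4 = ((sqrt (ip I f f))\<^sup>2)\<^sup>2" by (simp flip: power_mult)
    then show ?thesis by (simp add: ex std_normal_moment_4 ip_self_nonneg)
  qed
  show ?i2 unfolding p2 by (intro integrable_divide Bochner_Integration.integrable_diff int)
  show ?e2 unfolding p2 using int
    by (simp add: E2 del: ip_add_right ip_diff_right) (simp add: ip_linear ip_commute[of I e c])
  show ?i4 unfolding p4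
    by (intro integrable_divide Bochner_Integration.integrable_diff Bochner_Integration.integrable_add integrable_mult_right int)
  have "(\<integral>g. (ip I g c)\<^sup>2 * (ip I g e)\<^sup>2 \<partial>gaussPi I) =
      (3 * (ip I ?s ?s)\<^sup>2 + 3 * (ip I ?d ?d)\<^sup>2 - 6 * (ip I c c)\<^sup>2 - 6 * (ip I e e)\<^sup>2) / 12"
    unfolding p4 using int by (simp add: E4)
  also have "\<dots> = ip I c c * ip I e e + 2 * (ip I c e)\<^sup>2"
    by (simp add: ip_linear ip_commute[of I e c] power2_eq_square algebra_simps)
  finally show ?e4 .
qed

text \<open>Since \<open>x \<ge> \<kappa> * x ^ 2 - \<kappa> ^ 3 * x ^ 4\<close> for \<open>x \<ge> 0\<close>, positivity of all \<open>m\<close> variables forces their sum to be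
  of order \<open>m\<close>, whereas it has variance of order \<open>m\<close>.\<close>

lemma gaussPi_all_pos_normalized:
  assumes I: "finite I" "I \<noteq> {}" and L: "finite L" "L \<noteq> {}"
    and norm: "\<And>l. l \<in> L \<Longrightarrow> ip I (c l) (c l) = 1"
    and corr: "\<And>l l'. l \<in> L \<Longrightarrow> l' \<in> L \<Longrightarrow> l \<noteq> l' \<Longrightarrow> \<bar>ip I (c l) (c l')\<bar> \<le> 1 / card L"
  shows "measure (gaussPi I) {g \<in> space (gaussPi I). \<forall>l\<in>L. ip I g (c l) > 0} \<le> 147 / sqrt (card L)"
proof -
  interpret prob_space "gaussPi I" by (rule prob_space_gaussPi)
  define m where "m = real (card L)"
  have m: "m \<ge> 1" using L by (simp add: m_def Suc_leI card_gt_0_iff)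
  define \<Lambda> where "\<Lambda> = sqrt m"
  have \<Lambda>: "\<Lambda> \<ge> 1" "\<Lambda> * \<Lambda> = m" using m by (auto simp: \<Lambda>_def)
  \<comment> \<open>This value makes \<open>\<kappa> ^ 3 * (\<Lambda> * m)\<close> equal to
    \<open>\<kappa> * m / 4\<close>, half of the main term \<open>\<kappa> * m / 2\<close>.\<close>
  define \<kappa> where "\<kappa> = 1 / (2 * sqrt \<Lambda>)"
  have \<kappa>: "\<kappa> > 0" "\<kappa> * \<kappa> = 1 / (4 * \<Lambda>)" using \<Lambda> by (auto simp: \<kappa>_def)
  define X where "X = (\<lambda>l g. ip I g (c l))"
  define S where "S = (\<lambda>g. \<Sum>l\<in>L. X l g)"
  define V where "V = (\<lambda>g. \<Sum>l\<in>L. (X l g)\<^sup>2)"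
  define F where "F = (\<lambda>g. \<Sum>l\<in>L. (X l g) ^ 4)"
  have [measurable]: "X l \<in> borel_measurable (gaussPi I)" for l unfolding X_def by measurable
  have [measurable]: "S \<in> borel_measurable (gaussPi I)" "V \<in> borel_measurable (gaussPi I)" "F \<in> borel_measurable (gaussPi I)"
    unfolding S_def V_def F_def by measurable
  have intX: "integrable (gaussPi I) (\<lambda>g. X l g ^ k)" for l k
    unfolding X_def by (rule integrable_linear_gaussPi_power[OF I])
  have i2: "integrable (gaussPi I) (\<lambda>g. X l g * X l' g)" for l l'
    unfolding X_def by (rule integrable_gaussPi_mixed2[OF I])
  have i4: "integrable (gaussPi I) (\<lambda>g. (X l g)\<^sup>2 * (X l' g)\<^sup>2)" for l l'
    unfolding X_def by (rule integrable_gaussPi_mixed4[OF I])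
  \<comment> \<open>Diagonal terms occur \<open>m\<close> times; the off-diagonal bound
    \<open>b\<close> is charged to all \<open>m * m\<close> pairs. A correlation of at most
    \<open>1 / m\<close> therefore keeps every double sum of order \<open>m\<close>.\<close>
  have corr_sum: "(\<Sum>l\<in>L. \<Sum>l'\<in>L. h l l') \<le> a * m + b * m * m"
    if h: "\<And>l. l \<in> L \<Longrightarrow> h l l \<le> a" "\<And>l l'. l \<in> L \<Longrightarrow> l' \<in> L \<Longrightarrow> l \<noteq> l' \<Longrightarrow> h l l' \<le> b" and b: "b \<ge> 0"
      "a \<ge> 0" for h a b
  proof -
    have "(\<Sum>l\<in>L. \<Sum>l'\<in>L. h l l') \<le> (\<Sum>l\<in>L. \<Sum>l'\<in>L. (if l = l' then a else 0) + b)"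
      using h b by (intro sum_mono) (auto intro: add_increasing2)
    also have "\<dots> = a * m + b * m * m"
      using L by (simp add: sum.distrib m_def algebra_simps)
    finally show ?thesis .
  qed
  have S2: "(\<integral>g. (S g)\<^sup>2 \<partial>gaussPi I) \<le> 2 * m" and intS2: "integrable (gaussPi I) (\<lambda>g. (S g)\<^sup>2)"
  proof -
    have eq: "(S g)\<^sup>2 = (\<Sum>l\<in>L. \<Sum>l'\<in>L. X l g * X l' g)" for g
      by (simp add: S_def power2_eq_square sum_product)
    show "integrable (gaussPi I) (\<lambda>g. (S g)\<^sup>2)"
      unfolding eq by (intro Bochner_Integration.integrable_sum i2)
    have "(\<integral>g. (S g)\<^sup>2 \<partial>gaussPi I) = (\<Sum>l\<in>L. \<Sum>l'\<in>L. ip I (c l) (c l'))"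
      unfolding eq using i2 by (simp add: Bochner_Integration.integral_sum) (simp add: X_def expectation_gaussPi_mixed2[OF I])
    also have "\<dots> \<le> 1 * m + (1 / m) * m * m"
      using norm corr m by (intro corr_sum) (auto simp: m_def dest: order_trans[OF abs_ge_self])
    finally show "(\<integral>g. (S g)\<^sup>2 \<partial>gaussPi I) \<le> 2 * m" using m by simp
  qed
  have V2: "(\<integral>g. (V g - m)\<^sup>2 \<partial>gaussPi I) \<le> 4 * m" and intV2: "integrable (gaussPi I) (\<lambda>g. (V g - m)\<^sup>2)"
  proof -
    have eq: "(V g - m)\<^sup>2 = (\<Sum>l\<in>L. \<Sum>l'\<in>L. (X l g)\<^sup>2 * (X l' g)\<^sup>2 - (X l g)\<^sup>2 - (X l' g)\<^sup>2 + 1)" for g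
    proof -
      have "V g - m = (\<Sum>l\<in>L. (X l g)\<^sup>2 - 1)" by (simp add: V_def m_def sum_subtractf)
      then have "(V g - m)\<^sup>2 = (\<Sum>l\<in>L. \<Sum>l'\<in>L. ((X l g)\<^sup>2 - 1) * ((X l' g)\<^sup>2 - 1))"
        by (simp add: power2_eq_square sum_product)
      then show ?thesis by (simp add: algebra_simps)
    qed
    show "integrable (gaussPi I) (\<lambda>g. (V g - m)\<^sup>2)"
      unfolding eq by (intro Bochner_Integration.integrable_sum Bochner_Integration.integrable_add
          Bochner_Integration.integrable_diff i4 intX integrable_const)
    have one: "(\<integral>g. (X l g)\<^sup>2 \<partial>gaussPi I) = 1" if "l \<in> L" for l
      using expectation_gaussPi_mixed2[OF I, of "c l" "c l"] norm[OF that] by (simp add: X_def power2_eq_square)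
    have "(\<integral>g. (V g - m)\<^sup>2 \<partial>gaussPi I) = (\<Sum>l\<in>L. \<Sum>l'\<in>L. 2 * (ip I (c l) (c l'))\<^sup>2)"
    proof -
      have e: "(\<integral>g. (X l g)\<^sup>2 * (X l' g)\<^sup>2 - (X l g)\<^sup>2 - (X l' g)\<^sup>2 + 1 \<partial>gaussPi I) = 2 * (ip I (c l) (c l'))\<^sup>2"
        if "l \<in> L" "l' \<in> L" for l l'
      proof -
        have "(\<integral>g. (X l g)\<^sup>2 * (X l' g)\<^sup>2 - (X l g)\<^sup>2 - (X l' g)\<^sup>2 + 1 \<partial>gaussPi I) =
          (\<integral>g. (X l g)\<^sup>2 * (X l' g)\<^sup>2 \<partial>gaussPi I) - 1 - 1 + 1"
          using that i4 intX by (simp add: one prob_space)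
        also have "\<dots> = 2 * (ip I (c l) (c l'))\<^sup>2"
          using that by (simp add: X_def expectation_gaussPi_mixed4[OF I] norm)
        finally show ?thesis .
      qed
      have "(\<integral>g. (V g - m)\<^sup>2 \<partial>gaussPi I) =
        (\<Sum>l\<in>L. \<Sum>l'\<in>L. \<integral>g. (X l g)\<^sup>2 * (X l' g)\<^sup>2 - (X l g)\<^sup>2 - (X l' g)\<^sup>2 + 1 \<partial>gaussPi I)"
        unfolding eq
        by (subst Bochner_Integration.integral_sum, intro Bochner_Integration.integrable_sum Bochner_Integration.integrable_add
          Bochner_Integration.integrable_diff i4 intX integrable_const, intro sum.cong refl Bochner_Integration.integral_sum
          Bochner_Integration.integrable_add Bochner_Integration.integrable_diff i4 intX integrable_const)
      then show ?thesis using e by simp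
    qed
    also have "\<dots> \<le> 2 * m + (2 / m) * m * m"
    proof (rule corr_sum)
      fix l l' assume l: "l \<in> L" "l' \<in> L" "l \<noteq> l'"
      have "(ip I (c l) (c l'))\<^sup>2 \<le> (1 / m)\<^sup>2"
        using corr[OF l] by (intro abs_le_square_iff[THEN iffD1]) (simp add: m_def)
      also have "\<dots> \<le> 1 / m" using m by (simp add: power2_eq_square field_simps)
      finally show "2 * (ip I (c l) (c l'))\<^sup>2 \<le> 2 / m" by simp
    qed (use norm m in auto)
    finally show "(\<integral>g. (V g - m)\<^sup>2 \<partial>gaussPi I) \<le> 4 * m" using m by simp
  qed
  have F1: "(\<integral>g. F g \<partial>gaussPi I) = 3 * m" and intF: "integrable (gaussPi I) F"
  proof -
    show "integrable (gaussPi I) F" unfolding F_def by (intro Bochner_Integration.integrable_sum intX)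
    have "(\<integral>g. F g \<partial>gaussPi I) = (\<Sum>l\<in>L. \<integral>g. (X l g) ^ 4 \<partial>gaussPi I)"
      unfolding F_def by (intro Bochner_Integration.integral_sum intX)
    also have "\<dots> = (\<Sum>l\<in>L. 3)"
      by (intro sum.cong refl) (simp add: X_def expectation_linear_gaussPi_power[OF I] norm std_normal_moment_4)
    finally show "(\<integral>g. F g \<partial>gaussPi I) = 3 * m" by (simp add: m_def)
  qed
  \<comment> \<open>If all variables are positive and the first two events fail, the sum
    \<open>S\<close> is at least \<open>\<kappa> * m / 2 - \<kappa> ^ 3 * (\<Lambda> * m) = m *
    \<kappa> / 4\<close>, so the third event occurs. The three probabilities are at most
    \<open>16 / m\<close>, \<open>3 / \<Lambda>\<close> and \<open>128 / \<Lambda>\<close>, whence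
    the constant 147.\<close>
  define A1 where "A1 = {g \<in> space (gaussPi I). m\<^sup>2 / 4 \<le> (V g - m)\<^sup>2}"
  define A2 where "A2 = {g \<in> space (gaussPi I). \<Lambda> * m \<le> F g}"
  define A3 where "A3 = {g \<in> space (gaussPi I). (m * \<kappa> / 4)\<^sup>2 \<le> (S g)\<^sup>2}"
  have [measurable]: "A1 \<in> sets (gaussPi I)" "A2 \<in> sets (gaussPi I)" "A3 \<in> sets (gaussPi I)"
    unfolding A1_def A2_def A3_def by measurable
  have "{g \<in> space (gaussPi I). \<forall>l\<in>L. X l g > 0} \<subseteq> A1 \<union> A2 \<union> A3"
  proof (rule subsetI, rule ccontr)
    fix g assume g: "g \<in> {g \<in> space (gaussPi I). \<forall>l\<in>L. X l g > 0}" and n: "g \<notin> A1 \<union> A2 \<union> A3"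
    have "(V g - m)\<^sup>2 < (m / 2)\<^sup>2" using g n by (auto simp: A1_def power_divide)
    then have "\<bar>V g - m\<bar> < m / 2" using m by (metis abs_of_nonneg abs_square_less_1 divide_nonneg_nonneg
       less_eq_real_def linorder_not_le order_trans power2_less_imp_less power2_abs abs_ge_zero zero_le_numeral zero_le_one)
    then have V: "V g > m / 2" by linarith
    have F: "F g < \<Lambda> * m" using g n by (auto simp: A2_def)
    have S: "(S g)\<^sup>2 < (m * \<kappa> / 4)\<^sup>2" using g n by (auto simp: A3_def)
    have "\<kappa> * V g - \<kappa> ^ 3 * F g = (\<Sum>l\<in>L. \<kappa> * (X l g)\<^sup>2 - \<kappa> ^ 3 * (X l g) ^ 4)"
      by (simp add: V_def F_def sum_subtractf sum_distrib_left)
    also have "\<dots> \<le> S g" unfolding S_def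
    proof (rule sum_mono)
      fix l assume "l \<in> L"
      then have x: "X l g > 0" using g by auto
      define y where "y = \<kappa> * X l g"
      have y: "y > 0" using x \<kappa> by (simp add: y_def)
      have "y - y ^ 3 \<le> 1"
      proof (cases "y \<le> 1")
        case False
        then have "y ^ 1 \<le> y ^ 3" by (intro power_increasing) auto
        then show ?thesis by simp
      qed (use y in \<open>auto intro: order_trans[of _ y]\<close>)
      then have "X l g * (y - y ^ 3) \<le> X l g * 1" using x by (intro mult_left_mono) auto
      also have "X l g * (y - y ^ 3) = \<kappa> * (X l g)\<^sup>2 - \<kappa> ^ 3 * (X l g) ^ 4"
        by (simp add: y_def power2_eq_square power3_eq_cube power4_eq_xxxx algebra_simps)
      finally show "\<kappa> * (X l g)\<^sup>2 - \<kappa> ^ 3 * (X l g) ^ 4 \<le> X l g" by simp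
    qed
    finally have S1: "\<kappa> * V g - \<kappa> ^ 3 * F g \<le> S g" .
    have "\<kappa> ^ 3 * (\<Lambda> * m) = \<kappa> * (\<kappa> * \<kappa>) * \<Lambda> * m" by (simp add: power3_eq_cube)
    also have "\<dots> = \<kappa> * m / 4" unfolding \<kappa>(2) using \<Lambda> by (simp add: field_simps)
    finally have k3: "\<kappa> ^ 3 * (\<Lambda> * m) = \<kappa> * m / 4" .
    have "\<kappa> ^ 3 * F g \<le> \<kappa> * m / 4" unfolding k3[symmetric] using \<kappa> F by (intro mult_left_mono) auto
    moreover have "\<kappa> * (m / 2) \<le> \<kappa> * V g" using \<kappa> V by (intro mult_left_mono) auto
    ultimately have "m * \<kappa> / 4 \<le> S g" using S1 by (simp add: algebra_simps)
    then have "(m * \<kappa> / 4)\<^sup>2 \<le> (S g)\<^sup>2" using m \<kappa> by (intro power_mono) auto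
    with S show False by simp
  qed
  then have "prob {g \<in> space (gaussPi I). \<forall>l\<in>L. X l g > 0} \<le> prob (A1 \<union> A2 \<union> A3)"
    by (intro finite_measure_mono) auto
  also have "\<dots> \<le> prob (A1 \<union> A2) + prob A3" by (rule measure_Un_le) auto
  also have "\<dots> \<le> prob A1 + prob A2 + prob A3" using measure_Un_le[of A1 "gaussPi I" A2] by auto
  also have "prob A1 \<le> 16 / m"
  proof -
    have "prob A1 \<le> (\<integral>g. (V g - m)\<^sup>2 \<partial>gaussPi I) / (m\<^sup>2 / 4)"
      unfolding A1_def using m intV2 by (intro integral_Markov_inequality_measure[where A="{}"]) auto
    also have "\<dots> \<le> 4 * m / (m\<^sup>2 / 4)" using V2 by (intro divide_right_mono) auto
    also have "\<dots> = 16 / m" using m by (simp add: power2_eq_square)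
    finally show ?thesis .
  qed
  also have "prob A2 \<le> 3 / \<Lambda>"
  proof -
    have "prob A2 \<le> (\<integral>g. F g \<partial>gaussPi I) / (\<Lambda> * m)"
      unfolding A2_def using m \<Lambda> intF
      by (intro integral_Markov_inequality_measure[where A="{}"]) (auto simp: F_def intro!: sum_nonneg)
    then show ?thesis using F1 m by simp
  qed
  also have "prob A3 \<le> 128 / \<Lambda>"
  proof -
    have "prob A3 \<le> (\<integral>g. (S g)\<^sup>2 \<partial>gaussPi I) / (m * \<kappa> / 4)\<^sup>2"
      unfolding A3_def using m \<kappa> intS2 by (intro integral_Markov_inequality_measure[where A="{}"]) auto
    also have "\<dots> \<le> 2 * m / (m * \<kappa> / 4)\<^sup>2" using S2 by (intro divide_right_mono) auto
    also have "(m * \<kappa> / 4)\<^sup>2 = m * m * (\<kappa> * \<kappa>) / 16" by (simp add: power2_eq_square)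
    also have "2 * m / (m * m * (\<kappa> * \<kappa>) / 16) = 128 * \<Lambda> / m" unfolding \<kappa>(2) using m \<Lambda>(1) by (simp add: field_simps)
    also have "\<dots> = 128 / \<Lambda>" using \<Lambda> m by (simp add: field_simps flip: \<Lambda>(2))
    finally show ?thesis .
  qed
  also have "16 / m + 3 / \<Lambda> + 128 / \<Lambda> \<le> 147 / \<Lambda>"
  proof -
    have "1 / m \<le> 1 / \<Lambda>" using \<Lambda> m by (intro divide_left_mono) (auto simp flip: \<Lambda>(2))
    then show ?thesis by simp
  qed
  finally show ?thesis by (simp add: X_def \<Lambda>_def m_def)
qed

text \<open>Positivity ignores the lengths of the vectors, so they may be normalised; a zero vector
  makes the event empty because the inequality is strict. Being scale-free, the bound can be applied
  conditionally with an arbitrary weight vector.\<close>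

lemma gaussPi_all_pos_bound:
  assumes I: "finite I" "I \<noteq> {}" and L: "finite L" "L \<noteq> {}"
    and corr: "\<And>l l'. l \<in> L \<Longrightarrow> l' \<in> L \<Longrightarrow> l \<noteq> l' \<Longrightarrow>
      \<bar>ip I (c l) (c l')\<bar> \<le> sqrt (ip I (c l) (c l)) * sqrt (ip I (c l') (c l')) / card L"
  shows "measure (gaussPi I) {g \<in> space (gaussPi I). \<forall>l\<in>L. ip I g (c l) > 0} \<le> 147 / sqrt (card L)"
proof (cases "\<exists>l\<in>L. ip I (c l) (c l) = 0")
  case True
  then obtain l where l: "l \<in> L" "\<And>i. i \<in> I \<Longrightarrow> c l i = 0" using I by (auto simp: ip_self_eq_0_iff)
  then have "ip I g (c l) = 0" for g by (simp add: ip_def)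
  then have "{g \<in> space (gaussPi I). \<forall>l\<in>L. ip I g (c l) > 0} = {}"
    using l(1) by (metis (mono_tags, lifting) Collect_empty_eq less_irrefl)
  then show ?thesis by (simp only: measure_empty) simp
next
  case False
  define r where "r = (\<lambda>l. sqrt (ip I (c l) (c l)))"
  have r: "r l > 0" if "l \<in> L" for l
    using False that ip_self_nonneg[of I "c l"] by (auto simp: r_def less_le)
  define e where "e = (\<lambda>l i. (1 / r l) * c l i)"
  have rr: "r l * r l = ip I (c l) (c l)" for l by (simp add: r_def ip_self_nonneg)
  have eq: "{g \<in> space (gaussPi I). \<forall>l\<in>L. ip I g (c l) > 0} = {g \<in> space (gaussPi I). \<forall>l\<in>L. ip I g (e l) > 0}"
  proof -
    have "ip I g (e l) = ip I g (c l) / r l" for g l unfolding e_def ip_scale_right by simp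
    then have "ip I g (e l) > 0 \<longleftrightarrow> ip I g (c l) > 0" if "l \<in> L" for g l
      using r[OF that] by (simp add: zero_less_divide_iff)
    then show ?thesis by auto
  qed
  show ?thesis unfolding eq
  proof (rule gaussPi_all_pos_normalized[OF I L])
    show "ip I (e l) (e l) = 1" if "l \<in> L" for l
      using r[OF that] unfolding e_def ip_scale_left ip_scale_right rr[symmetric] by simp
    show "\<bar>ip I (e l) (e l')\<bar> \<le> 1 / card L" if "l \<in> L" "l' \<in> L" "l \<noteq> l'" for l l'
    proof -
      have "\<bar>ip I (e l) (e l')\<bar> = \<bar>ip I (c l) (c l')\<bar> / (r l * r l')"
        using r[OF that(1)] r[OF that(2)] unfolding e_def ip_scale_left ip_scale_right by (simp add: abs_mult)
      also have "\<dots> \<le> (r l * r l' / card L) / (r l * r l')"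
        using corr[OF that] r that by (intro divide_right_mono) (auto simp: r_def ip_self_nonneg)
      also have "\<dots> = 1 / card L" using r[OF that(1)] r[OF that(2)] by simp
      finally show ?thesis .
    qed
  qed
qed

section \<open>Minimum-norm interpolation\<close>

text \<open>Gram-Schmidt for possibly dependent vectors: a new vector enters through its residual
  \<open>e\<close> against the old ones. If \<open>e\<close> vanishes on \<open>I\<close>, the
  coefficient \<open>t\<close> is 0 because division by zero yields 0.\<close>

lemma ip_projection_exists:
  assumes I: "finite I" and S: "finite S"
  shows "\<exists>a. \<forall>k\<in>S. ip I (u k) (\<lambda>i. v i - (\<Sum>j\<in>S. a j * u j i)) = 0"
  using S
proof (induction S arbitrary: v rule: finite_induct)
  case empty
  then show ?case by simp
next
  case (insert x S)
  obtain a where a: "\<And>k. k \<in> S \<Longrightarrow> ip I (u k) (\<lambda>i. v i - (\<Sum>j\<in>S. a j * u j i)) = 0"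
    using insert.IH[of v] by blast
  obtain b where b: "\<And>k. k \<in> S \<Longrightarrow> ip I (u k) (\<lambda>i. u x i - (\<Sum>j\<in>S. b j * u j i)) = 0"
    using insert.IH[of "u x"] by blast
  define r where "r = (\<lambda>i. v i - (\<Sum>j\<in>S. a j * u j i))"
  define e where "e = (\<lambda>i. u x i - (\<Sum>j\<in>S. b j * u j i))"
  define t where "t = ip I e r / ip I e e"
  define c where "c = (\<lambda>j. if j = x then t else a j - t * b j)"
  have ux: "u x = (\<lambda>i. e i + (\<Sum>j\<in>S. b j * u j i))" by (simp add: e_def)
  have res: "(\<lambda>i. v i - (\<Sum>j\<in>insert x S. c j * u j i)) = (\<lambda>i. r i - t * e i)"
  proof
    fix i
    have "(\<Sum>j\<in>insert x S. c j * u j i) = t * u x i + (\<Sum>j\<in>S. c j * u j i)"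
      using insert.hyps by (simp add: c_def)
    also have "(\<Sum>j\<in>S. c j * u j i) = (\<Sum>j\<in>S. (a j - t * b j) * u j i)"
      using insert.hyps by (intro sum.cong) (auto simp: c_def)
    finally show "v i - (\<Sum>j\<in>insert x S. c j * u j i) = r i - t * e i"
      by (simp add: r_def e_def algebra_simps sum_subtractf sum_distrib_left)
  qed
  have er: "ip I e r = t * ip I e e"
  proof (cases "ip I e e = 0")
    case True
    then have "\<forall>i\<in>I. e i = 0" using I by (simp only: ip_self_eq_0_iff)
    then have "ip I e r = 0" by (simp add: ip_def)
    then show ?thesis using True by simp
  qed (simp add: t_def)
  have k: "ip I (u k) (\<lambda>i. r i - t * e i) = 0" if "k \<in> S" for k
    using a[OF that] b[OF that] by (simp add: ip_diff_right ip_scale_right r_def e_def)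
  have "ip I (u x) (\<lambda>i. r i - t * e i) = ip I e (\<lambda>i. r i - t * e i) + (\<Sum>j\<in>S. b j * ip I (u j) (\<lambda>i. r i - t * e i))"
    by (subst ux) (simp only: ip_add_left ip_sum_left)
  also have "\<dots> = 0" using k er by (simp add: ip_diff_right ip_scale_right)
  finally have "\<forall>k\<in>insert x S. ip I (u k) (\<lambda>i. v i - (\<Sum>j\<in>insert x S. c j * u j i)) = 0"
    unfolding res using k by auto
  then show ?case by blast
qed

text \<open>The residual of each \<open>u k\<close> against the other vectors has positive length;
  rescaled, it is a dual vector, and combining the dual vectors with coefficients \<open>r\<close>
  matches the right-hand side.\<close>

lemma ip_gram_solvable:
  assumes I: "finite I" and S: "finite S"
    and pd: "\<And>c k. k \<in> S \<Longrightarrow> c k \<noteq> 0 \<Longrightarrow> ip I (\<lambda>i. \<Sum>j\<in>S. c j * u j i) (\<lambda>i. \<Sum>j\<in>S. c j * u j i) > 0"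
  shows "\<exists>c. \<forall>k\<in>S. ip I (u k) (\<lambda>i. \<Sum>j\<in>S. c j * u j i) = r k"
proof -
  have "\<exists>b. ip I (u k) (\<lambda>i. \<Sum>j\<in>S. b j * u j i) = 1 \<and>
    (\<forall>k'\<in>S - {k}. ip I (u k') (\<lambda>i. \<Sum>j\<in>S. b j * u j i) = 0)" if k: "k \<in> S" for k
  proof -
    obtain a where a: "\<And>k'. k' \<in> S - {k} \<Longrightarrow> ip I (u k') (\<lambda>i. u k i - (\<Sum>j\<in>S - {k}. a j * u j i)) = 0"
      using ip_projection_exists[OF I, of "S - {k}" u "u k"] S by blast
    define b where "b = (\<lambda>j. if j = k then 1 else - a j)"
    define e where "e = (\<lambda>i. u k i - (\<Sum>j\<in>S - {k}. a j * u j i))"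
    have e: "e = (\<lambda>i. \<Sum>j\<in>S. b j * u j i)"
    proof
      fix i
      have "(\<Sum>j\<in>S. b j * u j i) = b k * u k i + (\<Sum>j\<in>S - {k}. b j * u j i)"
        using S k by (rule sum.remove)
      also have "(\<Sum>j\<in>S - {k}. b j * u j i) = (\<Sum>j\<in>S - {k}. - (a j * u j i))"
        by (intro sum.cong) (auto simp: b_def)
      finally show "e i = (\<Sum>j\<in>S. b j * u j i)" by (simp add: e_def b_def sum_negf)
    qed
    have N: "ip I e e > 0" unfolding e using k by (intro pd[of k]) (auto simp: b_def)
    have uk: "ip I (u k) e = ip I e e"
    proof -
      have "ip I e e = ip I (u k) e - (\<Sum>j\<in>S - {k}. a j * ip I (u j) e)"
        by (subst (1) e_def) (simp only: ip_diff_left ip_sum_left)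
      also have "(\<Sum>j\<in>S - {k}. a j * ip I (u j) e) = 0"
        using a by (intro sum.neutral) (auto simp: e_def)
      finally show ?thesis by simp
    qed
    define b' where "b' = (\<lambda>j. b j / ip I e e)"
    have "(\<lambda>i. \<Sum>j\<in>S. b' j * u j i) = (\<lambda>i. (1 / ip I e e) * e i)"
      by (subst (2) e) (simp add: b'_def sum_distrib_left sum_divide_distrib)
    then show ?thesis
      using N uk a by (intro exI[of _ b']) (simp only: ip_scale_right, simp add: e_def)
  qed
  then have "\<exists>b. \<forall>k\<in>S. ip I (u k) (\<lambda>i. \<Sum>j\<in>S. b k j * u j i) = 1 \<and>
    (\<forall>k'\<in>S - {k}. ip I (u k') (\<lambda>i. \<Sum>j\<in>S. b k j * u j i) = 0)"
    by (intro bchoice) blast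
  then obtain b where b1: "\<And>k. k \<in> S \<Longrightarrow> ip I (u k) (\<lambda>i. \<Sum>j\<in>S. b k j * u j i) = 1"
    and b0: "\<And>k k'. k \<in> S \<Longrightarrow> k' \<in> S \<Longrightarrow> k' \<noteq> k \<Longrightarrow> ip I (u k') (\<lambda>i. \<Sum>j\<in>S. b k j * u j i) = 0"
    by (auto simp del: ip_sum_right)
  define c where "c = (\<lambda>j. \<Sum>k\<in>S. r k * b k j)"
  have c: "(\<lambda>i. \<Sum>j\<in>S. c j * u j i) = (\<lambda>i. \<Sum>k\<in>S. r k * (\<Sum>j\<in>S. b k j * u j i))"
    by (simp add: c_def sum_distrib_left sum_distrib_right mult.assoc) (intro ext sum.swap)
  have "ip I (u k) (\<lambda>i. \<Sum>j\<in>S. c j * u j i) = r k" if k: "k \<in> S" for k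
  proof -
    have "ip I (u k) (\<lambda>i. \<Sum>j\<in>S. c j * u j i) = (\<Sum>k'\<in>S. r k' * ip I (u k) (\<lambda>i. \<Sum>j\<in>S. b k' j * u j i))"
      unfolding c ip_sum_right[of I "u k" r "\<lambda>k i. \<Sum>j\<in>S. b k j * u j i"] ..
    also have "\<dots> = (\<Sum>k'\<in>S. if k' = k then r k else 0)"
      using b1 b0 k by (intro sum.cong) auto
    finally show ?thesis using S k by simp
  qed
  then show ?thesis by blast
qed

text \<open>The form of \<open>\<alpha>0\<close> is the Lagrange condition. It makes
  \<open>\<alpha>0\<close> orthogonal, in the weighted sense, to all feasible directions, so any
  other feasible point costs more by a weighted squared distance. Forcing the coordinates from
  \<open>B\<close> on to vanish makes the minimiser unique as a function, which pins down the value
  of \<open>arg_min\<close>.\<close>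

lemma arg_min_weighted_norm:
  fixes B :: nat and l \<alpha>0 :: "nat \<Rightarrow> real" and u :: "'k \<Rightarrow> nat \<Rightarrow> real"
  assumes S: "finite S" and l: "\<And>j. j < B \<Longrightarrow> l j > 0"
    and \<alpha>0: "\<alpha>0 = (\<lambda>j. if j < B then l j * (\<Sum>k\<in>S. b k * u k j) else 0)"
    and feas: "\<And>k. k \<in> S \<Longrightarrow> (\<Sum>j<B. u k j * \<alpha>0 j) = r k"
  shows "arg_min (\<lambda>\<alpha>. \<Sum>j<B. (\<alpha> j)\<^sup>2 / l j) (\<lambda>\<alpha>. (\<forall>k\<in>S. (\<Sum>j<B. u k j * \<alpha> j) = r k) \<and> (\<forall>j\<ge>B. \<alpha> j = 0)) = \<alpha>0"
    (is "arg_min ?J ?P = _")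
proof -
  have P0: "?P \<alpha>0" using feas by (auto simp: \<alpha>0)
  have decomp: "?J \<alpha> = ?J \<alpha>0 + (\<Sum>j<B. (\<alpha> j - \<alpha>0 j)\<^sup>2 / l j)" if "?P \<alpha>" for \<alpha>
  proof -
    have "(\<Sum>j<B. \<alpha>0 j * (\<alpha> j - \<alpha>0 j) / l j) = (\<Sum>j<B. (\<Sum>k\<in>S. b k * u k j) * (\<alpha> j - \<alpha>0 j))"
      using l by (intro sum.cong) (auto simp: \<alpha>0 less_imp_neq[symmetric])
    also have "\<dots> = (\<Sum>k\<in>S. b k * (\<Sum>j<B. u k j * (\<alpha> j - \<alpha>0 j)))"
      by (simp add: sum_distrib_left sum_distrib_right mult.assoc) (rule sum.swap)
    also have "\<dots> = 0"
      using that P0 by (intro sum.neutral) (auto simp: algebra_simps sum_subtractf)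
    finally have o: "(\<Sum>j<B. \<alpha>0 j * (\<alpha> j - \<alpha>0 j) / l j) = 0" .
    have "?J \<alpha> = (\<Sum>j<B. (\<alpha>0 j)\<^sup>2 / l j + 2 * (\<alpha>0 j * (\<alpha> j - \<alpha>0 j) / l j) + (\<alpha> j - \<alpha>0 j)\<^sup>2 / l j)"
      by (intro sum.cong refl) (simp add: power2_eq_square algebra_simps add_divide_distrib diff_divide_distrib)
    also have "\<dots> = ?J \<alpha>0 + 2 * (\<Sum>j<B. \<alpha>0 j * (\<alpha> j - \<alpha>0 j) / l j) + (\<Sum>j<B. (\<alpha> j - \<alpha>0 j)\<^sup>2 / l j)"
      by (simp add: sum.distrib sum_distrib_left)
    finally show ?thesis using o by simp
  qed
  have nn: "(\<Sum>j<B. (\<alpha> j - \<alpha>0 j)\<^sup>2 / l j) \<ge> 0" for \<alpha>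
    using l by (intro sum_nonneg) (auto simp: less_imp_le)
  have m0: "is_arg_min ?J ?P \<alpha>0"
  proof -
    have "\<not> ?J \<alpha> < ?J \<alpha>0" if "?P \<alpha>" for \<alpha>
      using decomp[OF that] nn[of \<alpha>] by linarith
    then show ?thesis unfolding is_arg_min_def using P0 by blast
  qed
  have uniq: "\<alpha> = \<alpha>0" if "is_arg_min ?J ?P \<alpha>" for \<alpha>
  proof -
    have P: "?P \<alpha>" and "\<not> ?J \<alpha>0 < ?J \<alpha>" using that P0 unfolding is_arg_min_def by blast+
    then have "(\<Sum>j<B. (\<alpha> j - \<alpha>0 j)\<^sup>2 / l j) \<le> 0" using decomp[OF P] by linarith
    then have "(\<Sum>j<B. (\<alpha> j - \<alpha>0 j)\<^sup>2 / l j) = 0" using nn[of \<alpha>] by (rule antisym)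
    then have z: "\<forall>j\<in>{..<B}. (\<alpha> j - \<alpha>0 j)\<^sup>2 / l j = 0"
      using l by (subst (asm) sum_nonneg_eq_0_iff) (auto simp: less_imp_le)
    show ?thesis
    proof
      fix j show "\<alpha> j = \<alpha>0 j"
        using z l[of j] P by (cases "j < B") (auto simp: \<alpha>0)
    qed
  qed
  show ?thesis unfolding arg_min_def by (rule uniq) (rule someI[of "is_arg_min ?J ?P", OF m0])
qed

text \<open>A component of \<open>\<beta>\<close> orthogonal to all rows could be removed without
  affecting the constraints, and the norm would drop. The rows may be linearly dependent.\<close>

lemma arg_min_norm_in_span:
  fixes d :: nat and u :: "'k \<Rightarrow> nat \<Rightarrow> real" and \<beta> :: "nat \<Rightarrow> real"
  assumes S: "finite S"
    and \<beta>: "is_arg_min (\<lambda>\<beta>. \<Sum>i<d. (\<beta> i)\<^sup>2) (\<lambda>\<beta>. (\<forall>k\<in>S. (\<Sum>i<d. u k i * \<beta> i) = r k) \<and> (\<forall>i\<ge>d. \<beta> i = 0)) \<beta>"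
  shows "\<exists>c. \<forall>i<d. \<beta> i = (\<Sum>k\<in>S. c k * u k i)"
proof -
  let ?D = "{..<d}"
  have feas: "\<And>k. k \<in> S \<Longrightarrow> (\<Sum>i<d. u k i * \<beta> i) = r k" and z: "\<And>i. i \<ge> d \<Longrightarrow> \<beta> i = 0"
    using \<beta> unfolding is_arg_min_def by blast+
  obtain c where c: "\<And>k. k \<in> S \<Longrightarrow> ip ?D (u k) (\<lambda>i. \<beta> i - (\<Sum>j\<in>S. c j * u j i)) = 0"
    using ip_projection_exists[OF _ S, of ?D u \<beta>] by blast
  define h where "h = (\<lambda>i. \<beta> i - (\<Sum>j\<in>S. c j * u j i))"
  define \<gamma> where "\<gamma> = (\<lambda>i. if i < d then \<beta> i - h i else 0)"
  have "(\<Sum>i<d. u k i * \<gamma> i) = r k" if "k \<in> S" for k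
  proof -
    have "(\<Sum>i<d. u k i * \<gamma> i) = ip ?D (u k) (\<lambda>i. \<beta> i - h i)"
      unfolding ip_def by (intro sum.cong) (auto simp: \<gamma>_def)
    also have "\<dots> = ip ?D (u k) \<beta>" using c[OF that] by (simp add: ip_diff_right h_def)
    finally show ?thesis using feas[OF that] by (simp add: ip_def)
  qed
  moreover have "\<forall>i\<ge>d. \<gamma> i = 0" by (simp add: \<gamma>_def)
  ultimately have "\<not> (\<Sum>i<d. (\<gamma> i)\<^sup>2) < (\<Sum>i<d. (\<beta> i)\<^sup>2)"
    using \<beta> unfolding is_arg_min_def by blast
  moreover have "(\<Sum>i<d. (\<gamma> i)\<^sup>2) = ip ?D (\<lambda>i. \<beta> i - h i) (\<lambda>i. \<beta> i - h i)"
    unfolding ip_def by (intro sum.cong) (auto simp: \<gamma>_def power2_eq_square)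
  moreover have "ip ?D (\<lambda>i. \<beta> i - h i) (\<lambda>i. \<beta> i - h i) = ip ?D \<beta> \<beta> - 2 * ip ?D (\<lambda>i. \<beta> i - h i) h - ip ?D h h"
    by (simp add: ip_linear ip_commute[of ?D h \<beta>])
  moreover have "ip ?D (\<lambda>i. \<beta> i - h i) h = 0"
  proof -
    have "(\<lambda>i. \<beta> i - h i) = (\<lambda>i. \<Sum>j\<in>S. c j * u j i)" by (simp add: h_def)
    then show ?thesis using c by (simp add: ip_sum_left h_def)
  qed
  moreover have "(\<Sum>i<d. (\<beta> i)\<^sup>2) = ip ?D \<beta> \<beta>" by (simp add: ip_def power2_eq_square)
  ultimately have "ip ?D h h \<le> 0" by linarith
  then have "ip ?D h h = 0" using ip_self_nonneg[of ?D h] by linarith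
  then have "\<forall>i<d. h i = 0" by (simp add: ip_self_eq_0_iff)
  then show ?thesis by (intro exI[of _ c]) (simp add: h_def)
qed

text \<open>Landweber iteration for \<open>U \<beta> = 1\<close>, started at 0. Its limit is the minimum-norm solution, which is
  thereby seen to depend measurably on \<open>U\<close>.\<close>

primrec landweber :: "'k set \<Rightarrow> 'i set \<Rightarrow> ('k \<times> 'i \<Rightarrow> real) \<Rightarrow> nat \<Rightarrow> 'i \<Rightarrow> real" where
  "landweber S D U 0 = (\<lambda>_. 0)"
| "landweber S D U (Suc t) = (\<lambda>i. landweber S D U t i +
     (\<Sum>k\<in>S. U (k, i) * (1 - (\<Sum>j\<in>D. U (k, j) * landweber S D U t j))) / (1 + (\<Sum>k\<in>S. \<Sum>j\<in>D. (U (k, j))\<^sup>2)))"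

lemma measurable_landweber:
  assumes "i \<in> D"
  shows "(\<lambda>U. landweber S D U t i) \<in> borel_measurable (PiM (S \<times> D) (\<lambda>_. borel))"
  using assms
proof (induction t arbitrary: i)
  case (Suc t)
  note [measurable] = Suc.IH
  show ?case using Suc.prems by simp measurable
qed simp

text \<open>The error stays in the row span, with coefficients \<open>q\<close> that are updated by
  a gradient step. Each step lowers the squared length of \<open>q\<close> by at least
  \<open>\<eta>\<close> times the squared error, so the squared errors are summable and tend to 0.
  No lower bound on the spectrum of the Gram matrix enters.\<close>

lemma landweber_tendsto:
  assumes S: "finite S" and D: "finite D"
    and \<beta>: "\<And>i. i \<in> D \<Longrightarrow> \<beta> i = (\<Sum>k\<in>S. c k * U (k, i))"
    and feas: "\<And>k. k \<in> S \<Longrightarrow> (\<Sum>j\<in>D. U (k, j) * \<beta> j) = 1" and i: "i \<in> D"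
  shows "(\<lambda>t. landweber S D U t i) \<longlonglongrightarrow> \<beta> i"
proof -
  define F where "F = (\<Sum>k\<in>S. \<Sum>j\<in>D. (U (k, j))\<^sup>2)"
  have F: "F \<ge> 0" by (simp add: F_def sum_nonneg)
  \<comment> \<open>The step size stays below the inverse of the squared Frobenius norm; the summand
    1 also covers \<open>U = 0\<close>.\<close>
  define \<eta> where "\<eta> = 1 / (1 + F)"
  have \<eta>: "\<eta> > 0" "\<eta> * F \<le> 1" using F by (auto simp: \<eta>_def field_simps)
  define step where "step = (\<lambda>q k. q k - \<eta> * (\<Sum>j\<in>D. U (k, j) * (\<Sum>k'\<in>S. q k' * U (k', j))))"
  define q where "q = (\<lambda>t. (step ^^ t) c)"
  define p where "p = (\<lambda>t j. \<Sum>k\<in>S. q t k * U (k, j))"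
  have qS: "q (Suc t) k = q t k - \<eta> * (\<Sum>j\<in>D. U (k, j) * p t j)" for t k
    by (simp add: q_def step_def p_def)
  have pS: "p (Suc t) j = p t j - \<eta> * (\<Sum>k\<in>S. U (k, j) * (\<Sum>j'\<in>D. U (k, j') * p t j'))" for t j
  proof -
    have "p (Suc t) j = (\<Sum>k\<in>S. q (Suc t) k * U (k, j))" by (simp add: p_def)
    also have "\<dots> = (\<Sum>k\<in>S. q t k * U (k, j) - \<eta> * (U (k, j) * (\<Sum>j'\<in>D. U (k, j') * p t j')))"
      by (intro sum.cong refl) (simp only: qS, simp only: algebra_simps)
    also have "\<dots> = p t j - \<eta> * (\<Sum>k\<in>S. U (k, j) * (\<Sum>j'\<in>D. U (k, j') * p t j'))"
      unfolding sum_subtractf sum_distrib_left[symmetric] by (simp add: p_def)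
    finally show ?thesis .
  qed
  have lw: "\<beta> j - landweber S D U t j = p t j" if "j \<in> D" for t j
    using that
  proof (induction t arbitrary: j)
    case 0
    then show ?case by (simp add: \<beta> p_def q_def)
  next
    case (Suc t)
    have *: "1 - (\<Sum>j\<in>D. U (k, j) * landweber S D U t j) = (\<Sum>j\<in>D. U (k, j) * p t j)" if "k \<in> S" for k
    proof -
      have "(\<Sum>j\<in>D. U (k, j) * p t j) = (\<Sum>j\<in>D. U (k, j) * \<beta> j - U (k, j) * landweber S D U t j)"
        using Suc.IH by (intro sum.cong) (auto simp: algebra_simps simp flip: Suc.IH)
      then show ?thesis using feas[OF that] by (simp add: sum_subtractf)
    qed
    have "(\<Sum>k\<in>S. U (k, j) * (1 - (\<Sum>j\<in>D. U (k, j) * landweber S D U t j))) =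
        (\<Sum>k\<in>S. U (k, j) * (\<Sum>j\<in>D. U (k, j) * p t j))"
      by (intro sum.cong refl) (simp add: *)
    then show ?case
      using Suc.IH[OF Suc.prems] by (simp add: pS \<eta>_def F_def)
  qed
  define N where "N = (\<lambda>t. \<Sum>k\<in>S. (q t k)\<^sup>2)"
  define P where "P = (\<lambda>t. \<Sum>j\<in>D. (p t j)\<^sup>2)"
  have P0: "P t \<ge> 0" for t by (simp add: P_def sum_nonneg)
  have NS: "N (Suc t) \<le> N t - \<eta> * P t" for t
  proof -
    define s where "s = (\<lambda>k. \<Sum>j\<in>D. U (k, j) * p t j)"
    have "N (Suc t) = (\<Sum>k\<in>S. (q t k)\<^sup>2 - 2 * \<eta> * (q t k * s k) + \<eta>\<^sup>2 * (s k)\<^sup>2)"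
      unfolding N_def by (intro sum.cong refl) (simp add: qS s_def power2_eq_square algebra_simps)
    also have "\<dots> = N t - 2 * \<eta> * (\<Sum>k\<in>S. q t k * s k) + \<eta>\<^sup>2 * (\<Sum>k\<in>S. (s k)\<^sup>2)"
      by (simp add: N_def sum.distrib sum_subtractf sum_distrib_left)
    also have "(\<Sum>k\<in>S. q t k * s k) = (\<Sum>k\<in>S. \<Sum>j\<in>D. q t k * U (k, j) * p t j)"
      by (simp add: s_def sum_distrib_left mult.assoc)
    also have "\<dots> = (\<Sum>j\<in>D. \<Sum>k\<in>S. q t k * U (k, j) * p t j)" by (rule sum.swap)
    also have "\<dots> = P t" by (simp add: P_def p_def power2_eq_square sum_distrib_right)
    finally have 1: "N (Suc t) = N t - 2 * \<eta> * P t + \<eta>\<^sup>2 * (\<Sum>k\<in>S. (s k)\<^sup>2)" .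
    have "(\<Sum>k\<in>S. (s k)\<^sup>2) \<le> (\<Sum>k\<in>S. (\<Sum>j\<in>D. (U (k, j))\<^sup>2) * P t)"
      unfolding s_def P_def by (intro sum_mono Cauchy_Schwarz_ineq_sum)
    also have "\<dots> = F * P t" by (simp add: F_def sum_distrib_right)
    finally have "\<eta>\<^sup>2 * (\<Sum>k\<in>S. (s k)\<^sup>2) \<le> \<eta>\<^sup>2 * (F * P t)" by (intro mult_left_mono) auto
    also have "\<dots> = (\<eta> * F) * (\<eta> * P t)" by (simp add: power2_eq_square)
    also have "\<dots> \<le> 1 * (\<eta> * P t)" using \<eta> P0 by (intro mult_right_mono) auto
    finally show ?thesis unfolding 1 by simp
  qed
  have bnd: "N t + (\<Sum>s<t. \<eta> * P s) \<le> N 0" for t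
    by (induction t) (use NS in \<open>auto simp: add.commute intro: order_trans\<close>, smt (verit) NS)
  have "summable (\<lambda>t. \<eta> * P t)"
  proof (rule summableI_nonneg_bounded)
    show "(\<Sum>s<t. \<eta> * P s) \<le> N 0" for t
      using bnd[of t] sum_nonneg[of S "\<lambda>k. (q t k)\<^sup>2"] by (simp add: N_def)
  qed (use \<eta> P0 in auto)
  then have "(\<lambda>t. \<eta> * P t) \<longlonglongrightarrow> 0" by (rule summable_LIMSEQ_zero)
  then have "(\<lambda>t. (1 / \<eta>) * (\<eta> * P t)) \<longlonglongrightarrow> (1 / \<eta>) * 0" by (intro tendsto_intros)
  then have PL: "P \<longlonglongrightarrow> 0" using \<eta> by simp
  have "(p t i)\<^sup>2 \<le> P t" for t unfolding P_def using i D by (intro member_le_sum) auto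
  then have "(\<lambda>t. (p t i)\<^sup>2) \<longlonglongrightarrow> 0"
    by (intro tendsto_sandwich[OF _ _ tendsto_const PL]) auto
  then have "(\<lambda>t. p t i) \<longlonglongrightarrow> 0"
    using tendsto_real_sqrt[of "\<lambda>t. (p t i)\<^sup>2" 0 sequentially] by (simp add: tendsto_rabs_zero_iff)
  then have "(\<lambda>t. \<beta> i - p t i) \<longlonglongrightarrow> \<beta> i - 0" by (intro tendsto_intros)
  moreover have "\<beta> i - p t i = landweber S D U t i" for t using lw[OF i, of t] by simp
  ultimately show ?thesis by simp
qed

section \<open>Whitening the Gaussian draws\<close>

lemma distr_normal_scale:
  assumes "\<sigma> > 0"
  shows "distr (density lborel (normal_density 0 \<sigma>)) borel (\<lambda>x. x / \<sigma>) = std_normal_distribution"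
proof -
  interpret prob_space "density lborel (normal_density 0 \<sigma>)" using assms by (rule prob_space_normal_density)
  have "distributed (density lborel (normal_density 0 \<sigma>)) lborel (\<lambda>x. x) (normal_density 0 \<sigma>)"
    by (auto simp: distributed_def distr_id2)
  then have "distributed (density lborel (normal_density 0 \<sigma>)) lborel (\<lambda>x. (x - 0) / \<sigma>) std_normal_density"
    using normal_standard_normal_convert[OF assms, of "\<lambda>x. x" 0] by simp
  then have "distr (density lborel (normal_density 0 \<sigma>)) lborel (\<lambda>x. x / \<sigma>) = std_normal_distribution"
    by (simp add: distributed_distr_eq_density)
  moreover have "distr (density lborel (normal_density 0 \<sigma>)) lborel (\<lambda>x. x / \<sigma>) =
    distr (density lborel (normal_density 0 \<sigma>)) borel (\<lambda>x. x / \<sigma>)"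
    by (rule distr_cong) auto
  ultimately show ?thesis by simp
qed

text \<open>The draws live on a product of products. Flattening the indices to pairs and rescaling
  yields one standard Gaussian vector, to which the reflection argument applies.\<close>

definition whiten :: "real \<Rightarrow> real \<Rightarrow> real \<Rightarrow> nat \<Rightarrow> (nat \<Rightarrow> nat \<Rightarrow> real) \<Rightarrow> nat \<times> nat \<Rightarrow> real" where
  "whiten p q T n z = (\<lambda>ij\<in>{..<dimD T n} \<times> {..<dimB p n}. z (fst ij) (snd ij) / sqrt (lam p q n (snd ij)))"

lemma
  assumes l: "\<And>j. j < dimB p n \<Longrightarrow> lam p q n j > 0"
  shows measurable_whiten: "whiten p q T n \<in> Zspace p q T n \<rightarrow>\<^sub>M gaussPi ({..<dimD T n} \<times> {..<dimB p n})" (is ?m)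
    and distr_whiten: "distr (Zspace p q T n) (gaussPi ({..<dimD T n} \<times> {..<dimB p n})) (whiten p q T n) =
      gaussPi ({..<dimD T n} \<times> {..<dimB p n})" (is ?d)
    and prob_space_Zspace: "prob_space (Zspace p q T n)" (is ?p)
proof -
  define D where "D = {..<dimD T n}"
  define B where "B = {..<dimB p n}"
  define \<sigma> where "\<sigma> = (\<lambda>j. sqrt (lam p q n j))"
  \<comment> \<open>Outside \<open>B\<close> the standard deviation may be 0, so a default value
    keeps the factor a probability measure at every index.\<close>
  define N where "N = (\<lambda>j. if j \<in> B then density lborel (normal_density 0 (\<sigma> j)) else std_normal_distribution)"
  have \<sigma>: "\<sigma> j > 0" if "j \<in> B" for j using l that by (auto simp: \<sigma>_def B_def)
  have N: "prob_space (N j)" for j using \<sigma> by (auto simp: N_def intro!: prob_space_normal_density)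
  have Z: "Zspace p q T n = PiM D (\<lambda>_. PiM B N)"
    unfolding Zspace_def D_def B_def by (intro PiM_cong refl) (auto simp: N_def B_def \<sigma>_def)
  interpret N: product_prob_space N by (simp add: product_prob_space_def product_sigma_finite_def
      product_prob_space_axioms_def N prob_space_imp_sigma_finite)
  have R: "prob_space (PiM B N)" by (intro prob_space_PiM N)
  interpret R: product_prob_space "\<lambda>_::nat. PiM B N" by (simp add: product_prob_space_def product_sigma_finite_def
      product_prob_space_axioms_def R prob_space_imp_sigma_finite)
  interpret std: prob_space std_normal_distribution by (intro prob_space_normal_density) simp
  interpret G: product_sigma_finite "\<lambda>_::nat \<times> nat. std_normal_distribution" by standard
  show ?p unfolding Z by (intro prob_space_PiM R)
  have setsN: "sets (PiM B N) = sets (PiM B (\<lambda>_. borel))"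
    by (intro sets_PiM_cong) (auto simp: N_def)
  have setsZ: "sets (PiM D (\<lambda>_. PiM B N)) = sets (PiM D (\<lambda>_. PiM B (\<lambda>_. borel)))"
    by (intro sets_PiM_cong setsN refl)
  have "whiten p q T n \<in> PiM D (\<lambda>_. PiM B (\<lambda>_. borel)) \<rightarrow>\<^sub>M PiM (D \<times> B) (\<lambda>_. borel)"
    unfolding whiten_def D_def[symmetric] B_def[symmetric]
  proof (intro measurable_restrict borel_measurable_divide borel_measurable_const)
    fix ij assume "ij \<in> D \<times> B"
    then have "(\<lambda>z. z (fst ij)) \<in> PiM D (\<lambda>_. PiM B (\<lambda>_. borel)) \<rightarrow>\<^sub>M PiM B (\<lambda>_. borel :: real measure)"
      "(\<lambda>h. h (snd ij)) \<in> PiM B (\<lambda>_. borel :: real measure) \<rightarrow>\<^sub>M borel"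
      by auto
    then show "(\<lambda>z. z (fst ij) (snd ij)) \<in> borel_measurable (PiM D (\<lambda>_. PiM B (\<lambda>_. borel :: real measure)))"
      by (rule measurable_compose)
  qed
  then show m: ?m
    unfolding Z D_def[symmetric] B_def[symmetric]
    using measurable_cong_sets[OF setsZ, of "gaussPi (D \<times> B)" "PiM (D \<times> B) (\<lambda>_. borel)"]
    by (auto cong: sets_PiM_cong)
  have "distr (Zspace p q T n) (gaussPi (D \<times> B)) (whiten p q T n) = gaussPi (D \<times> B)"
  proof (rule G.PiM_eqI)
    show "finite (D \<times> B)" by (simp add: D_def B_def)
    fix A :: "nat \<times> nat \<Rightarrow> real set" assume A: "\<And>ij. ij \<in> D \<times> B \<Longrightarrow> A ij \<in> sets std_normal_distribution"
    define A' where "A' = (\<lambda>i j. {x. x / \<sigma> j \<in> A (i, j)})"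
    have A': "A' i j \<in> sets (N j)" if "i \<in> D" "j \<in> B" for i j
    proof -
      have "A (i, j) \<in> sets borel" using A[of "(i, j)"] that by simp
      then have "(\<lambda>x. x / \<sigma> j) -` A (i, j) \<inter> space borel \<in> sets borel" by measurable
      then show ?thesis using that by (simp add: A'_def N_def vimage_def)
    qed
    have eN: "emeasure (N j) (A' i j) = emeasure std_normal_distribution (A (i, j))" if "i \<in> D" "j \<in> B" for i j
    proof -
      have "emeasure std_normal_distribution (A (i, j)) = emeasure (distr (N j) borel (\<lambda>x. x / \<sigma> j)) (A (i, j))"
        using distr_normal_scale[OF \<sigma>[OF that(2)]] that by (simp add: N_def)
      also have "\<dots> = emeasure (N j) ((\<lambda>x. x / \<sigma> j) -` A (i, j) \<inter> space (N j))"
        using A[of "(i, j)"] that by (intro emeasure_distr) (auto simp: N_def)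
      finally show ?thesis using that by (simp add: A'_def N_def vimage_def)
    qed
    have pre: "whiten p q T n -` (Pi\<^sub>E (D \<times> B) A) \<inter> space (PiM D (\<lambda>_. PiM B N)) = Pi\<^sub>E D (\<lambda>i. Pi\<^sub>E B (A' i))"
      unfolding whiten_def D_def[symmetric] B_def[symmetric] \<sigma>_def[symmetric]
      by (auto simp: space_PiM PiE_def Pi_def A'_def \<sigma>_def N_def extensional_def split: if_splits)
    have "emeasure (distr (Zspace p q T n) (gaussPi (D \<times> B)) (whiten p q T n)) (Pi\<^sub>E (D \<times> B) A) =
      emeasure (PiM D (\<lambda>_. PiM B N)) (Pi\<^sub>E D (\<lambda>i. Pi\<^sub>E B (A' i)))"
      using m A unfolding pre[symmetric] Z[symmetric] D_def[symmetric] B_def[symmetric]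
      by (intro emeasure_distr sets_PiM_I_finite) (auto simp: D_def B_def)
    also have "\<dots> = (\<Prod>i\<in>D. emeasure (PiM B N) (Pi\<^sub>E B (A' i)))"
      using A' by (intro R.emeasure_PiM) (auto simp: D_def B_def intro!: sets_PiM_I_finite)
    also have "\<dots> = (\<Prod>i\<in>D. \<Prod>j\<in>B. emeasure (N j) (A' i j))"
      using A' by (intro prod.cong refl N.emeasure_PiM) (auto simp: B_def)
    also have "\<dots> = (\<Prod>i\<in>D. \<Prod>j\<in>B. emeasure std_normal_distribution (A (i, j)))"
      by (intro prod.cong refl eN) auto
    also have "\<dots> = (\<Prod>ij\<in>D \<times> B. emeasure std_normal_distribution (A ij))"
      by (simp add: prod.cartesian_product case_prod_beta')
    finally show "emeasure (distr (Zspace p q T n) (gaussPi (D \<times> B)) (whiten p q T n)) (Pi\<^sub>E (D \<times> B) A) =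
      (\<Prod>ij\<in>D \<times> B. emeasure std_normal_distribution (A ij))" .
  qed simp
  then show ?d by (simp add: D_def B_def)
qed

section \<open>The Fourier kernel and the interpolant\<close>

lemma dirichlet_kernel_cos:
  "2 * sin (t / 2) * (\<Sum>f=1..K. cos (real f * t)) = sin ((real K + 1 / 2) * t) - sin (t / 2)"
proof (induction K)
  case (Suc K)
  have "2 * sin (t / 2) * cos (real (Suc K) * t) = sin (real (Suc K) * t + t / 2) - sin (real (Suc K) * t - t / 2)"
    by (simp add: sin_add sin_diff)
  also have "real (Suc K) * t + t / 2 = (real (Suc K) + 1 / 2) * t" by (simp add: algebra_simps)
  also have "real (Suc K) * t - t / 2 = (real K + 1 / 2) * t" by (simp add: algebra_simps)
  finally show ?case using Suc by (simp add: distrib_left)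
qed simp

lemma dirichlet_kernel_sin:
  "2 * sin (t / 2) * (\<Sum>f=1..K. sin (real f * t)) = cos (t / 2) - cos ((real K + 1 / 2) * t)"
proof (induction K)
  case (Suc K)
  have "2 * sin (t / 2) * sin (real (Suc K) * t) = cos (real (Suc K) * t - t / 2) - cos (real (Suc K) * t + t / 2)"
    by (simp add: cos_add cos_diff)
  also have "real (Suc K) * t + t / 2 = (real (Suc K) + 1 / 2) * t" by (simp add: algebra_simps)
  also have "real (Suc K) * t - t / 2 = (real K + 1 / 2) * t" by (simp add: algebra_simps)
  finally show ?case using Suc by (simp add: distrib_left)
qed simp

lemma abs_sum_cos_le:
  assumes "sin (t / 2) \<noteq> 0"
  shows "\<bar>\<Sum>f=1..K. cos (real f * t)\<bar> \<le> 1 / 2 + 1 / (2 * \<bar>sin (t / 2)\<bar>)"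
proof -
  have "(\<Sum>f=1..K. cos (real f * t)) = (sin ((real K + 1 / 2) * t) - sin (t / 2)) / (2 * sin (t / 2))"
    using dirichlet_kernel_cos[of t K] assms by (simp add: field_simps)
  also have "\<bar>\<dots>\<bar> = \<bar>sin ((real K + 1 / 2) * t) - sin (t / 2)\<bar> / (2 * \<bar>sin (t / 2)\<bar>)"
    by (simp add: abs_mult)
  also have "\<dots> \<le> (1 + \<bar>sin (t / 2)\<bar>) / (2 * \<bar>sin (t / 2)\<bar>)"
  proof (intro divide_right_mono)
    have "\<bar>sin ((real K + 1 / 2) * t)\<bar> \<le> 1" by (rule abs_sin_le_one)
    then show "\<bar>sin ((real K + 1 / 2) * t) - sin (t / 2)\<bar> \<le> 1 + \<bar>sin (t / 2)\<bar>" by linarith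
  qed simp
  also have "\<dots> = 1 / 2 + 1 / (2 * \<bar>sin (t / 2)\<bar>)" using assms by (simp add: field_simps)
  finally show ?thesis .
qed

text \<open>After multiplication by the squared sine each Dirichlet kernel becomes
  \<open>sin (a - b) * sin (a + b)\<close>, a difference of consecutive squares, and the sum
  telescopes.\<close>

lemma fejer_kernel:
  "(sin (t / 2))\<^sup>2 * (\<Sum>m<n. 1 + 2 * (\<Sum>k=1..m. cos (real k * t))) = (sin (real n * t / 2))\<^sup>2"
proof (induction n)
  case (Suc n)
  have "(sin (t / 2))\<^sup>2 * (1 + 2 * (\<Sum>k=1..n. cos (real k * t))) =
      sin (t / 2) * (sin (t / 2) + 2 * sin (t / 2) * (\<Sum>k=1..n. cos (real k * t)))"
    by (simp add: power2_eq_square algebra_simps)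
  also have "\<dots> = sin (t / 2) * sin ((real n + 1 / 2) * t)"
    by (simp only: dirichlet_kernel_cos) simp
  also have "\<dots> = sin (real (Suc n) * t / 2 - real n * t / 2) * sin (real (Suc n) * t / 2 + real n * t / 2)"
    by (intro arg_cong2[where f="(*)"] arg_cong[where f=sin]) (simp_all add: field_simps)
  also have "\<dots> = (sin (real (Suc n) * t / 2))\<^sup>2 - (sin (real n * t / 2))\<^sup>2"
  proof -
    have "sin (a - b) * sin (a + b) = (sin a)\<^sup>2 - (sin b)\<^sup>2" for a b :: real
    proof -
      have "sin (a - b) * sin (a + b) = (sin a)\<^sup>2 * (cos b)\<^sup>2 - (cos a)\<^sup>2 * (sin b)\<^sup>2"
        by (simp add: sin_add sin_diff power2_eq_square algebra_simps)
      then show ?thesis by (simp add: cos_squared_eq algebra_simps)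
    qed
    then show ?thesis .
  qed
  finally show ?case using Suc by (simp add: distrib_left)
qed simp

lemma sin_pi_frac_eq_0_iff:
  assumes "n > 0"
  shows "sin (pi * real_of_int j / real n) = 0 \<longleftrightarrow> int n dvd j"
proof
  assume "sin (pi * real_of_int j / real n) = 0"
  then obtain i where "pi * real_of_int j / real n = of_int i * pi" by (auto simp: sin_zero_iff_int2)
  then have "real_of_int j = real_of_int (i * int n)" using assms by (simp add: field_simps)
  then have "j = i * int n" by (metis of_int_eq_iff)
  then show "int n dvd j" by simp
next
  assume "int n dvd j"
  then obtain i where "j = int n * i" by auto
  then show "sin (pi * real_of_int j / real n) = 0" using assms by (simp add: sin_zero_iff_int2 mult.commute)
qed

text \<open>After a whole number of periods the endpoint term of the Dirichlet formula has returned
  to its starting value, so the two terms of the closed form cancel.\<close>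

lemma
  assumes n: "n > 0" and j: "\<not> int n dvd j"
  shows sum_cos_full_period: "(\<Sum>f=1..M * n. cos (real f * (2 * pi * real_of_int j / real n))) = 0" (is ?c)
    and sum_sin_full_period: "(\<Sum>f=1..M * n. sin (real f * (2 * pi * real_of_int j / real n))) = 0" (is ?s)
proof -
  let ?t = "2 * pi * real_of_int j / real n"
  have s0: "sin (?t / 2) \<noteq> 0" using sin_pi_frac_eq_0_iff[OF n, of j] j by simp
  have e: "(real (M * n) + 1 / 2) * ?t = ?t / 2 + 2 * pi * of_int (int M * j)"
    using n by (simp add: field_simps)
  have "sin ((real (M * n) + 1 / 2) * ?t) = sin (?t / 2)" "cos ((real (M * n) + 1 / 2) * ?t) = cos (?t / 2)"
    unfolding e sin_add cos_add sin_int_2pin cos_int_2pin by simp_all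
  then show ?c ?s using dirichlet_kernel_cos[of ?t "M * n"] dirichlet_kernel_sin[of ?t "M * n"] s0 by auto
qed

text \<open>Aliasing: on the grid a frequency not divisible by \<open>n\<close> runs through full
  periods and cancels, while a multiple of \<open>n\<close> takes the same value at every training
  input.\<close>

lemma sum_cos_xtrain:
  assumes n: "n > 0"
  shows "(\<Sum>i=1..n. cos (real f * pi * (x - xtrain n i))) = (if n dvd f then real n * cos (real f * pi * (x + 1)) else 0)"
proof -
  have arg: "real f * pi * (x - xtrain n i) = real f * pi * (x + 1) - real i * (2 * pi * real_of_int (int f) / real n)" for i
    using n by (simp add: xtrain_def field_simps)
  have eq: "(\<Sum>i=1..n. cos (real f * pi * (x - xtrain n i))) =
    cos (real f * pi * (x + 1)) * (\<Sum>i=1..n. cos (real i * (2 * pi * real_of_int (int f) / real n))) +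
    sin (real f * pi * (x + 1)) * (\<Sum>i=1..n. sin (real i * (2 * pi * real_of_int (int f) / real n)))"
    unfolding arg cos_diff by (simp add: sum.distrib sum_distrib_left)
  show ?thesis
  proof (cases "n dvd f")
    case True
    then obtain m where m: "f = n * m" by auto
    have "real i * (2 * pi * real_of_int (int f) / real n) = 2 * pi * of_int (int (i * m))" for i
      using n by (simp add: m)
    then have "cos (real i * (2 * pi * real_of_int (int f) / real n)) = 1"
      "sin (real i * (2 * pi * real_of_int (int f) / real n)) = 0" for i
      by (simp_all only: cos_int_2pin sin_int_2pin)
    then show ?thesis unfolding eq using True by simp
  next
    case False
    then have "\<not> int n dvd int f" by simp
    then show ?thesis unfolding eq
      using sum_cos_full_period[OF n, of "int f" 1] sum_sin_full_period[OF n, of "int f" 1] False by simp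
  qed
qed

text \<open>At the shifts \<open>y - xtrain n i\<close> the numerator of the Fejer kernel does not
  depend on \<open>i\<close>, so the reciprocal squared sines are Fejer sums over a common
  denominator. Summed over the grid, these keep only their constant terms, because all their
  frequencies are below \<open>n\<close>.\<close>

lemma sum_inverse_sin_squared_xtrain:
  assumes n: "n > 0" and s: "sin (real n * pi * (y + 1) / 2) \<noteq> 0"
  shows "(\<Sum>i=1..n. 1 / (sin (pi * (y - xtrain n i) / 2))\<^sup>2) = (real n)\<^sup>2 / (sin (real n * pi * (y + 1) / 2))\<^sup>2"
    and "i \<in> {1..n} \<Longrightarrow> sin (pi * (y - xtrain n i) / 2) \<noteq> 0"
proof -
  let ?s = "sin (real n * pi * (y + 1) / 2)"
  define t where "t = (\<lambda>i. pi * (y - xtrain n i))"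
  have nt: "(sin (real n * t i / 2))\<^sup>2 = ?s\<^sup>2" for i
  proof -
    have "real n * t i / 2 = real n * pi * (y + 1) / 2 - pi * of_int (int i)"
      using n by (simp add: t_def xtrain_def field_simps)
    then have "sin (real n * t i / 2) = ?s * cos (pi * of_int (int i)) - cos (real n * pi * (y + 1) / 2) * sin (pi * of_int (int i))"
      by (simp only: sin_diff)
    moreover have "sin (pi * of_int (int i)) = 0" by (simp add: sin_zero_iff_int2 mult.commute)
    ultimately show ?thesis using sin_cos_squared_add[of "pi * of_int (int i)"]
      by (simp add: power_mult_distrib)
  qed
  have fe: "(sin (t i / 2))\<^sup>2 * (\<Sum>m<n. 1 + 2 * (\<Sum>k=1..m. cos (real k * t i))) = ?s\<^sup>2" for i
    unfolding fejer_kernel nt ..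
  have ne: "sin (t i / 2) \<noteq> 0" for i using fe[of i] s by auto
  then show "sin (pi * (y - xtrain n i) / 2) \<noteq> 0" by (simp add: t_def)
  have "(\<Sum>i=1..n. 1 / (sin (t i / 2))\<^sup>2) = (\<Sum>i=1..n. (\<Sum>m<n. 1 + 2 * (\<Sum>k=1..m. cos (real k * t i))) / ?s\<^sup>2)"
  proof (rule sum.cong[OF refl])
    fix i
    show "1 / (sin (t i / 2))\<^sup>2 = (\<Sum>m<n. 1 + 2 * (\<Sum>k=1..m. cos (real k * t i))) / ?s\<^sup>2"
      unfolding fe[of i, symmetric] using ne[of i] fe[of i] s by (auto simp: field_simps)
  qed
  also have "\<dots> = (\<Sum>i=1..n. \<Sum>m<n. 1 + 2 * (\<Sum>k=1..m. cos (real k * t i))) / ?s\<^sup>2"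
    by (simp add: sum_divide_distrib)
  also have "(\<Sum>i=1..n. \<Sum>m<n. 1 + 2 * (\<Sum>k=1..m. cos (real k * t i))) =
      (\<Sum>m<n. \<Sum>i=1..n. 1 + 2 * (\<Sum>k=1..m. cos (real k * t i)))" by (rule sum.swap)
  also have "\<dots> = (\<Sum>m<n. real n)"
  proof (rule sum.cong[OF refl])
    fix m assume m: "m \<in> {..<n}"
    have "(\<Sum>i=1..n. \<Sum>k=1..m. cos (real k * t i)) = (\<Sum>k=1..m. \<Sum>i=1..n. cos (real k * pi * (y - xtrain n i)))"
      by (subst sum.swap) (simp add: t_def mult.assoc)
    also have "\<dots> = 0"
      unfolding sum_cos_xtrain[OF n] using m by (intro sum.neutral) (auto dest: dvd_imp_le)
    finally have "(\<Sum>i=1..n. \<Sum>k=1..m. cos (real k * t i)) = 0" .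
    then show "(\<Sum>i=1..n. 1 + 2 * (\<Sum>k=1..m. cos (real k * t i))) = real n"
      by (simp add: sum.distrib flip: sum_distrib_left)
  qed
  finally show "(\<Sum>i=1..n. 1 / (sin (pi * (y - xtrain n i) / 2))\<^sup>2) = (real n)\<^sup>2 / ?s\<^sup>2"
    by (simp add: t_def power2_eq_square)
qed

lemma sum_dimB: "(\<Sum>j<dimB p n. h j) = (h 0 :: real) + (\<Sum>f=1..nfreq p n. h (2 * f - Suc 0) + h (2 * f))"
proof -
  have "(\<Sum>j<2 * K + 1. h j) = h 0 + (\<Sum>f=1..K. h (2 * f - Suc 0) + h (2 * f))" for K
    by (induction K) auto
  then show ?thesis by (simp add: dimB_def)
qed

lemma phi_simps:
  "phi x 0 = 1 / sqrt 2"
  "f \<ge> 1 \<Longrightarrow> phi x (2 * f - Suc 0) = sin (real f * pi * x)"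
  "f \<ge> 1 \<Longrightarrow> phi x (2 * f) = cos (real f * pi * x)"
  by (auto simp: phi_def)

lemma lam_freq: "f \<ge> 1 \<Longrightarrow> lam p q n (2 * f - Suc 0) = (1 - gam q n) * real (dimB p n) / (real (dimB p n) - 1)"
  "f \<ge> 1 \<Longrightarrow> lam p q n (2 * f) = (1 - gam q n) * real (dimB p n) / (real (dimB p n) - 1)"
  by (auto simp: lam_def)

section \<open>The feature kernel and its aliased form\<close>

definition cfreq :: "real \<Rightarrow> real \<Rightarrow> nat \<Rightarrow> real" where
  "cfreq p q n = (1 - gam q n) * real (dimB p n) / (real (dimB p n) - 1)"

text \<open>The contribution of the constant feature to the kernel; the half is the square of
  \<open>phi x 0\<close>.\<close>

definition cnst :: "real \<Rightarrow> real \<Rightarrow> nat \<Rightarrow> real" where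
  "cnst p q n = gam q n * real (dimB p n) / 2"

text \<open>Counts the frequencies divisible by \<open>n\<close>, the ones that survive summation
  over the training inputs.\<close>

definition nalias :: "real \<Rightarrow> nat \<Rightarrow> nat" where
  "nalias p n = nfreq p n div n"

definition kern :: "real \<Rightarrow> real \<Rightarrow> nat \<Rightarrow> real \<Rightarrow> real \<Rightarrow> real" where
  "kern p q n x y = (\<Sum>j<dimB p n. lam p q n j * phi x j * phi y j)"

lemma kern_eq: "kern p q n x y = cnst p q n + cfreq p q n * (\<Sum>f=1..nfreq p n. cos (real f * pi * (x - y)))"
proof -
  have "kern p q n x y = lam p q n 0 * phi x 0 * phi y 0 +
     (\<Sum>f=1..nfreq p n. lam p q n (2 * f - Suc 0) * phi x (2 * f - Suc 0) * phi y (2 * f - Suc 0) + lam p q n (2 * f) * phi x (2 * f) * phi y (2 * f))"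
    unfolding kern_def by (rule sum_dimB)
  also have "lam p q n 0 * phi x 0 * phi y 0 = cnst p q n" by (simp add: phi_simps lam_def cnst_def)
  also have "(\<Sum>f=1..nfreq p n. lam p q n (2 * f - Suc 0) * phi x (2 * f - Suc 0) * phi y (2 * f - Suc 0) + lam p q n (2 * f) * phi x (2 * f) * phi y (2 * f)) =
    (\<Sum>f=1..nfreq p n. cfreq p q n * cos (real f * pi * (x - y)))"
  proof (intro sum.cong refl)
    fix f assume "f \<in> {1..nfreq p n}"
    then have f: "f \<ge> 1" by simp
    show "lam p q n (2 * f - Suc 0) * phi x (2 * f - Suc 0) * phi y (2 * f - Suc 0) + lam p q n (2 * f) * phi x (2 * f) * phi y (2 * f) =
       cfreq p q n * cos (real f * pi * (x - y))"
      unfolding phi_simps(2,3)[OF f] lam_freq[OF f] cfreq_def[symmetric] right_diff_distrib cos_diff by (simp add: algebra_simps)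
  qed
  finally show ?thesis by (simp add: sum_distrib_left)
qed

lemma sum_phi_squared: "(\<Sum>j<dimB p n. (phi x j)\<^sup>2) = 1 / 2 + real (nfreq p n)"
proof -
  have "(\<Sum>j<dimB p n. (phi x j)\<^sup>2) = (phi x 0)\<^sup>2 + (\<Sum>f=1..nfreq p n. (phi x (2 * f - Suc 0))\<^sup>2 + (phi x (2 * f))\<^sup>2)"
    by (rule sum_dimB)
  also have "(\<Sum>f=1..nfreq p n. (phi x (2 * f - Suc 0))\<^sup>2 + (phi x (2 * f))\<^sup>2) = (\<Sum>f=1..nfreq p n. 1)"
    by (intro sum.cong refl) (auto simp: phi_simps)
  finally show ?thesis by (simp add: phi_simps power_divide)
qed

lemma sum_kern_xtrain:
  assumes n: "n > 0"
  shows "(\<Sum>k=1..n. kern p q n x (xtrain n k)) =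
    real n * (cnst p q n + cfreq p q n * (\<Sum>m=1..nalias p n. cos (real m * (real n * pi * (x + 1)))))"
proof -
  have "(\<Sum>k=1..n. kern p q n x (xtrain n k)) = real n * cnst p q n +
      cfreq p q n * (\<Sum>k=1..n. \<Sum>f=1..nfreq p n. cos (real f * pi * (x - xtrain n k)))"
    unfolding kern_eq by (simp add: sum.distrib sum_distrib_left)
  also have "(\<Sum>k=1..n. \<Sum>f=1..nfreq p n. cos (real f * pi * (x - xtrain n k))) =
      (\<Sum>f=1..nfreq p n. \<Sum>k=1..n. cos (real f * pi * (x - xtrain n k)))" by (rule sum.swap)
  also have "\<dots> = (\<Sum>f=1..nfreq p n. if n dvd f then real n * cos (real f * pi * (x + 1)) else 0)"
    unfolding sum_cos_xtrain[OF n] ..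
  also have "\<dots> = (\<Sum>f\<in>(\<lambda>m. m * n) ` {1..nalias p n}. real n * cos (real f * pi * (x + 1)))"
  proof (rule sum.mono_neutral_cong_right)
    show "(\<lambda>m. m * n) ` {1..nalias p n} \<subseteq> {1..nfreq p n}"
      using n by (auto simp: nalias_def less_eq_div_iff_mult_less_eq)
    show "\<forall>i\<in>{1..nfreq p n} - (\<lambda>m. m * n) ` {1..nalias p n}. (if n dvd i then real n * cos (real i * pi * (x + 1)) else 0) = 0"
    proof
      fix i assume i: "i \<in> {1..nfreq p n} - (\<lambda>m. m * n) ` {1..nalias p n}"
      have "\<not> n dvd i"
      proof
        assume "n dvd i"
        then have "i = (i div n) * n" by simp
        moreover have "i div n \<in> {1..nalias p n}" using i n \<open>n dvd i\<close>
          by (auto simp: nalias_def div_le_mono Suc_leI dvd_imp_le div_greater_zero_iff)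
        ultimately show False using i by blast
      qed
      then show "(if n dvd i then real n * cos (real i * pi * (x + 1)) else 0) = 0" by simp
    qed
  qed auto
  also have "\<dots> = (\<Sum>m=1..nalias p n. real n * cos (real m * (real n * pi * (x + 1))))"
    using n by (subst sum.reindex) (auto simp: inj_on_def mult.assoc)
  finally show ?thesis by (simp add: sum_distrib_left distrib_left algebra_simps)
qed

lemma cos_xtrain_alias:
  assumes "n > 0"
  shows "cos (real m * (real n * pi * (xtrain n i + 1))) = 1"
proof -
  have "real m * (real n * pi * (xtrain n i + 1)) = 2 * pi * of_int (int (m * i))"
    using assms by (simp add: xtrain_def)
  then show ?thesis by (simp only: cos_int_2pin)
qed

text \<open>All rows of the kernel matrix on the grid have the same sum, so a constant vector solves
  the dual system: every training input carries the same weight \<open>b\<close>. The interpolant is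
  then a plain sum of kernels, which aliasing collapses.\<close>

lemma fhat_eq:
  assumes n: "n > 0" and l: "\<And>j. j < dimB p n \<Longrightarrow> lam p q n j > 0"
    and pos: "cnst p q n + cfreq p q n * nalias p n > 0"
  shows "fhat p q n x = (cnst p q n + cfreq p q n * (\<Sum>m=1..nalias p n. cos (real m * (real n * pi * (x + 1))))) /
     (cnst p q n + cfreq p q n * nalias p n)"
proof -
  define b where "b = 1 / (real n * (cnst p q n + cfreq p q n * nalias p n))"
  define u where "u = (\<lambda>k j. phi (xtrain n k) j)"
  define \<alpha>0 where "\<alpha>0 = (\<lambda>j. if j < dimB p n then lam p q n j * (\<Sum>k\<in>{1..n}. b * u k j) else 0)"
  have inner: "(\<Sum>j<dimB p n. phi y j * \<alpha>0 j) = b * (\<Sum>k=1..n. kern p q n y (xtrain n k))" for y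
  proof -
    have "(\<Sum>j<dimB p n. phi y j * \<alpha>0 j) = (\<Sum>j<dimB p n. \<Sum>k=1..n. b * (lam p q n j * phi y j * phi (xtrain n k) j))"
      by (intro sum.cong refl) (auto simp: \<alpha>0_def u_def sum_distrib_left intro!: sum.cong)
    also have "\<dots> = (\<Sum>k=1..n. \<Sum>j<dimB p n. b * (lam p q n j * phi y j * phi (xtrain n k) j))"
      by (rule sum.swap)
    finally show ?thesis by (simp add: kern_def sum_distrib_left)
  qed
  have feas: "(\<Sum>j<dimB p n. u k j * \<alpha>0 j) = 1" if "k \<in> {1..n}" for k
    unfolding u_def inner sum_kern_xtrain[OF n] cos_xtrain_alias[OF n]
    using n pos by (simp add: b_def)
  have "alpha_hat p q n = \<alpha>0"
    using arg_min_weighted_norm[of "{1..n}" "dimB p n" "lam p q n" \<alpha>0 "\<lambda>_. b" u "\<lambda>_. 1"] l feas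
    by (simp add: alpha_hat_def \<alpha>0_def u_def)
  then have "fhat p q n x = (\<Sum>j<dimB p n. phi x j * \<alpha>0 j)" by (simp add: fhat_def mult.commute)
  also have "\<dots> = (cnst p q n + cfreq p q n * (\<Sum>m=1..nalias p n. cos (real m * (real n * pi * (x + 1))))) /
     (cnst p q n + cfreq p q n * nalias p n)"
    unfolding inner sum_kern_xtrain[OF n] using n by (simp add: b_def)
  finally show ?thesis .
qed

text \<open>Parseval's identity: over a multiple of \<open>n\<close> consecutive frequencies the
  cross terms between distinct training inputs cancel.\<close>

lemma sum_energy_full_periods:
  assumes n: "n > 0"
  shows "(\<Sum>f=1..M * n. (\<Sum>k=1..n. a k * sin (real f * pi * xtrain n k))\<^sup>2 + (\<Sum>k=1..n. a k * cos (real f * pi * xtrain n k))\<^sup>2)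
    = real (M * n) * (\<Sum>k=1..n. (a k)\<^sup>2)"
proof -
  have "(\<Sum>f=1..M * n. (\<Sum>k=1..n. a k * sin (real f * pi * xtrain n k))\<^sup>2 + (\<Sum>k=1..n. a k * cos (real f * pi * xtrain n k))\<^sup>2)
     = (\<Sum>f=1..M * n. \<Sum>k=1..n. \<Sum>k'=1..n. a k * a k' * cos (real f * pi * (xtrain n k - xtrain n k')))"
  proof (rule sum.cong[OF refl])
    fix f
    show "(\<Sum>k=1..n. a k * sin (real f * pi * xtrain n k))\<^sup>2 + (\<Sum>k=1..n. a k * cos (real f * pi * xtrain n k))\<^sup>2 =
      (\<Sum>k=1..n. \<Sum>k'=1..n. a k * a k' * cos (real f * pi * (xtrain n k - xtrain n k')))"
      unfolding right_diff_distrib cos_diff power2_eq_square sum_product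
      by (simp add: sum.distrib[symmetric] algebra_simps)
  qed
  also have "\<dots> = (\<Sum>k=1..n. \<Sum>f=1..M * n. \<Sum>k'=1..n. a k * a k' * cos (real f * pi * (xtrain n k - xtrain n k')))"
    by (rule sum.swap)
  also have "\<dots> = (\<Sum>k=1..n. \<Sum>k'=1..n. \<Sum>f=1..M * n. a k * a k' * cos (real f * pi * (xtrain n k - xtrain n k')))"
    by (intro sum.cong refl sum.swap)
  also have "\<dots> = (\<Sum>k=1..n. \<Sum>k'=1..n. if k' = k then real (M * n) * (a k)\<^sup>2 else 0)"
  proof (intro sum.cong refl)
    fix k k' assume k: "k \<in> {1..n}" "k' \<in> {1..n}"
    have arg: "real f * pi * (xtrain n k - xtrain n k') = real f * (2 * pi * real_of_int (int k - int k') / real n)" for f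
      using n by (simp add: xtrain_def field_simps)
    show "(\<Sum>f=1..M * n. a k * a k' * cos (real f * pi * (xtrain n k - xtrain n k'))) =
      (if k' = k then real (M * n) * (a k)\<^sup>2 else 0)"
    proof (cases "k' = k")
      case False
      have "\<not> int n dvd (int k - int k')"
      proof
        assume "int n dvd (int k - int k')"
        then have "\<bar>int n\<bar> \<le> \<bar>int k - int k'\<bar>" using False by (intro dvd_imp_le_int) auto
        then show False using k by auto
      qed
      then show ?thesis
        unfolding sum_distrib_left[symmetric] arg sum_cos_full_period[OF n \<open>\<not> int n dvd (int k - int k')\<close>] using False by simp
    qed (simp add: power2_eq_square)
  qed
  also have "\<dots> = real (M * n) * (\<Sum>k=1..n. (a k)\<^sup>2)" by (simp add: sum_distrib_left)
  finally show ?thesis .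
qed

text \<open>Only complete blocks of \<open>n\<close> frequencies are kept; what is dropped is
  nonnegative.\<close>

lemma quad_form_lower:
  assumes n: "n > 0" and c: "cfreq p q n \<ge> 0" "cnst p q n \<ge> 0"
  shows "cfreq p q n * real (nalias p n * n) * (\<Sum>k=1..n. (a k)\<^sup>2) \<le>
    (\<Sum>j<dimB p n. lam p q n j * (\<Sum>k=1..n. a k * phi (xtrain n k) j)\<^sup>2)"
proof -
  let ?E = "\<lambda>f. (\<Sum>k=1..n. a k * sin (real f * pi * xtrain n k))\<^sup>2 + (\<Sum>k=1..n. a k * cos (real f * pi * xtrain n k))\<^sup>2"
  have "cfreq p q n * real (nalias p n * n) * (\<Sum>k=1..n. (a k)\<^sup>2) = cfreq p q n * (\<Sum>f=1..nalias p n * n. ?E f)"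
    unfolding sum_energy_full_periods[OF n] by simp
  also have "\<dots> \<le> cfreq p q n * (\<Sum>f=1..nfreq p n. ?E f)"
    using c by (intro mult_left_mono sum_mono2) (auto simp: nalias_def intro: order_trans[OF _ div_times_less_eq_dividend])
  also have "\<dots> = (\<Sum>f=1..nfreq p n. lam p q n (2 * f - Suc 0) * (\<Sum>k=1..n. a k * phi (xtrain n k) (2 * f - Suc 0))\<^sup>2 +
      lam p q n (2 * f) * (\<Sum>k=1..n. a k * phi (xtrain n k) (2 * f))\<^sup>2)"
    unfolding sum_distrib_left by (intro sum.cong refl) (auto simp: phi_simps lam_freq cfreq_def distrib_left)
  also have "\<dots> \<le> (\<Sum>j<dimB p n. lam p q n j * (\<Sum>k=1..n. a k * phi (xtrain n k) j)\<^sup>2)"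
    unfolding sum_dimB using c by (simp add: lam_def cnst_def)
  finally show ?thesis .
qed

text \<open>Completing the last block of frequencies costs one further period and the constant
  feature adds another, hence \<open>nalias p n + 2\<close>.\<close>

lemma quad_form_upper:
  assumes n: "n > 0"
  shows "(\<Sum>j<dimB p n. (\<Sum>k=1..n. a k * phi (xtrain n k) j)\<^sup>2) \<le> (real (nalias p n) + 2) * n * (\<Sum>k=1..n. (a k)\<^sup>2)"
proof -
  let ?E = "\<lambda>f. (\<Sum>k=1..n. a k * sin (real f * pi * xtrain n k))\<^sup>2 + (\<Sum>k=1..n. a k * cos (real f * pi * xtrain n k))\<^sup>2"
  have "(\<Sum>j<dimB p n. (\<Sum>k=1..n. a k * phi (xtrain n k) j)\<^sup>2) = (\<Sum>k=1..n. a k * phi (xtrain n k) 0)\<^sup>2 +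
      (\<Sum>f=1..nfreq p n. (\<Sum>k=1..n. a k * phi (xtrain n k) (2 * f - Suc 0))\<^sup>2 + (\<Sum>k=1..n. a k * phi (xtrain n k) (2 * f))\<^sup>2)"
    by (rule sum_dimB)
  also have "(\<Sum>f=1..nfreq p n. (\<Sum>k=1..n. a k * phi (xtrain n k) (2 * f - Suc 0))\<^sup>2 + (\<Sum>k=1..n. a k * phi (xtrain n k) (2 * f))\<^sup>2) =
      (\<Sum>f=1..nfreq p n. ?E f)"
    by (intro sum.cong refl) (auto simp: phi_simps)
  finally have 1: "(\<Sum>j<dimB p n. (\<Sum>k=1..n. a k * phi (xtrain n k) j)\<^sup>2) =
    (\<Sum>k=1..n. a k * phi (xtrain n k) 0)\<^sup>2 + (\<Sum>f=1..nfreq p n. ?E f)" .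
  have "(\<Sum>f=1..nfreq p n. ?E f) \<le> (\<Sum>f=1..Suc (nalias p n) * n. ?E f)"
  proof (rule sum_mono2)
    have "nfreq p n \<le> Suc (nalias p n) * n"
      using n by (simp add: nalias_def) (metis add.commute div_mult_mod_eq less_imp_le mod_less_divisor nat_add_left_cancel_le)
    then show "{1..nfreq p n} \<subseteq> {1..Suc (nalias p n) * n}" by auto
  qed auto
  also have "\<dots> = real (Suc (nalias p n) * n) * (\<Sum>k=1..n. (a k)\<^sup>2)"
    by (rule sum_energy_full_periods[OF n])
  finally have 2: "(\<Sum>f=1..nfreq p n. ?E f) \<le> real (Suc (nalias p n) * n) * (\<Sum>k=1..n. (a k)\<^sup>2)" .
  have 3: "(\<Sum>k=1..n. a k * phi (xtrain n k) 0)\<^sup>2 \<le> n * (\<Sum>k=1..n. (a k)\<^sup>2)"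
  proof -
    have "(\<Sum>k=1..n. a k * phi (xtrain n k) 0)\<^sup>2 \<le> (\<Sum>k=1..n. (a k)\<^sup>2) * (\<Sum>k=1..n. (phi (xtrain n k) 0)\<^sup>2)"
      by (rule Cauchy_Schwarz_ineq_sum)
    also have "\<dots> \<le> (\<Sum>k=1..n. (a k)\<^sup>2) * n"
      by (intro mult_left_mono sum_nonneg) (auto simp: phi_simps power_divide)
    finally show ?thesis by (simp add: mult.commute)
  qed
  have "real (Suc (nalias p n) * n) * (\<Sum>k=1..n. (a k)\<^sup>2) + n * (\<Sum>k=1..n. (a k)\<^sup>2) = (real (nalias p n) + 2) * n * (\<Sum>k=1..n. (a k)\<^sup>2)"
    by (simp add: algebra_simps)
  then show ?thesis using 1 2 3 by linarith
qed

section \<open>Large-sample regime\<close>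

lemma nfreq_bounds: "real n powr p / 2 - 1 \<le> real (nfreq p n)" "real (nfreq p n) \<le> real n powr p / 2"
  by (auto simp: nfreq_def) linarith+

lemma filterlim_nfreq:
  assumes "p > 0"
  shows "filterlim (\<lambda>n. real (nfreq p n)) at_top sequentially"
proof (rule filterlim_at_top_mono)
  show "filterlim (\<lambda>n. real n powr p / 2 - 1) at_top sequentially" using assms by real_asymp
qed (simp add: nfreq_bounds)

lemma nalias_bounds:
  assumes "n > 0"
  shows "nalias p n * n \<le> nfreq p n" "nfreq p n < (nalias p n + 1) * n"
  using assms by (simp_all add: nalias_def div_times_less_eq_dividend dividend_less_div_times)

lemma filterlim_nalias:
  assumes "p > 1"
  shows "filterlim (\<lambda>n. real (nalias p n)) at_top sequentially"
proof (rule filterlim_at_top_mono)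
  show "filterlim (\<lambda>n. (real n powr p / 2 - 1) / real n - 1) at_top sequentially" using assms by real_asymp
  show "\<forall>\<^sub>F n in sequentially. (real n powr p / 2 - 1) / real n - 1 \<le> real (nalias p n)"
    using eventually_gt_at_top[of 0]
  proof eventually_elim
    case (elim n)
    have "real n powr p / 2 - 1 \<le> real ((nalias p n + 1) * n)"
      using nfreq_bounds(1)[of n p] nalias_bounds(2)[OF elim, of p] by linarith
    then show ?case using elim by (simp add: field_simps)
  qed
qed

lemma gam_tendsto_0:
  assumes "q > 0"
  shows "(gam q) \<longlonglongrightarrow> 0"
  unfolding gam_def using assms by real_asymp

lemma inverse_nfreq_tendsto_0:
  assumes "p > 0"
  shows "(\<lambda>n. 1 / real (nfreq p n)) \<longlonglongrightarrow> 0"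
  using tendsto_inverse_0_at_top[OF filterlim_nfreq[OF assms]] by (simp add: divide_inverse)

lemma eventually_nfreq_pos: "p > 0 \<Longrightarrow> \<forall>\<^sub>F n in sequentially. nfreq p n > 0"
  using filterlim_nfreq[of p, unfolded filterlim_at_top_dense, rule_format, of 0] by simp

lemma cfreq_tendsto_1:
  assumes "p > 0" "q > 0"
  shows "cfreq p q \<longlonglongrightarrow> 1"
proof -
  have "(\<lambda>n. (1 - gam q n) * (1 + (1 / real (nfreq p n)) / 2)) \<longlonglongrightarrow> (1 - 0) * (1 + 0 / 2)"
    using gam_tendsto_0 inverse_nfreq_tendsto_0 assms by (intro tendsto_intros) auto
  moreover have "\<forall>\<^sub>F n in sequentially. (1 - gam q n) * (1 + (1 / real (nfreq p n)) / 2) = cfreq p q n"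
    using eventually_nfreq_pos[OF assms(1)]
    by eventually_elim (simp add: cfreq_def dimB_def field_simps)
  ultimately show ?thesis by (simp add: tendsto_cong)
qed

text \<open>The ratio is of order \<open>n powr (1 - q)\<close>. Its vanishing makes the constant
  feature negligible in the kernel estimates, even after multiplication by \<open>n\<close>.\<close>

lemma n_cnst_over_nfreq_tendsto_0:
  assumes "p > 0" "q > 1"
  shows "(\<lambda>n. real n * cnst p q n / real (nfreq p n)) \<longlonglongrightarrow> 0"
proof -
  have "(\<lambda>n. real n * real n powr (- q)) \<longlonglongrightarrow> 0" using assms by real_asymp
  then have "(\<lambda>n. (real n * real n powr (- q)) * (1 + (1 / real (nfreq p n)) / 2)) \<longlonglongrightarrow> 0 * (1 + 0 / 2)"
    using inverse_nfreq_tendsto_0 assms by (intro tendsto_intros) auto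
  moreover have "\<forall>\<^sub>F n in sequentially. (real n * real n powr (- q)) * (1 + (1 / real (nfreq p n)) / 2) =
      real n * cnst p q n / real (nfreq p n)"
    using eventually_nfreq_pos[OF assms(1)]
    by eventually_elim (simp add: cnst_def gam_def dimB_def field_simps)
  ultimately show ?thesis by (simp add: tendsto_cong)
qed

lemma cnst_nonneg: "cnst p q n \<ge> 0" by (simp add: cnst_def gam_def)

text \<open>Bundles conditions that hold for all large \<open>n\<close>, so that later estimates can
  be stated for a single \<open>n\<close> with absolute constants.\<close>

definition regular :: "real \<Rightarrow> real \<Rightarrow> nat \<Rightarrow> bool" where
  "regular p q n \<longleftrightarrow> n > 0 \<and> nalias p n > 0 \<and> nfreq p n > 0 \<and> 1 / 2 \<le> cfreq p q n \<and> cfreq p q n \<le> 2 \<and>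
     (\<forall>j<dimB p n. lam p q n j > 0)"

lemma eventually_regular:
  assumes "p > 1" "q > 1"
  shows "\<forall>\<^sub>F n in sequentially. regular p q n"
proof -
  have c: "cfreq p q \<longlonglongrightarrow> 1" using assms by (intro cfreq_tendsto_1) auto
  have M: "\<forall>\<^sub>F n in sequentially. real (nalias p n) > 0"
    using filterlim_nalias[OF assms(1), unfolded filterlim_at_top_dense, rule_format, of 0] .
  have K: "\<forall>\<^sub>F n in sequentially. nfreq p n > 0" using assms by (intro eventually_nfreq_pos) auto
  have c1: "\<forall>\<^sub>F n in sequentially. 1 / 2 < cfreq p q n" and c2: "\<forall>\<^sub>F n in sequentially. cfreq p q n < 2"
    by (rule order_tendstoD[OF c], simp)+
  show ?thesis
    using eventually_gt_at_top[of 0] M K c1 c2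
  proof eventually_elim
    case (elim n)
    have "lam p q n j > 0" for j
      using elim by (cases "j = 0") (auto simp: lam_def cfreq_def gam_def dimB_def)
    with elim show ?case by (simp add: regular_def)
  qed
qed

lemma regularD:
  assumes "regular p q n"
  shows "n > 0" "nalias p n > 0" "nfreq p n > 0" "1 / 2 \<le> cfreq p q n" "cfreq p q n \<le> 2"
    "\<And>j. j < dimB p n \<Longrightarrow> lam p q n j > 0" "cnst p q n + cfreq p q n * nalias p n > 0"
proof -
  show "n > 0" "nalias p n > 0" "nfreq p n > 0" "1 / 2 \<le> cfreq p q n" "cfreq p q n \<le> 2"
    "\<And>j. j < dimB p n \<Longrightarrow> lam p q n j > 0" using assms by (auto simp: regular_def)
  then have "cfreq p q n * nalias p n > 0" by simp
  then show "cnst p q n + cfreq p q n * nalias p n > 0" using cnst_nonneg[of p q n] by linarith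
qed

lemma regular_fhat_eq:
  assumes "regular p q n"
  shows "fhat p q n x = (cnst p q n + cfreq p q n * (\<Sum>m=1..nalias p n. cos (real m * (real n * pi * (x + 1))))) /
     (cnst p q n + cfreq p q n * nalias p n)"
  using regularD[OF assms] by (intro fhat_eq) auto

lemma cnst_over_nalias_tendsto_0:
  assumes "p > 1" "q > 1"
  shows "(\<lambda>n. cnst p q n / real (nalias p n)) \<longlonglongrightarrow> 0"
proof (rule tendsto_sandwich[where f="\<lambda>_. 0" and h="\<lambda>n. 2 * (real n * cnst p q n / real (nfreq p n))"])
  have "(\<lambda>n. 2 * (real n * cnst p q n / real (nfreq p n))) \<longlonglongrightarrow> 2 * 0"
    using assms by (intro tendsto_intros n_cnst_over_nfreq_tendsto_0) auto
  then show "(\<lambda>n. 2 * (real n * cnst p q n / real (nfreq p n))) \<longlonglongrightarrow> 0" by simp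
  show "\<forall>\<^sub>F n in sequentially. cnst p q n / real (nalias p n) \<le> 2 * (real n * cnst p q n / real (nfreq p n))"
    using eventually_regular[OF assms]
  proof eventually_elim
    case (elim n)
    note r = regularD[OF elim]
    have "nfreq p n \<le> 2 * nalias p n * n"
    proof -
      have "(nalias p n + 1) * n \<le> 2 * nalias p n * n" using r(2) by (intro mult_right_mono) auto
      then show ?thesis using nalias_bounds(2)[OF r(1), of p] by linarith
    qed
    then have "real (nfreq p n) \<le> real (2 * nalias p n * n)" by (simp only: of_nat_le_iff)
    then have "cnst p q n * real (nfreq p n) \<le> cnst p q n * (2 * real (nalias p n) * real n)"
      using cnst_nonneg by (intro mult_left_mono) auto
    then show ?case using r by (simp add: field_simps)
  qed
qed (auto simp: cnst_nonneg)

section \<open>Dips of the interpolant next to the training inputs\<close>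

lemma abs_sin_ge_half:
  fixes x :: real
  assumes "\<bar>x\<bar> \<le> 1"
  shows "\<bar>x\<bar> / 2 \<le> \<bar>sin x\<bar>"
proof -
  have "\<bar>sin x - (\<Sum>m<3. sin_coeff m * x ^ m)\<bar> \<le> inverse (fact 3) * \<bar>x\<bar> ^ 3"
    by (rule Maclaurin_sin_bound)
  also have "(\<Sum>m<3. sin_coeff m * x ^ m) = x" by (simp add: eval_nat_numeral sin_coeff_def)
  finally have "\<bar>sin x - x\<bar> \<le> \<bar>x\<bar> ^ 3 / 6" by (simp add: fact_numeral)
  moreover have "\<bar>x\<bar> ^ 3 \<le> \<bar>x\<bar> ^ 1" using assms by (intro power_decreasing) auto
  moreover have "\<bar>x\<bar> \<le> \<bar>sin x\<bar> + \<bar>sin x - x\<bar>" by linarith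
  ultimately show ?thesis by (simp only: power_one_right)
qed

definition dip_angle :: "real \<Rightarrow> nat \<Rightarrow> nat \<Rightarrow> nat \<Rightarrow> real" where
  "dip_angle p n L l = (3 * pi / 2 + 2 * pi * real (L * l)) / (real (nalias p n) + 1 / 2)"

text \<open>At these points the numerator \<open>sin ((M + 1/2) * t)\<close> of the Dirichlet kernel is \<open>-1\<close>; the stride \<open>L\<close>
  decorrelates the Gaussian process at different dips.\<close>

definition dip :: "real \<Rightarrow> nat \<Rightarrow> nat \<Rightarrow> nat \<Rightarrow> nat \<Rightarrow> real" where
  "dip p n L k l = xtrain n k + dip_angle p n L l / (real n * pi)"

lemma dip_phase:
  assumes "n > 0"
  shows "real n * pi * (dip p n L k l + 1) = 2 * pi * real k + dip_angle p n L l"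
  using assms by (simp add: dip_def xtrain_def field_simps)

lemma dip_angle_pos: "dip_angle p n L l > 0"
  unfolding dip_angle_def by (intro divide_pos_pos add_pos_nonneg add_nonneg_pos) auto

lemma dip_angle_mono: "l \<le> m \<Longrightarrow> dip_angle p n L l \<le> dip_angle p n L m"
  unfolding dip_angle_def by (intro divide_right_mono add_left_mono mult_left_mono) (auto intro: mult_left_mono)

lemma dip_angle_tendsto_0:
  assumes "p > 1"
  shows "(\<lambda>n. dip_angle p n L l) \<longlonglongrightarrow> 0"
proof -
  have "filterlim (\<lambda>n. real (nalias p n) + 1 / 2) at_top sequentially"
    using filterlim_tendsto_add_at_top[OF tendsto_const filterlim_nalias[OF assms], of "1/2"] by (simp add: add.commute)
  from tendsto_mult[OF tendsto_const tendsto_inverse_0_at_top[OF this], of "3 * pi / 2 + 2 * pi * real (L * l)"]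
  show ?thesis unfolding dip_angle_def by (simp only: divide_inverse mult_zero_right)
qed

lemma eventually_dip_angle_le:
  assumes "p > 1" "e > 0"
  shows "\<forall>\<^sub>F n in sequentially. \<forall>l\<le>m. dip_angle p n L l \<le> e"
  using order_tendstoD(2)[OF dip_angle_tendsto_0[OF assms(1), of L m] assms(2)]
  by eventually_elim (auto intro: order_trans[OF dip_angle_mono])

text \<open>Passing to another training input changes the phase by a multiple of
  \<open>2 * pi\<close> only. With numerator -1 the closed form is
  \<open>(- 1 - s) / (2 * s)\<close> for \<open>s = sin (dip_angle p n L l / 2)\<close>, and
  \<open>s\<close> is at most half the angle.\<close>

lemma sum_cos_dip:
  assumes n: "n > 0" and small: "dip_angle p n L l \<le> 1"
  shows "(\<Sum>i=1..nalias p n. cos (real i * (real n * pi * (dip p n L k l + 1)))) \<le> - 1 / dip_angle p n L l"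
proof -
  let ?t = "dip_angle p n L l" and ?M = "nalias p n"
  have t0: "?t > 0" by (rule dip_angle_pos)
  have "cos (real i * (real n * pi * (dip p n L k l + 1))) = cos (real i * ?t)" for i
  proof -
    have "real i * (real n * pi * (dip p n L k l + 1)) = real i * ?t + 2 * pi * of_int (int (i * k))"
      unfolding dip_phase[OF n] by (simp add: algebra_simps)
    then have "cos (real i * (real n * pi * (dip p n L k l + 1))) = cos (real i * ?t + 2 * pi * of_int (int (i * k)))"
      by (rule arg_cong)
    then show ?thesis unfolding cos_add sin_int_2pin cos_int_2pin by simp
  qed
  then have eq: "(\<Sum>i=1..?M. cos (real i * (real n * pi * (dip p n L k l + 1)))) = (\<Sum>i=1..?M. cos (real i * ?t))"
    by simp
  have "(real ?M + 1 / 2) * ?t = 3 / 2 * pi + 2 * pi * of_int (int (L * l))"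
    by (simp add: dip_angle_def)
  then have "sin ((real ?M + 1 / 2) * ?t) = sin (3 / 2 * pi + 2 * pi * of_int (int (L * l)))"
    by (rule arg_cong)
  also have "\<dots> = -1" unfolding sin_add sin_int_2pin cos_int_2pin sin_3over2_pi by simp
  finally have "sin ((real ?M + 1 / 2) * ?t) = -1" .
  then have d: "2 * sin (?t / 2) * (\<Sum>i=1..?M. cos (real i * ?t)) = - 1 - sin (?t / 2)"
    using dirichlet_kernel_cos[of ?t ?M] by simp
  have s0: "sin (?t / 2) > 0" using t0 small pi_gt3 by (intro sin_gt_zero) auto
  have s1: "sin (?t / 2) \<le> ?t / 2" using t0 by (intro sin_x_le_x) auto
  have "(\<Sum>i=1..?M. cos (real i * ?t)) = (- 1 - sin (?t / 2)) / (2 * sin (?t / 2))"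
    using d s0 by (simp add: field_simps)
  also have "\<dots> \<le> - 1 / (2 * sin (?t / 2))" using s0 by (intro divide_right_mono) auto
  also have "\<dots> \<le> - 1 / ?t" using s0 s1 t0 by (simp add: field_simps)
  finally show ?thesis unfolding eq .
qed

text \<open>The depth of a dip is at least a fixed fraction of \<open>nalias p n\<close>, depending
  on \<open>L\<close> and \<open>m\<close> only, whereas \<open>cnst p q n\<close> is of smaller
  order.\<close>

lemma eventually_fhat_dip_nonpos:
  assumes pq: "p > 1" "q > 1"
  shows "\<forall>\<^sub>F n in sequentially. \<forall>k. \<forall>l\<le>m. fhat p q n (dip p n L k l) \<le> 0"
proof -
  define C where "C = 3 * pi / 2 + 2 * pi * real (L * m)"
  have C: "C > 0" unfolding C_def by (intro add_pos_nonneg) auto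
  have "\<forall>\<^sub>F n in sequentially. cnst p q n / real (nalias p n) < 1 / (2 * C)"
    using C by (intro order_tendstoD(2)[OF cnst_over_nalias_tendsto_0[OF pq]]) simp
  then show ?thesis
    using eventually_regular[OF pq] eventually_dip_angle_le[OF pq(1) zero_less_one, of m L]
  proof eventually_elim
    case (elim n)
    note r = regularD[OF elim(2)]
    show ?case
    proof (intro allI impI)
      fix k l assume l: "l \<le> m"
      let ?S = "\<Sum>i=1..nalias p n. cos (real i * (real n * pi * (dip p n L k l + 1)))"
      have "?S \<le> - 1 / dip_angle p n L l" using elim(3) l by (intro sum_cos_dip r) auto
      also have "\<dots> \<le> - (real (nalias p n) / C)"
      proof -
        have "dip_angle p n L l \<le> dip_angle p n L m" by (rule dip_angle_mono[OF l])
        also have "\<dots> \<le> C / real (nalias p n)" unfolding dip_angle_def C_def[symmetric]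
          using C r(2) by (intro divide_left_mono) auto
        finally show ?thesis using dip_angle_pos[of p n L l] C r(2) by (simp add: field_simps)
      qed
      finally have S: "?S \<le> - (real (nalias p n) / C)" .
      have "cfreq p q n * ?S \<le> cfreq p q n * (- (real (nalias p n) / C))" using S r(4) by (intro mult_left_mono) auto
      also have "\<dots> \<le> 1 / 2 * (- (real (nalias p n) / C))"
        using r(4) C by (intro mult_right_mono_neg) auto
      also have "\<dots> \<le> - cnst p q n" using elim(1) C r(2) by (simp add: field_simps)
      finally show "fhat p q n (dip p n L k l) \<le> 0"
        unfolding regular_fhat_eq[OF elim(2)] using r(7) by (simp add: divide_nonpos_pos)
    qed
  qed
qed

text \<open>Dips beside the same training input are at least of order \<open>L / nfreq p n\<close>
  apart, that is, \<open>L\<close> times the correlation length of the kernel. The closed form of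
  the Dirichlet sum turns this distance into a correlation of order \<open>1 / L\<close>, relative
  to the variance scale \<open>cfreq p q n * nfreq p n\<close>.\<close>

lemma eventually_kern_dip_small:
  assumes pq: "p > 1" "q > 1" and L: "L > 0"
  shows "\<forall>\<^sub>F n in sequentially. \<forall>k. \<forall>l\<le>m. \<forall>l'\<le>m. l \<noteq> l' \<longrightarrow>
     \<bar>kern p q n (dip p n L k l) (dip p n L k l')\<bar> \<le> (2 / L) * (cfreq p q n * nfreq p n)"
proof -
  have "(\<lambda>n. real n * cnst p q n / real (nfreq p n) + 1 / real (nfreq p n)) \<longlonglongrightarrow> 0 + 0"
    using pq by (intro tendsto_add n_cnst_over_nfreq_tendsto_0 inverse_nfreq_tendsto_0) auto
  then have "\<forall>\<^sub>F n in sequentially. real n * cnst p q n / real (nfreq p n) + 1 / real (nfreq p n) < 1 / (2 * L)"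
    using L by (intro order_tendstoD(2)) auto
  then show ?thesis
    using eventually_regular[OF pq] eventually_dip_angle_le[OF pq(1) zero_less_one, of m L]
  proof eventually_elim
    case (elim n)
    note r = regularD[OF elim(2)]
    show ?case
    proof (intro allI impI)
      fix k l l' assume l: "l \<le> m" "l' \<le> m" "l \<noteq> l'"
      let ?x = "dip p n L k l" and ?y = "dip p n L k l'"
      define s where "s = pi * (?x - ?y) / 2"
      have s: "s = (dip_angle p n L l - dip_angle p n L l') / (2 * real n)"
        using r(1) by (simp add: s_def dip_def field_simps)
      have s': "s = pi * L * (real l - real l') / ((real (nalias p n) + 1 / 2) * real n)"
      proof -
        have "dip_angle p n L l - dip_angle p n L l' = 2 * (pi * L * (real l - real l')) / (real (nalias p n) + 1 / 2)"
          unfolding dip_angle_def diff_divide_distrib[symmetric] by (simp add: algebra_simps)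
        then show ?thesis unfolding s by simp
      qed
      have "\<bar>dip_angle p n L l - dip_angle p n L l'\<bar> \<le> 1"
        using elim(3) l dip_angle_pos[of p n L l] dip_angle_pos[of p n L l'] by (auto simp: abs_le_iff less_imp_le add_increasing2 diff_le_eq)
      then have "\<bar>s\<bar> \<le> 1" unfolding s using r(1) by (simp add: abs_mult field_simps)
      then have sin: "\<bar>s\<bar> / 2 \<le> \<bar>sin s\<bar>" by (rule abs_sin_ge_half)
      have "\<bar>real l - real l'\<bar> \<ge> 1" using l(3) by linarith
      \<comment> \<open>In total \<open>\<bar>s\<bar>\<close> is at least
        \<open>2 * L / nfreq p n\<close>: the denominator is at most
        \<open>3 / 2 * nfreq p n\<close> and \<open>pi\<close> exceeds 3. Passing from
        \<open>s\<close> to its sine halves the bound.\<close>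
      then have "pi * L * 1 / ((real (nalias p n) + 1 / 2) * real n) \<le> \<bar>s\<bar>"
        unfolding s' abs_divide abs_mult using r(1) L
        by (intro divide_mono mult_mono) auto
      moreover have "(real (nalias p n) + 1 / 2) * real n \<le> 3 / 2 * real (nfreq p n)"
      proof -
        have "(real (nalias p n) + 1 / 2) * real n \<le> (3 / 2 * real (nalias p n)) * real n"
          using r(2) by (intro mult_right_mono) auto
        also have "\<dots> \<le> 3 / 2 * real (nfreq p n)"
          using nalias_bounds(1)[OF r(1), of p] by (simp flip: of_nat_mult)
        finally show ?thesis .
      qed
      then have "pi * L * 1 / (3 / 2 * real (nfreq p n)) \<le> pi * L * 1 / ((real (nalias p n) + 1 / 2) * real n)"
        using r L by (intro divide_left_mono mult_pos_pos) (auto intro!: add_nonneg_pos)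
      moreover have "2 * real L / nfreq p n \<le> pi * L * 1 / (3 / 2 * real (nfreq p n))"
        using r(3) L pi_gt3 by (simp add: field_simps)
      ultimately have "real L / nfreq p n \<le> \<bar>sin s\<bar>" using sin by (simp add: field_simps)
      moreover have "real L / nfreq p n > 0" using L r(3) by simp
      ultimately have s0: "sin s \<noteq> 0" and "inverse \<bar>sin s\<bar> \<le> inverse (real L / nfreq p n)"
        by (auto intro!: le_imp_inverse_le simp del: inverse_divide)
      then have sL: "1 / (2 * \<bar>sin s\<bar>) \<le> nfreq p n / (2 * L)" by (simp add: inverse_eq_divide)
      let ?t = "pi * (?x - ?y)"
      have "\<bar>\<Sum>f=1..nfreq p n. cos (real f * ?t)\<bar> \<le> 1 / 2 + nfreq p n / (2 * L)"
        using abs_sum_cos_le[of ?t "nfreq p n"] sL s0 unfolding s_def by linarith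
      then have b: "\<bar>cfreq p q n * (\<Sum>f=1..nfreq p n. cos (real f * ?t))\<bar> \<le> cfreq p q n * (1 / 2 + nfreq p n / (2 * L))"
        using r(4) by (simp add: abs_mult mult_left_mono)
      have "\<bar>kern p q n ?x ?y\<bar> \<le> cnst p q n + cfreq p q n * (1 / 2 + nfreq p n / (2 * L))"
        using b cnst_nonneg[of p q n] unfolding kern_eq mult.assoc by linarith
      also have "cnst p q n \<le> cfreq p q n * (2 * (real n * cnst p q n))"
      proof -
        have "cnst p q n * 1 \<le> cnst p q n * (cfreq p q n * 2 * real n)"
        proof (intro mult_left_mono cnst_nonneg)
          have "1 * 1 \<le> (cfreq p q n * 2) * real n" using r(1,4) by (intro mult_mono) auto
          then show "1 \<le> cfreq p q n * 2 * real n" by simp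
        qed
        then show ?thesis by (simp add: algebra_simps)
      qed
      also have "cfreq p q n * (2 * (real n * cnst p q n)) + cfreq p q n * (1 / 2 + nfreq p n / (2 * L)) =
        cfreq p q n * (2 * (real n * cnst p q n) + 1 / 2 + nfreq p n / (2 * L))"
        by (simp add: algebra_simps)
      also have "\<dots> \<le> cfreq p q n * (nfreq p n * 2 / L)"
      proof (intro mult_left_mono)
        have "real n * cnst p q n + 1 < nfreq p n / (2 * L)"
          using elim(1) r(3) by (simp add: field_simps)
        moreover have "nfreq p n * 2 / L = nfreq p n / (2 * L) + 2 * (nfreq p n / (2 * L)) + nfreq p n / (2 * L)"
          using L by (simp add: field_simps)
        moreover have "nfreq p n / (2 * L) \<ge> 0" by simp
        ultimately show "2 * (real n * cnst p q n) + 1 / 2 + nfreq p n / (2 * L) \<le> nfreq p n * 2 / L" by linarith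
      qed (use r(4) in auto)
      finally show "\<bar>kern p q n ?x ?y\<bar> \<le> (2 / L) * (cfreq p q n * nfreq p n)" by (simp add: algebra_simps)
    qed
  qed
qed

text \<open>Measures how much the training inputs reveal about a dip. The reciprocal squared sines
  sum exactly over the grid, so the total is governed by the distance to the nearest training input.
  Indices start at 1 because at \<open>l = 0\<close> the stride \<open>L\<close> gives no separation
  from that input.\<close>

lemma eventually_kern_dip_train_small:
  assumes pq: "p > 1" "q > 1" and L: "L > 0"
  shows "\<forall>\<^sub>F n in sequentially. \<forall>k. \<forall>l\<in>{1..m}.
     (\<Sum>i=1..n. (kern p q n (dip p n L k l) (xtrain n i))\<^sup>2) \<le> (3 / (real L)\<^sup>2) * (cfreq p q n * nfreq p n)\<^sup>2"
proof -
  have "(\<lambda>n. 1 / real (nalias p n)) \<longlonglongrightarrow> 0"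
    using tendsto_inverse_0_at_top[OF filterlim_nalias[OF pq(1)]] by (simp add: divide_inverse)
  then have "(\<lambda>n. real n * cnst p q n / real (nfreq p n) + 1 / real (nalias p n)) \<longlonglongrightarrow> 0 + 0"
    using pq by (intro tendsto_add n_cnst_over_nfreq_tendsto_0) auto
  then have "\<forall>\<^sub>F n in sequentially. real n * cnst p q n / real (nfreq p n) + 1 / real (nalias p n) < 1 / (4 * L)"
    using L by (intro order_tendstoD(2)) auto
  then show ?thesis
    using eventually_regular[OF pq] eventually_dip_angle_le[OF pq(1) zero_less_one, of m L]
  proof eventually_elim
    case (elim n)
    note r = regularD[OF elim(2)]
    show ?case
    proof (intro allI ballI)
      fix k l assume l: "l \<in> {1..m}"
      let ?y = "dip p n L k l" and ?c = "cfreq p q n" and ?K = "real (nfreq p n)"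
      define \<theta> where "\<theta> = dip_angle p n L l"
      have \<theta>: "\<theta> > 0" "\<theta> \<le> 1" using elim(3) l dip_angle_pos by (auto simp: \<theta>_def)
      have MK: "(real (nalias p n) + 1 / 2) * real n \<le> 3 / 2 * ?K"
      proof -
        have "(real (nalias p n) + 1 / 2) * real n \<le> (3 / 2 * real (nalias p n)) * real n"
          using r(2) by (intro mult_right_mono) auto
        also have "\<dots> \<le> 3 / 2 * ?K"
          using nalias_bounds(1)[OF r(1), of p] by (simp flip: of_nat_mult)
        finally show ?thesis .
      qed
      have sq: "(sin (real n * pi * (?y + 1) / 2))\<^sup>2 = (sin (\<theta> / 2))\<^sup>2"
      proof -
        have "real n * pi * (?y + 1) / 2 = \<theta> / 2 + pi * of_int (int k)"
          unfolding dip_phase[OF r(1)] \<theta>_def by (simp add: field_simps)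
        then have "sin (real n * pi * (?y + 1) / 2) = sin (\<theta> / 2) * cos (pi * of_int (int k)) + cos (\<theta> / 2) * sin (pi * of_int (int k))"
          by (simp only: sin_add)
        moreover have "sin (pi * of_int (int k)) = 0" by (simp add: sin_zero_iff_int2 mult.commute)
        ultimately show ?thesis using sin_cos_squared_add[of "pi * of_int (int k)"] by (simp add: power_mult_distrib)
      qed
      have "\<bar>\<theta> / 2\<bar> / 2 \<le> \<bar>sin (\<theta> / 2)\<bar>" using \<theta> by (intro abs_sin_ge_half) auto
      then have s1: "\<theta> / 4 \<le> \<bar>sin (\<theta> / 2)\<bar>" using \<theta> by simp
      \<comment> \<open>For \<open>l \<ge> 1\<close> the angle is at least
        \<open>6 * L / (nalias p n + 1 / 2)\<close>; the factor \<open>3 / 2\<close> above and below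
        prepares for the bound \<open>MK\<close>.\<close>
      have s2: "3 / 2 * L * real n / (3 / 2 * ?K) \<le> \<theta> / 4"
      proof -
        have "3 / 2 * L * real n / (3 / 2 * ?K) \<le> 3 / 2 * L * real n / ((real (nalias p n) + 1 / 2) * real n)"
          using MK r L by (intro divide_left_mono mult_pos_pos) (auto intro!: add_nonneg_pos)
        also have "\<dots> = (6 * L) / (real (nalias p n) + 1 / 2) / 4"
        proof -
          have "3 / 2 * L * real n / (A * real n) = (6 * L) / A / 4" for A using r(1) by simp
          then show ?thesis .
        qed
        also have "\<dots> \<le> \<theta> / 4" unfolding \<theta>_def dip_angle_def
        proof (intro divide_right_mono)
          have "6 * real L * 1 \<le> (2 * pi * real L) * real l" using pi_gt3 l by (intro mult_mono) auto
          then have "real (6 * L) \<le> 2 * pi * real (L * l)" by (simp add: mult.assoc)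
          moreover have "3 * pi / 2 \<ge> 0" by simp
          ultimately show "real (6 * L) \<le> 3 * pi / 2 + 2 * pi * real (L * l)" by linarith
        qed auto
        finally show ?thesis .
      qed
      have sL: "L * real n / ?K \<le> \<bar>sin (\<theta> / 2)\<bar>" using order_trans[OF s2 s1] r(3) by simp
      moreover have "L * real n / ?K > 0" using L r(1,3) by simp
      ultimately have "sin (\<theta> / 2) \<noteq> 0" by linarith
      then have s0: "sin (real n * pi * (?y + 1) / 2) \<noteq> 0"
        using sq by (metis power2_eq_iff_nonneg power_zero_numeral zero_eq_power2)
      have "(L * real n / ?K)\<^sup>2 \<le> (sin (\<theta> / 2))\<^sup>2" using power_mono[OF sL, of 2] by simp
      moreover have "(L * real n / ?K)\<^sup>2 > 0" using L r(1,3) by simp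
      ultimately have "(real n)\<^sup>2 / (sin (\<theta> / 2))\<^sup>2 \<le> (real n)\<^sup>2 / (L * real n / ?K)\<^sup>2"
        by (intro divide_left_mono mult_pos_pos) auto
      also have "\<dots> = ?K\<^sup>2 / (real L)\<^sup>2" using r(1) L by (simp add: power_divide power_mult_distrib)
      finally have n2: "(real n)\<^sup>2 / (sin (\<theta> / 2))\<^sup>2 \<le> ?K\<^sup>2 / (real L)\<^sup>2" .
      \<comment> \<open>\<open>b\<close> collects what does not decay with the distance: the
        constant feature and the bounded part of the Dirichlet sum.\<close>
      define b where "b = cnst p q n + ?c / 2"
      have kb: "(kern p q n ?y (xtrain n i))\<^sup>2 \<le> 2 * b\<^sup>2 + ?c\<^sup>2 / 2 * (1 / (sin (pi * (?y - xtrain n i) / 2))\<^sup>2)"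
        if i: "i \<in> {1..n}" for i
      proof -
        let ?t = "pi * (?y - xtrain n i)"
        have t0: "sin (?t / 2) \<noteq> 0" using sum_inverse_sin_squared_xtrain(2)[OF r(1) s0 i] .
        have "\<bar>\<Sum>f=1..nfreq p n. cos (real f * ?t)\<bar> \<le> 1 / 2 + 1 / (2 * \<bar>sin (?t / 2)\<bar>)"
          by (rule abs_sum_cos_le[OF t0])
        then have "\<bar>?c * (\<Sum>f=1..nfreq p n. cos (real f * ?t))\<bar> \<le> ?c * (1 / 2 + 1 / (2 * \<bar>sin (?t / 2)\<bar>))"
          using r(4) by (simp add: abs_mult mult_left_mono)
        then have "\<bar>kern p q n ?y (xtrain n i)\<bar> \<le> b + ?c / (2 * \<bar>sin (?t / 2)\<bar>)"
          using cnst_nonneg[of p q n] unfolding kern_eq b_def mult.assoc distrib_left times_divide_eq_right mult_1_right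
          by linarith
        then have "(kern p q n ?y (xtrain n i))\<^sup>2 \<le> (b + ?c / (2 * \<bar>sin (?t / 2)\<bar>))\<^sup>2"
          by (metis abs_ge_zero power2_abs power_mono)
        also have "\<dots> \<le> 2 * b\<^sup>2 + 2 * (?c / (2 * \<bar>sin (?t / 2)\<bar>))\<^sup>2"
          using sum_squares_ge_zero[of "b - ?c / (2 * \<bar>sin (?t / 2)\<bar>)" 0] by (simp add: power2_eq_square algebra_simps)
        also have "2 * (?c / (2 * \<bar>sin (?t / 2)\<bar>))\<^sup>2 = ?c\<^sup>2 / 2 * (1 / (sin (?t / 2))\<^sup>2)"
          by (simp add: power_divide power_mult_distrib)
        finally show ?thesis .
      qed
      have "(\<Sum>i=1..n. (kern p q n ?y (xtrain n i))\<^sup>2) \<le>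
         (\<Sum>i=1..n. 2 * b\<^sup>2 + ?c\<^sup>2 / 2 * (1 / (sin (pi * (?y - xtrain n i) / 2))\<^sup>2))"
        by (intro sum_mono kb)
      also have "\<dots> = 2 * real n * b\<^sup>2 + ?c\<^sup>2 / 2 * ((real n)\<^sup>2 / (sin (\<theta> / 2))\<^sup>2)"
        unfolding sum.distrib sum_distrib_left[symmetric] sum_inverse_sin_squared_xtrain(1)[OF r(1) s0] sq by simp
      also have "\<dots> \<le> 2 * (?c * ?K / L)\<^sup>2 + ?c\<^sup>2 / 2 * (?K\<^sup>2 / (real L)\<^sup>2)"
      proof (intro add_mono mult_left_mono n2)
        have "real n * b\<^sup>2 \<le> (real n * b)\<^sup>2"
          using r(1) by (simp add: power_mult_distrib) (intro mult_right_mono, auto simp: power2_eq_square)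
        also have "\<dots> \<le> (?c * ?K / L)\<^sup>2"
        proof (intro power_mono)
          have "real n / ?K \<le> 1 / real (nalias p n)"
            using nalias_bounds(1)[OF r(1), of p] r by (simp add: field_simps flip: of_nat_mult)
          then have "real n * cnst p q n / ?K + real n / ?K \<le> 1 / (4 * L)" using elim(1) by linarith
          then have h: "real n * cnst p q n + real n \<le> ?K / (4 * L)" using r(3) by (simp add: field_simps)
          have "real n * b \<le> real n * cnst p q n + real n * 1" unfolding b_def distrib_left
            using r(5) by (intro add_left_mono mult_left_mono) auto
          also have "\<dots> \<le> 1 / 2 * ?K / L" using h r(3) L by (simp add: field_simps)
          also have "\<dots> \<le> ?c * ?K / L" using r(4) by (intro divide_right_mono mult_right_mono) auto
          finally show "real n * b \<le> ?c * ?K / L" .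
          show "0 \<le> real n * b" using cnst_nonneg[of p q n] r(4) by (simp add: b_def)
        qed
        finally show "2 * real n * b\<^sup>2 \<le> 2 * (?c * ?K / L)\<^sup>2" by simp
      qed auto
      also have "\<dots> = (5 / 2 / (real L)\<^sup>2) * (?c * ?K)\<^sup>2" using L by (simp add: power_divide power_mult_distrib field_simps)
      also have "\<dots> \<le> (3 / (real L)\<^sup>2) * (?c * ?K)\<^sup>2" by (intro mult_right_mono divide_right_mono) auto
      finally show "(\<Sum>i=1..n. (kern p q n ?y (xtrain n i))\<^sup>2) \<le> (3 / (real L)\<^sup>2) * (?c * ?K)\<^sup>2" .
    qed
  qed
qed

section \<open>Positivity of the random interpolant at the dips\<close>

text \<open>Conditioning by Fubini: independence makes the joint law a product, so a bound on every
  section at a fixed value of \<open>X\<close> bounds the joint event.\<close>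

lemma (in prob_space) indep_var_prob_le:
  assumes ind: "indep_var S X T Y" and E: "E \<in> sets (S \<Otimes>\<^sub>M T)" and c: "c \<ge> 0"
    and sec: "\<And>u. u \<in> space S \<Longrightarrow> prob {\<omega> \<in> space M. (u, Y \<omega>) \<in> E} \<le> c"
  shows "prob {\<omega> \<in> space M. (X \<omega>, Y \<omega>) \<in> E} \<le> c"
proof -
  have X[measurable]: "X \<in> M \<rightarrow>\<^sub>M S" and Y[measurable]: "Y \<in> M \<rightarrow>\<^sub>M T"
    and eq: "distr M S X \<Otimes>\<^sub>M distr M T Y = distr M (S \<Otimes>\<^sub>M T) (\<lambda>x. (X x, Y x))"
    using ind by (auto simp: indep_var_distribution_eq)
  interpret X: prob_space "distr M S X" by (rule prob_space_distr[OF X])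
  interpret Y: prob_space "distr M T Y" by (rule prob_space_distr[OF Y])
  have "emeasure M {\<omega> \<in> space M. (X \<omega>, Y \<omega>) \<in> E} = emeasure (distr M (S \<Otimes>\<^sub>M T) (\<lambda>x. (X x, Y x))) E"
    using E by (subst emeasure_distr) (auto intro!: arg_cong[where f="emeasure M"])
  also have "\<dots> = (\<integral>\<^sup>+u. emeasure (distr M T Y) (Pair u -` E) \<partial>distr M S X)"
    unfolding eq[symmetric] using E
    by (intro Y.emeasure_pair_measure_alt) (simp cong: sets_pair_measure_cong)
  also have "\<dots> \<le> (\<integral>\<^sup>+u. ennreal c \<partial>distr M S X)"
  proof (rule nn_integral_mono)
    fix u assume "u \<in> space (distr M S X)"
    then have u: "u \<in> space S" by simp
    have "emeasure (distr M T Y) (Pair u -` E) = emeasure M (Y -` (Pair u -` E) \<inter> space M)"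
      using E by (intro emeasure_distr) auto
    also have "Y -` (Pair u -` E) \<inter> space M = {\<omega> \<in> space M. (u, Y \<omega>) \<in> E}" by auto
    also have "emeasure M \<dots> \<le> ennreal c" using sec[OF u] by (simp add: emeasure_eq_measure ennreal_leI)
    finally show "emeasure (distr M T Y) (Pair u -` E) \<le> ennreal c" .
  qed
  also have "\<dots> = ennreal c" by (simp add: X.emeasure_space_1[simplified])
  finally show ?thesis using c by (simp add: emeasure_eq_measure)
qed

section \<open>Feature vectors, projection on the training features, residuals\<close>

definition featv :: "real \<Rightarrow> real \<Rightarrow> nat \<Rightarrow> real \<Rightarrow> nat \<Rightarrow> real" where
  "featv p q n x j = sqrt (lam p q n j) * phi x j"

text \<open>A rank-one coefficient matrix: paired with the whitened matrix of draws it gives the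
  functional with weights \<open>a\<close> over the draws and \<open>v\<close> over the
  features.\<close>

definition tens :: "(nat \<Rightarrow> real) \<Rightarrow> (nat \<Rightarrow> real) \<Rightarrow> nat \<times> nat \<Rightarrow> real" where
  "tens a v ij = a (fst ij) * v (snd ij)"

lemma ip_tens: "ip (D \<times> B) (tens a v) (tens b w) = ip D a b * ip B v w"
  by (simp add: ip_def tens_def sum_product sum.cartesian_product case_prod_beta' algebra_simps)

lemma ip_featv:
  assumes "regular p q n"
  shows "ip {..<dimB p n} (featv p q n x) (featv p q n y) = kern p q n x y"
  unfolding ip_def kern_def featv_def
proof (intro sum.cong refl)
  fix j assume "j \<in> {..<dimB p n}"
  then have "lam p q n j > 0" using regularD(6)[OF assms] by auto
  then have "sqrt (lam p q n j) * sqrt (lam p q n j) = lam p q n j" by simp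
  then show "sqrt (lam p q n j) * phi x j * (sqrt (lam p q n j) * phi y j) = lam p q n j * phi x j * phi y j"
    by (metis mult.assoc mult.commute)
qed

lemma phiRFS_whiten:
  assumes reg: "regular p q n" and i: "i < dimD T n"
  shows "phiRFS p n z x i = ip ({..<dimD T n} \<times> {..<dimB p n}) (whiten p q T n z)
    (tens (\<lambda>i'. if i' = i then 1 else 0) (featv p q n x))"
proof -
  have "ip ({..<dimD T n} \<times> {..<dimB p n}) (whiten p q T n z) (tens (\<lambda>i'. if i' = i then 1 else 0) (featv p q n x)) =
    (\<Sum>i'<dimD T n. \<Sum>j<dimB p n. whiten p q T n z (i', j) * ((if i' = i then 1 else 0) * featv p q n x j))"
    by (simp add: ip_def tens_def sum.cartesian_product case_prod_beta')
  also have "\<dots> = (\<Sum>i'<dimD T n. if i' = i then \<Sum>j<dimB p n. whiten p q T n z (i', j) * featv p q n x j else 0)"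
    by (intro sum.cong) auto
  also have "\<dots> = (\<Sum>j<dimB p n. whiten p q T n z (i, j) * featv p q n x j)" using i by simp
  also have "\<dots> = (\<Sum>j<dimB p n. z i j * phi x j)"
    using i regularD(6)[OF reg] by (intro sum.cong refl) (auto simp: whiten_def featv_def less_imp_neq[symmetric])
  finally show ?thesis by (simp add: phiRFS_def)
qed

text \<open>With all labels equal to 1, \<open>fhat\<close> is the kriging predictor. Its value is
  the sum of the weights \<open>a\<close>, as one sees by adding up the normal equations, since all
  row sums of the kernel matrix agree. For the second claim, Cauchy-Schwarz bounds the squared
  length of the projection by the length of \<open>a\<close> times that of the vector of kernel
  values, while \<open>quad_form_lower\<close> bounds the length of \<open>a\<close> by that of the
  projection.\<close>

lemma projection_residual:
  assumes reg: "regular p q n"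
    and a: "\<And>k. k \<in> {1..n} \<Longrightarrow> ip {..<dimB p n} (featv p q n (xtrain n k))
      (\<lambda>j. featv p q n y j - (\<Sum>k\<in>{1..n}. a k * featv p q n (xtrain n k) j)) = 0"
  shows "(\<Sum>k=1..n. a k) = fhat p q n y"
    and "ip {..<dimB p n} (\<lambda>j. \<Sum>k\<in>{1..n}. a k * featv p q n (xtrain n k) j) (\<lambda>j. \<Sum>k\<in>{1..n}. a k * featv p q n (xtrain n k) j) *
      (cfreq p q n * real (nalias p n * n)) \<le> (\<Sum>i=1..n. (kern p q n y (xtrain n i))\<^sup>2)"
proof -
  note r = regularD[OF reg]
  let ?B = "{..<dimB p n}" and ?v = "\<lambda>k. featv p q n (xtrain n k)"
  define P where "P = (\<lambda>j. \<Sum>k\<in>{1..n}. a k * ?v k j)"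
  have kP: "ip ?B (?v k) P = kern p q n y (xtrain n k)" if "k \<in> {1..n}" for k
  proof -
    have "ip ?B (?v k) (featv p q n y) - ip ?B (?v k) P = 0" using a[OF that] by (simp add: P_def ip_diff_right)
    then show ?thesis using ip_commute[of ?B "?v k" "featv p q n y"] by (simp add: ip_featv[OF reg])
  qed
  define b where "b = real n * (cnst p q n + cfreq p q n * nalias p n)"
  have b: "b > 0" using r(1,7) by (simp add: b_def)
  have "(\<Sum>k=1..n. kern p q n y (xtrain n k)) = (\<Sum>k=1..n. \<Sum>k'=1..n. a k' * kern p q n (xtrain n k) (xtrain n k'))"
    by (intro sum.cong refl) (simp add: P_def ip_sum_right ip_featv[OF reg] flip: kP)
  also have "\<dots> = (\<Sum>k'=1..n. \<Sum>k=1..n. a k' * kern p q n (xtrain n k) (xtrain n k'))" by (rule sum.swap)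
  also have "\<dots> = (\<Sum>k'=1..n. a k' * b)"
  proof (intro sum.cong refl)
    fix k' assume k': "k' \<in> {1..n}"
    have "(\<Sum>k=1..n. kern p q n (xtrain n k') (xtrain n k)) = b"
      unfolding sum_kern_xtrain[OF r(1)] cos_xtrain_alias[OF r(1)] by (simp add: b_def)
    moreover have "kern p q n (xtrain n k) (xtrain n k') = kern p q n (xtrain n k') (xtrain n k)" for k
      by (simp add: kern_def mult_ac)
    ultimately show "(\<Sum>k=1..n. a k' * kern p q n (xtrain n k) (xtrain n k')) = a k' * b"
      by (simp flip: sum_distrib_left)
  qed
  finally have "(\<Sum>k=1..n. a k) = (\<Sum>k=1..n. kern p q n y (xtrain n k)) / b"
    using b by (simp flip: sum_distrib_right)
  also have "\<dots> = fhat p q n y"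
    unfolding sum_kern_xtrain[OF r(1)] regular_fhat_eq[OF reg] b_def using r(1) by simp
  finally show "(\<Sum>k=1..n. a k) = fhat p q n y" .
  define A where "A = (\<Sum>k=1..n. (a k)\<^sup>2)"
  define Q where "Q = (\<Sum>i=1..n. (kern p q n y (xtrain n i))\<^sup>2)"
  define C where "C = cfreq p q n * real (nalias p n * n)"
  have nn: "A \<ge> 0" "Q \<ge> 0" "C \<ge> 0" using r(4) by (auto simp: A_def Q_def C_def sum_nonneg)
  have PP: "ip ?B P P = (\<Sum>k=1..n. a k * kern p q n y (xtrain n k))"
  proof -
    have "ip ?B P P = (\<Sum>k=1..n. a k * ip ?B (?v k) P)" by (subst (1) P_def) (rule ip_sum_left)
    then show ?thesis using kP by simp
  qed
  have 1: "(ip ?B P P)\<^sup>2 \<le> A * Q" unfolding PP A_def Q_def by (rule Cauchy_Schwarz_ineq_sum)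
  have 2: "C * A \<le> ip ?B P P"
  proof -
    have "C * A \<le> (\<Sum>j<dimB p n. lam p q n j * (\<Sum>k=1..n. a k * phi (xtrain n k) j)\<^sup>2)"
      unfolding C_def A_def using r cnst_nonneg by (intro quad_form_lower) auto
    also have "\<dots> = ip ?B P P" unfolding ip_def
    proof (intro sum.cong refl)
      fix j assume "j \<in> {..<dimB p n}"
      then have "lam p q n j > 0" using r(6) by auto
      then have l: "sqrt (lam p q n j) * sqrt (lam p q n j) = lam p q n j" by simp
      have "P j = sqrt (lam p q n j) * (\<Sum>k=1..n. a k * phi (xtrain n k) j)"
        by (simp add: P_def featv_def sum_distrib_left algebra_simps)
      then have "P j * P j = (sqrt (lam p q n j) * sqrt (lam p q n j)) * (\<Sum>k=1..n. a k * phi (xtrain n k) j)\<^sup>2"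
        by (simp add: power2_eq_square algebra_simps)
      then show "lam p q n j * (\<Sum>k=1..n. a k * phi (xtrain n k) j)\<^sup>2 = P j * P j" unfolding l by simp
    qed
    finally show ?thesis .
  qed
  have "ip ?B P P * C \<le> Q"
  proof (cases "ip ?B P P = 0")
    case False
    then have pos: "ip ?B P P > 0" using ip_self_nonneg[of ?B P] by linarith
    have "ip ?B P P * (ip ?B P P * C) = C * (ip ?B P P)\<^sup>2" by (simp add: power2_eq_square)
    also have "\<dots> \<le> C * (A * Q)" using 1 nn by (intro mult_left_mono) auto
    also have "\<dots> = (C * A) * Q" by simp
    also have "\<dots> \<le> ip ?B P P * Q" using 2 nn by (intro mult_right_mono) auto
    finally show ?thesis using pos by simp
  qed (use nn in simp)
  then show "ip ?B (\<lambda>j. \<Sum>k\<in>{1..n}. a k * ?v k j) (\<lambda>j. \<Sum>k\<in>{1..n}. a k * ?v k j) *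
      (cfreq p q n * real (nalias p n * n)) \<le> (\<Sum>i=1..n. (kern p q n y (xtrain n i))\<^sup>2)"
    by (simp add: P_def Q_def C_def)
qed

text \<open>A Schur complement: inner products of residuals are kernel values minus inner products
  of projections. The latter are at most \<open>N / (32 * m)\<close>, so each residual keeps squared
  length at least \<open>N / 2\<close>, while the inner product in question stays below
  \<open>N / (2 * m)\<close>.\<close>

lemma residual_correlation:
  assumes reg: "regular p q n" and m: "m > 0"
    and a: "\<And>l k. k \<in> {1..n} \<Longrightarrow> ip {..<dimB p n} (featv p q n (xtrain n k))
      (\<lambda>j. featv p q n (Y l) j - (\<Sum>k\<in>{1..n}. a l k * featv p q n (xtrain n k) j)) = 0"
    and w: "w = (\<lambda>l j. featv p q n (Y l) j - (\<Sum>k\<in>{1..n}. a l k * featv p q n (xtrain n k) j))"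
    and N: "N = cfreq p q n * nfreq p n"
    and h3: "\<And>l. l \<in> {1..m} \<Longrightarrow> (\<Sum>i=1..n. (kern p q n (Y l) (xtrain n i))\<^sup>2) \<le> 3 / (real (16 * m))\<^sup>2 * N\<^sup>2"
    and kk: "\<bar>kern p q n (Y l) (Y l')\<bar> \<le> N / (8 * m)"
    and l: "l \<in> {1..m}" "l' \<in> {1..m}"
  shows "\<bar>ip {..<dimB p n} (w l) (w l')\<bar> \<le> sqrt (ip {..<dimB p n} (w l) (w l)) * sqrt (ip {..<dimB p n} (w l') (w l')) / m"
proof -
  note r = regularD[OF reg]
  let ?B = "{..<dimB p n}" and ?v = "\<lambda>k. featv p q n (xtrain n k)"
  have N0: "N > 0" using r(3,4) by (simp add: N)
  define P where "P = (\<lambda>l j. \<Sum>k\<in>{1..n}. a l k * ?v k j)"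
  have wP: "ip ?B (P l) (w l') = 0" for l l'
    unfolding P_def ip_sum_left using a[of _ l'] by (intro sum.neutral) (simp add: w)
  have ww: "ip ?B (w l) (w l') = kern p q n (Y l) (Y l') - ip ?B (P l) (P l')" for l l'
  proof -
    have "ip ?B (w l) (w l') = ip ?B (featv p q n (Y l)) (w l') - ip ?B (P l) (w l')"
      by (subst (1) w) (simp add: ip_diff_left P_def)
    also have "\<dots> = ip ?B (featv p q n (Y l)) (w l')" using wP by simp
    also have "\<dots> = kern p q n (Y l) (Y l') - ip ?B (featv p q n (Y l)) (P l')"
      by (simp add: w ip_diff_right P_def ip_featv[OF reg])
    also have "ip ?B (featv p q n (Y l)) (P l') = ip ?B (w l) (P l') + ip ?B (P l) (P l')"
      by (simp add: w ip_diff_left P_def)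
    also have "ip ?B (w l) (P l') = 0" using wP[of l' l] by (simp add: ip_commute)
    finally show ?thesis by simp
  qed
  have PP: "ip ?B (P l) (P l) \<le> N / (32 * m)" if l: "l \<in> {1..m}" for l
  proof -
    have "(nalias p n + 1) * n \<le> (2 * nalias p n) * n" using r(2) by (intro mult_right_mono) auto
    then have "nfreq p n \<le> 2 * (nalias p n * n)" using nalias_bounds(2)[OF r(1), of p] unfolding mult.assoc by linarith
    then have "real (nfreq p n) / 2 \<le> real (nalias p n * n)" by linarith
    then have "N / 2 \<le> cfreq p q n * real (nalias p n * n)"
      unfolding N using r(4) mult_left_mono[of "real (nfreq p n) / 2" "real (nalias p n * n)" "cfreq p q n"] by simp
    then have "ip ?B (P l) (P l) * (N / 2) \<le> ip ?B (P l) (P l) * (cfreq p q n * real (nalias p n * n))"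
      using ip_self_nonneg by (intro mult_left_mono) auto
    also have "\<dots> \<le> (\<Sum>i=1..n. (kern p q n (Y l) (xtrain n i))\<^sup>2)"
      unfolding P_def using a[of _ l] by (intro projection_residual(2)[OF reg]) auto
    also have "\<dots> \<le> 3 / (real (16 * m))\<^sup>2 * N\<^sup>2" by (rule h3[OF l])
    finally have "ip ?B (P l) (P l) \<le> 6 * N / (256 * (real m)\<^sup>2)"
      using N0 m by (simp add: power2_eq_square field_simps)
    also have "\<dots> \<le> 6 * N / (256 * real m)"
      using N0 m by (intro divide_left_mono mult_left_mono) (auto simp: power2_eq_square)
    also have "\<dots> \<le> N / (32 * m)" using N0 m by (simp add: field_simps)
    finally show ?thesis .
  qed
  have cross: "\<bar>ip ?B (P l) (P l')\<bar> \<le> N / (32 * m)"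
  proof -
    have "\<bar>ip ?B (P l) (P l')\<bar> \<le> sqrt (ip ?B (P l) (P l)) * sqrt (ip ?B (P l') (P l'))" by (rule abs_ip_le)
    also have "\<dots> \<le> sqrt (N / (32 * m)) * sqrt (N / (32 * m))"
      using PP[OF l(1)] PP[OF l(2)] N0 by (intro mult_mono real_sqrt_le_mono) (auto simp: ip_self_nonneg)
    also have "\<dots> = N / (32 * m)" using N0 by simp
    finally show ?thesis .
  qed
  have low: "N / 2 \<le> ip ?B (w l) (w l)" if l: "l \<in> {1..m}" for l
  proof -
    have "kern p q n (Y l) (Y l) \<ge> N" using cnst_nonneg[of p q n] by (simp add: kern_eq N)
    moreover have "N / (32 * m) \<le> N / 2" using N0 m by (intro divide_left_mono) auto
    ultimately show ?thesis using PP[OF l] unfolding ww by linarith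
  qed
  have "\<bar>ip ?B (w l) (w l')\<bar> \<le> N / (8 * m) + N / (32 * m)" using kk cross unfolding ww by linarith
  also have "\<dots> \<le> (N / 2) / m" using N0 m by (simp add: field_simps)
  also have "\<dots> = (sqrt (N / 2) * sqrt (N / 2)) / m" using N0 by simp
  also have "\<dots> \<le> sqrt (ip ?B (w l) (w l)) * sqrt (ip ?B (w l') (w l')) / m"
    using low[OF l(1)] low[OF l(2)] N0 by (intro divide_right_mono mult_mono real_sqrt_le_mono) auto
  finally show ?thesis .
qed

text \<open>As \<open>fhat\<close> is nonpositive at the points, positive values of
  \<open>ghat\<close> force all residual Gaussians to be positive, given the features at the
  training inputs. The cover \<open>A\<close> comes from two measurable events, one for each form
  that \<open>beta_hat\<close> can take, and each contributes 147; measurability of the covered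
  event is not claimed.\<close>

lemma ghat_all_pos_event:
  fixes Y :: "nat \<Rightarrow> real"
  assumes reg: "regular p q n" and d: "dimD T n > 0" and m: "m > 0"
    and N: "N = cfreq p q n * nfreq p n"
    and h1: "\<And>l. l \<in> {1..m} \<Longrightarrow> fhat p q n (Y l) \<le> 0"
    and h2: "\<And>l l'. l \<in> {1..m} \<Longrightarrow> l' \<in> {1..m} \<Longrightarrow> l \<noteq> l' \<Longrightarrow> \<bar>kern p q n (Y l) (Y l')\<bar> \<le> N / (8 * m)"
    and h3: "\<And>l. l \<in> {1..m} \<Longrightarrow> (\<Sum>i=1..n. (kern p q n (Y l) (xtrain n i))\<^sup>2) \<le> 3 / (real (16 * m))\<^sup>2 * N\<^sup>2"
  shows "\<exists>A\<in>sets (Zspace p q T n). {z \<in> space (Zspace p q T n). \<forall>l\<in>{1..m}. ghat p T n z (Y l) > 0} \<subseteq> A \<and>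
     measure (Zspace p q T n) A \<le> 294 / sqrt m"
proof -
  note r = regularD[OF reg]
  define D where "D = {..<dimD T n}"
  define B where "B = {..<dimB p n}"
  define L where "L = {1..m}"
  define I where "I = D \<times> B"
  let ?v = "\<lambda>k. featv p q n (xtrain n k)"
  have fin: "finite D" "finite B" "finite I" "finite L" "L \<noteq> {}" "card L = m" "I \<noteq> {}"
    using d m by (auto simp: D_def B_def I_def L_def dimB_def)
  have N0: "N > 0" using r(3,4) by (simp add: N)
  interpret G: prob_space "gaussPi I" by (rule prob_space_gaussPi)
  interpret Z: prob_space "Zspace p q T n" by (rule prob_space_Zspace[OF r(6)])
  define W where "W = whiten p q T n"
  have Wm[measurable]: "W \<in> Zspace p q T n \<rightarrow>\<^sub>M gaussPi I"
    and Wd: "distr (Zspace p q T n) (gaussPi I) W = gaussPi I"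
    using measurable_whiten[of p n q T] distr_whiten[of p n q T] r(6) by (auto simp: W_def I_def D_def B_def)
  define e :: "nat \<Rightarrow> nat \<Rightarrow> real" where "e = (\<lambda>i i'. if i' = i then 1 else 0)"
  have "\<forall>l. \<exists>a. \<forall>k\<in>{1..n}. ip B (?v k) (\<lambda>j. featv p q n (Y l) j - (\<Sum>k\<in>{1..n}. a k * ?v k j)) = 0"
    using ip_projection_exists[OF fin(2), of "{1..n}" ?v] by blast
  from choice[OF this]
  obtain a where a: "\<And>l k. k \<in> {1..n} \<Longrightarrow> ip B (?v k) (\<lambda>j. featv p q n (Y l) j - (\<Sum>k\<in>{1..n}. a l k * ?v k j)) = 0"
    by blast
  define w where "w = (\<lambda>l j. featv p q n (Y l) j - (\<Sum>k\<in>{1..n}. a l k * ?v k j))"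
  \<comment> \<open>\<open>U\<close> records the features at the training inputs and
    \<open>R\<close> the residual features at the points. Their coefficient vectors are orthogonal,
    whence independence.\<close>
  define U where "U = (\<lambda>g. \<lambda>ki\<in>{1..n} \<times> D. ip I g (tens (e (snd ki)) (?v (fst ki))))"
  define R where "R = (\<lambda>g. \<lambda>li\<in>L \<times> D. ip I g (tens (e (snd li)) (w (fst li))))"
  have ind: "G.indep_var (PiM ({1..n} \<times> D) (\<lambda>_. borel)) U (PiM (L \<times> D) (\<lambda>_. borel)) R"
    unfolding U_def R_def
  proof (rule indep_var_orthogonal_gaussPi[OF fin(3)])
    fix ki li assume "ki \<in> {1..n} \<times> D" "li \<in> L \<times> D"
    then show "ip I (tens (e (snd ki)) (?v (fst ki))) (tens (e (snd li)) (w (fst li))) = 0"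
      unfolding I_def ip_tens using a[of "fst ki" "fst li"] by (auto simp: w_def)
  qed (simp add: fin)
  have lin: "(\<Sum>i\<in>D. \<beta> i * ip I g (tens (e i) v)) = ip I g (tens \<beta> v)" for \<beta> g v
  proof -
    have "ip I g (tens \<beta> v) = ip I g (\<lambda>ij. \<Sum>i\<in>D. \<beta> i * tens (e i) v ij)"
    proof (intro ip_cong refl)
      fix ij assume "ij \<in> I"
      then have "fst ij \<in> D" by (auto simp: I_def)
      have "(\<Sum>i\<in>D. \<beta> i * tens (e i) v ij) = (\<Sum>i\<in>D. if i = fst ij then \<beta> i * v (snd ij) else 0)"
        by (intro sum.cong) (auto simp: tens_def e_def)
      then show "tens \<beta> v ij = (\<Sum>i\<in>D. \<beta> i * tens (e i) v ij)"
        using \<open>fst ij \<in> D\<close> fin by (simp add: tens_def)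
    qed
    then show ?thesis by (simp only: ip_sum_right)
  qed
  \<comment> \<open>A measurable stand-in for \<open>beta_hat\<close>: it agrees with the minimiser,
    on the coordinates in \<open>D\<close>, whenever one exists; for other arguments only its
    measurability matters.\<close>
  define bsel where "bsel = (\<lambda>u i. lim (\<lambda>t. landweber {1..n} D u t i))"
  have bm: "(\<lambda>u. bsel u i) \<in> borel_measurable (PiM ({1..n} \<times> D) (\<lambda>_. borel))" if "i \<in> D" for i
    unfolding bsel_def by (intro borel_measurable_lim_metric measurable_landweber that)
  define E where "E = {x \<in> space (PiM ({1..n} \<times> D) (\<lambda>_. borel) \<Otimes>\<^sub>M PiM (L \<times> D) (\<lambda>_. borel)).
     \<forall>l\<in>L. 0 < (\<Sum>i\<in>D. bsel (fst x) i * snd x (l, i))}"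
  have E: "E \<in> sets (PiM ({1..n} \<times> D) (\<lambda>_. borel) \<Otimes>\<^sub>M PiM (L \<times> D) (\<lambda>_. borel))"
  proof -
    have "(\<lambda>x. \<Sum>i\<in>D. bsel (fst x) i * snd x (l, i)) \<in> borel_measurable (PiM ({1..n} \<times> D) (\<lambda>_. borel) \<Otimes>\<^sub>M PiM (L \<times> D) (\<lambda>_. borel))"
      if "l \<in> L" for l
    proof (intro borel_measurable_sum borel_measurable_times)
      fix i assume i: "i \<in> D"
      show "(\<lambda>x. bsel (fst x) i) \<in> borel_measurable (PiM ({1..n} \<times> D) (\<lambda>_. borel) \<Otimes>\<^sub>M PiM (L \<times> D) (\<lambda>_. borel))"
        by (rule measurable_compose[OF measurable_fst bm[OF i]])
      show "(\<lambda>x. snd x (l, i)) \<in> borel_measurable (PiM ({1..n} \<times> D) (\<lambda>_. borel) \<Otimes>\<^sub>M PiM (L \<times> D) (\<lambda>_. borel))"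
        using i that by (intro measurable_compose[OF measurable_snd] measurable_component_singleton) auto
    qed
    then show ?thesis unfolding E_def
      using fin by (intro sets.sets_Collect_finite_All' borel_measurable_less borel_measurable_const) auto
  qed
  define A2 where "A2 = {g \<in> space (gaussPi I). (U g, R g) \<in> E}"
  have Um: "U \<in> gaussPi I \<rightarrow>\<^sub>M PiM ({1..n} \<times> D) (\<lambda>_. borel)" and Rm: "R \<in> gaussPi I \<rightarrow>\<^sub>M PiM (L \<times> D) (\<lambda>_. borel)"
    using ind by (auto simp: G.indep_var_distribution_eq)
  have A2m: "A2 \<in> sets (gaussPi I)"
    using measurable_sets[OF measurable_Pair[OF Um Rm] E] by (simp add: A2_def vimage_def Int_def conj_commute)
  have P2: "measure (gaussPi I) A2 \<le> 147 / sqrt m"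
    unfolding A2_def
  proof (rule G.indep_var_prob_le[OF ind E])
    fix u assume u: "u \<in> space (PiM ({1..n} \<times> D) (\<lambda>_. borel :: real measure))"
    have "(\<Sum>i\<in>D. bsel u i * R g (l, i)) = ip I g (tens (bsel u) (w l))" if "l \<in> L" for g l
      unfolding lin[of "bsel u" g "w l", symmetric] using that by (intro sum.cong) (auto simp: R_def)
    then have "{g \<in> space (gaussPi I). (u, R g) \<in> E} = {g \<in> space (gaussPi I). \<forall>l\<in>L. ip I g (tens (bsel u) (w l)) > 0}"
      using u measurable_space[OF Rm] by (auto simp: E_def space_pair_measure)
    also have "measure (gaussPi I) \<dots> \<le> 147 / sqrt (card L)"
    proof (rule gaussPi_all_pos_bound[OF fin(3,7,4,5)])
      fix l l' assume l: "l \<in> L" "l' \<in> L" "l \<noteq> l'"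
      let ?b = "ip D (bsel u) (bsel u)"
      have "\<bar>ip B (w l) (w l')\<bar> \<le> sqrt (ip B (w l) (w l)) * sqrt (ip B (w l') (w l')) / m"
        using l unfolding B_def L_def
        by (intro residual_correlation[OF reg m _ w_def N h3 h2] a[unfolded B_def]) auto
      \<comment> \<open>Fixed weights multiply all covariances by the same factor \<open>?b\<close>,
        which cancels in the correlation condition.\<close>
      then have "?b * \<bar>ip B (w l) (w l')\<bar> \<le> ?b * (sqrt (ip B (w l) (w l)) * sqrt (ip B (w l') (w l')) / m)"
        by (intro mult_left_mono ip_self_nonneg)
      also have "\<dots> = sqrt (?b * ip B (w l) (w l)) * sqrt (?b * ip B (w l') (w l')) / m"
        using real_sqrt_mult_self[of ?b] ip_self_nonneg[of D "bsel u"] by (simp add: real_sqrt_mult)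
      finally show "\<bar>ip I (tens (bsel u) (w l)) (tens (bsel u) (w l'))\<bar> \<le>
         sqrt (ip I (tens (bsel u) (w l)) (tens (bsel u) (w l))) * sqrt (ip I (tens (bsel u) (w l')) (tens (bsel u) (w l'))) / card L"
        unfolding I_def ip_tens fin(6) by (simp add: abs_mult ip_self_nonneg)
    qed
    finally show "measure (gaussPi I) {g \<in> space (gaussPi I). (u, R g) \<in> E} \<le> 147 / sqrt m" by (simp add: fin)
  qed simp
  \<comment> \<open>The value of \<open>beta_hat\<close> when its minimisation problem has no solution.\<close>
  define \<beta>0 :: "nat \<Rightarrow> real" where "\<beta>0 = (SOME \<beta>. False)"
  define A1 where "A1 = {g \<in> space (gaussPi I). \<forall>l\<in>L. ip I g (tens \<beta>0 (featv p q n (Y l))) > 0}"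
  have A1m: "A1 \<in> sets (gaussPi I)" unfolding A1_def using fin by measurable
  have P1: "measure (gaussPi I) A1 \<le> 147 / sqrt (card L)"
    unfolding A1_def
  proof (rule gaussPi_all_pos_bound[OF fin(3,7,4,5)])
    fix l l' assume l: "l \<in> L" "l' \<in> L" "l \<noteq> l'"
    let ?b = "ip D \<beta>0 \<beta>0"
    let ?k = "\<lambda>l l'. kern p q n (Y l) (Y l')"
    have low: "N \<le> ?k l l" for l using cnst_nonneg[of p q n] by (simp add: kern_eq N)
    have "\<bar>?k l l'\<bar> \<le> N / (8 * m)" using h2 l by (simp add: L_def)
    also have "\<dots> \<le> N / m" using N0 m by (intro divide_left_mono) auto
    also have "\<dots> = sqrt N * sqrt N / m" using N0 by simp
    also have "\<dots> \<le> sqrt (?k l l) * sqrt (?k l' l') / m"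
      using low N0 order_trans[OF less_imp_le[OF N0] low]
      by (intro divide_right_mono mult_mono real_sqrt_le_mono) auto
    finally have "?b * \<bar>?k l l'\<bar> \<le> ?b * (sqrt (?k l l) * sqrt (?k l' l') / m)"
      by (intro mult_left_mono ip_self_nonneg)
    also have "\<dots> = sqrt (?b * ?k l l) * sqrt (?b * ?k l' l') / m"
      using real_sqrt_mult_self[of ?b] ip_self_nonneg[of D \<beta>0] by (simp add: real_sqrt_mult)
    finally show "\<bar>ip I (tens \<beta>0 (featv p q n (Y l))) (tens \<beta>0 (featv p q n (Y l')))\<bar> \<le>
       sqrt (ip I (tens \<beta>0 (featv p q n (Y l))) (tens \<beta>0 (featv p q n (Y l)))) *
       sqrt (ip I (tens \<beta>0 (featv p q n (Y l'))) (tens \<beta>0 (featv p q n (Y l')))) / card L"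
      unfolding I_def ip_tens fin(6) unfolding B_def ip_featv[OF reg] by (simp add: abs_mult ip_self_nonneg)
  qed
  have sub: "W z \<in> A1 \<union> A2"
    if z: "z \<in> space (Zspace p q T n)" and gp: "\<forall>l\<in>L. ghat p T n z (Y l) > 0" for z
  proof -
    let ?J = "\<lambda>\<beta>. \<Sum>i<dimD T n. (\<beta> i)\<^sup>2 :: real"
    let ?C = "\<lambda>\<beta>. (\<forall>k\<in>{1..n}. (\<Sum>i<dimD T n. phiRFS p n z (xtrain n k) i * \<beta> i) = 1) \<and> (\<forall>i\<ge>dimD T n. \<beta> i = 0)"
    have Wz: "W z \<in> space (gaussPi I)" using measurable_space[OF Wm z] .
    have rfs: "phiRFS p n z x i = ip I (W z) (tens (e i) (featv p q n x))" if "i \<in> D" for x i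
      using phiRFS_whiten[OF reg, of i T z x] that by (simp add: D_def I_def B_def W_def e_def)
    have gh: "ghat p T n z y = ip I (W z) (tens (beta_hat p T n z) (featv p q n y))" for y
      unfolding ghat_def lin[of "beta_hat p T n z" "W z" "featv p q n y", symmetric] D_def[symmetric] by (intro sum.cong) (auto simp: rfs)
    show ?thesis
    proof (cases "\<exists>\<beta>. is_arg_min ?J ?C \<beta>")
      case False
      then have "is_arg_min ?J ?C = (\<lambda>_. False)" by auto
      then have "beta_hat p T n z = \<beta>0" by (simp only: beta_hat_def arg_min_def \<beta>0_def)
      then have "W z \<in> A1" using gp gh Wz by (simp add: A1_def)
      then show ?thesis by simp
    next
      case True
      define \<beta> where "\<beta> = beta_hat p T n z"
      have am: "is_arg_min ?J ?C \<beta>"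
        using someI_ex[OF True] by (simp only: \<beta>_def beta_hat_def arg_min_def)
      then have feas: "\<And>k. k \<in> {1..n} \<Longrightarrow> (\<Sum>i\<in>D. phiRFS p n z (xtrain n k) i * \<beta> i) = 1"
        unfolding is_arg_min_def D_def by blast
      obtain c where c: "\<forall>i<dimD T n. \<beta> i = (\<Sum>k\<in>{1..n}. c k * phiRFS p n z (xtrain n k) i)"
        using arg_min_norm_in_span[OF _ am] by blast
      have Uz: "U (W z) (k, i) = phiRFS p n z (xtrain n k) i" if "k \<in> {1..n}" "i \<in> D" for k i
        using that by (simp add: U_def rfs)
      have bs: "bsel (U (W z)) i = \<beta> i" if "i \<in> D" for i
        unfolding bsel_def
      proof (rule limI, rule landweber_tendsto)
        show "\<beta> i = (\<Sum>k\<in>{1..n}. c k * U (W z) (k, i))" if "i \<in> D" for i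
          using c that by (auto simp: D_def Uz[unfolded D_def])
        show "(\<Sum>j\<in>D. U (W z) (k, j) * \<beta> j) = 1" if "k \<in> {1..n}" for k
          using feas[OF that] that by (simp add: Uz)
      qed (use fin that in auto)
      have "0 < (\<Sum>i\<in>D. bsel (U (W z)) i * R (W z) (l, i))" if l: "l \<in> L" for l
      proof -
        have "ghat p T n z (Y l) = ip I (W z) (tens \<beta> (featv p q n (Y l)))" by (simp add: gh \<beta>_def)
        \<comment> \<open>The feature vector splits into residual and projection. Interpolation
          evaluates the projected part as the sum of the weights \<open>a l k\<close>, a
          deterministic number.\<close>
        also have "tens \<beta> (featv p q n (Y l)) = (\<lambda>ij. tens \<beta> (w l) ij + (\<Sum>k\<in>{1..n}. a l k * tens \<beta> (?v k) ij))"
          by (simp add: tens_def w_def fun_eq_iff algebra_simps sum_distrib_left)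
        also have "ip I (W z) \<dots> = ip I (W z) (tens \<beta> (w l)) + (\<Sum>k\<in>{1..n}. a l k * ip I (W z) (tens \<beta> (?v k)))"
          by (simp only: ip_add_right ip_sum_right)
        also have "(\<Sum>k\<in>{1..n}. a l k * ip I (W z) (tens \<beta> (?v k))) = (\<Sum>k\<in>{1..n}. a l k)"
        proof (intro sum.cong refl)
          fix k assume k: "k \<in> {1..n}"
          have "ip I (W z) (tens \<beta> (?v k)) = (\<Sum>i\<in>D. phiRFS p n z (xtrain n k) i * \<beta> i)"
            unfolding lin[of \<beta> "W z" "?v k", symmetric] by (intro sum.cong) (auto simp: rfs)
          then show "a l k * ip I (W z) (tens \<beta> (?v k)) = a l k" using feas[OF k] by simp
        qed
        also have "(\<Sum>k\<in>{1..n}. a l k) = fhat p q n (Y l)"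
          using a[of _ l] unfolding B_def by (intro projection_residual(1)[OF reg]) auto
        finally have "ip I (W z) (tens \<beta> (w l)) > 0" using gp h1[of l] l by (force simp: L_def)
        also have "ip I (W z) (tens \<beta> (w l)) = (\<Sum>i\<in>D. bsel (U (W z)) i * R (W z) (l, i))"
          unfolding lin[of \<beta> "W z" "w l", symmetric] using l by (intro sum.cong) (auto simp: R_def bs)
        finally show ?thesis .
      qed
      then have "W z \<in> A2"
        using Wz measurable_space[OF Um Wz] measurable_space[OF Rm Wz] by (simp add: A2_def E_def space_pair_measure)
      then show ?thesis by simp
    qed
  qed
  define A where "A = W -` (A1 \<union> A2) \<inter> space (Zspace p q T n)"
  have "A \<in> sets (Zspace p q T n)" unfolding A_def using A1m A2m by (intro measurable_sets[OF Wm]) auto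
  moreover have "{z \<in> space (Zspace p q T n). \<forall>l\<in>{1..m}. ghat p T n z (Y l) > 0} \<subseteq> A"
    using sub by (auto simp: A_def L_def)
  moreover have "measure (Zspace p q T n) A \<le> 294 / sqrt m"
  proof -
    have "measure (Zspace p q T n) A = measure (distr (Zspace p q T n) (gaussPi I) W) (A1 \<union> A2)"
      unfolding A_def using A1m A2m by (intro measure_distr[symmetric]) auto
    also have "\<dots> \<le> measure (gaussPi I) A1 + measure (gaussPi I) A2"
      unfolding Wd using A1m A2m by (rule measure_Un_le)
    also have "\<dots> \<le> 147 / sqrt m + 147 / sqrt m" using P1 P2 fin by simp
    finally show ?thesis by simp
  qed
  ultimately show ?thesis by blast
qed

section \<open>Adversarial risk\<close>

lemma continuous_on_phi: "continuous_on S (\<lambda>x. phi x j)"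
  unfolding phi_def by (cases "j = 0"; cases "odd j") (auto intro!: continuous_intros)

lemma continuous_on_fhat: "continuous_on S (fhat p q n)"
  unfolding fhat_def by (intro continuous_intros continuous_on_phi)

lemma continuous_on_ghat: "continuous_on S (ghat p T n z)"
  unfolding ghat_def phiRFS_def by (intro continuous_intros continuous_on_phi)

lemma sgn_neq_1_iff: "sgn (x :: real) \<noteq> sgn 1 \<longleftrightarrow> x \<le> 0"
  by (auto simp: sgn_if)

lemma Icc_fmeasurable: "{a..b::real} \<in> fmeasurable lborel"
  using fmeasurable_cbox[of a b] by simp

text \<open>The closed set of nonpositive values, fattened by a compact interval, remains
  closed.\<close>

lemma adv_set_measurable:
  fixes f :: "real \<Rightarrow> real"
  assumes "continuous_on UNIV f"
  shows "{x \<in> {-1..1}. \<exists>y. \<bar>y - x\<bar> \<le> eps \<and> sgn (f y) \<noteq> sgn (1::real)} \<in> sets lborel"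
proof -
  have "closed {y. f y \<le> 0}" using assms by (intro closed_Collect_le) auto
  then have "closed (\<Union>x\<in>{y. f y \<le> 0}. \<Union>y\<in>{-eps..eps}. {x + y})"
    by (intro closed_compact_sums compact_Icc)
  moreover have "{x. \<exists>y. \<bar>y - x\<bar> \<le> eps \<and> f y \<le> 0} = (\<Union>x\<in>{y. f y \<le> 0}. \<Union>y\<in>{-eps..eps}. {x + y})"
  proof (intro set_eqI iffI)
    fix x assume "x \<in> {x. \<exists>y. \<bar>y - x\<bar> \<le> eps \<and> f y \<le> 0}"
    then obtain y where "\<bar>y - x\<bar> \<le> eps" "f y \<le> 0" by blast
    then show "x \<in> (\<Union>x\<in>{y. f y \<le> 0}. \<Union>y\<in>{-eps..eps}. {x + y})"
      by (auto intro!: bexI[of _ y] exI[of _ y] bexI[of _ "x - y"])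
  next
    fix x assume "x \<in> (\<Union>x\<in>{y. f y \<le> 0}. \<Union>y\<in>{-eps..eps}. {x + y})"
    then obtain y t where "f y \<le> 0" "t \<in> {-eps..eps}" "x = y + t" by auto
    then show "x \<in> {x. \<exists>y. \<bar>y - x\<bar> \<le> eps \<and> f y \<le> 0}" by (auto intro!: exI[of _ y])
  qed
  ultimately have "closed ({-1..1} \<inter> {x. \<exists>y. \<bar>y - x\<bar> \<le> eps \<and> f y \<le> 0})" by (intro closed_Int) auto
  then show ?thesis unfolding sgn_neq_1_iff by (simp add: Int_def borel_closed)
qed

lemma adv_risk_le_1:
  fixes f :: "real \<Rightarrow> real"
  assumes "continuous_on UNIV f"
  shows "adv_risk f eps \<le> 1"
proof -
  have "measure lborel {x \<in> {-1..1}. \<exists>y. \<bar>y - x\<bar> \<le> eps \<and> sgn (f y) \<noteq> sgn (1::real)} \<le> measure lborel {-1..1::real}"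
    by (intro measure_mono_fmeasurable Icc_fmeasurable adv_set_measurable assms) auto
  then show ?thesis by (simp add: adv_risk_def)
qed

text \<open>The balls of radius \<open>1 / n\<close> around the \<open>n + 1\<close> grid points
  cover the test interval; index 0 stands for the left endpoint. A nonpositive value within
  \<open>\<eta> / n\<close> of a grid point defeats its whole ball up to two slivers of length
  \<open>\<eta> / n\<close>, and a bad grid point forfeits length \<open>2 / n\<close>. The estimate
  follows from \<open>n + 1 \<le> 2 * n\<close> and the normalisation of the risk by 2.\<close>

lemma adv_risk_lower:
  fixes f :: "real \<Rightarrow> real"
  assumes f: "continuous_on UNIV f" and n: "n > 0" and \<eta>: "0 \<le> \<eta>"
    and near: "\<And>k. k \<le> n \<Longrightarrow> k \<notin> Bad \<Longrightarrow> \<exists>y. \<bar>y - xtrain n k\<bar> \<le> \<eta> / n \<and> f y \<le> 0"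
    and Bad: "Bad \<subseteq> {..n}"
  shows "1 - adv_risk f (1 / n) \<le> 2 * \<eta> + card Bad / n"
proof -
  define A where "A = {x \<in> {-1..1}. \<exists>y. \<bar>y - x\<bar> \<le> 1 / n \<and> sgn (f y) \<noteq> sgn (1::real)}"
  have A: "A \<in> sets lborel" unfolding A_def by (rule adv_set_measurable[OF f])
  let ?x = "xtrain n"
  define C where "C = (\<lambda>k. if k \<in> Bad then {?x k - 1 / n .. ?x k + 1 / n}
     else {?x k - 1 / n .. ?x k - 1 / n + \<eta> / n} \<union> {?x k + 1 / n - \<eta> / n .. ?x k + 1 / n})"
  have sub: "{-1..1} \<subseteq> A \<union> (\<Union>k\<in>{..n}. C k)"
  proof
    fix x :: real assume x: "x \<in> {-1..1}"
    define t where "t = real n * (x + 1) / 2"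
    define k where "k = nat (round t)"
    have t: "0 \<le> t" "t \<le> n" using x n by (auto simp: t_def)
    have r0: "round t \<ge> 0" using t(1) by (simp add: round_def)
    have rk: "real k = of_int (round t)" using r0 by (simp add: k_def)
    have "round t \<le> round (real n)" using t(2) by (rule round_mono)
    then have "round t \<le> int n" by (simp add: round_of_nat)
    then have kn: "k \<le> n" by (simp add: k_def)
    have "\<bar>of_int (round t) - t\<bar> \<le> 1 / 2" by (rule of_int_round_abs_le)
    then have kt: "\<bar>t - real k\<bar> \<le> 1 / 2" unfolding rk by linarith
    have "x - ?x k = (t - real k) * (2 / n)" using n by (simp add: t_def xtrain_def field_simps)
    then have "\<bar>x - ?x k\<bar> = \<bar>t - real k\<bar> * \<bar>2 / n\<bar>" by (simp only: abs_mult)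
    then have "\<bar>x - ?x k\<bar> = \<bar>t - real k\<bar> * (2 / n)" by simp
    also have "\<dots> \<le> 1 / 2 * (2 / n)" using kt by (intro mult_right_mono) auto
    finally have close: "\<bar>x - ?x k\<bar> \<le> 1 / n" by simp
    show "x \<in> A \<union> (\<Union>k\<in>{..n}. C k)"
    proof (cases "k \<in> Bad")
      case True
      then have "x \<in> C k" using close by (auto simp: C_def abs_le_iff)
      then show ?thesis using kn by auto
    next
      case False
      then obtain y where y: "\<bar>y - ?x k\<bar> \<le> \<eta> / n" "f y \<le> 0" using near[OF kn] by blast
      show ?thesis
      proof (cases "\<bar>y - x\<bar> \<le> 1 / n")
        case True
        then have "x \<in> A" using x y unfolding A_def sgn_neq_1_iff by blast
        then show ?thesis by simp
      next
        case far: False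
        have "x \<in> C k" using False far y close by (auto simp: C_def)
        then show ?thesis using kn by auto
      qed
    qed
  qed
  have Cm: "C k \<in> fmeasurable lborel" for k
    unfolding C_def by (auto intro!: fmeasurable.Un Icc_fmeasurable)
  have mC: "measure lborel (C k) \<le> 2 * \<eta> / n + (if k \<in> Bad then 2 / n else 0)" for k
  proof (cases "k \<in> Bad")
    case True
    then show ?thesis using n \<eta> by (simp add: C_def)
  next
    case False
    have "C k = {?x k - 1 / n .. ?x k - 1 / n + \<eta> / n} \<union> {?x k + 1 / n - \<eta> / n .. ?x k + 1 / n}"
      using False by (simp add: C_def)
    then have "measure lborel (C k) \<le> measure lborel {?x k - 1 / n .. ?x k - 1 / n + \<eta> / n} + measure lborel {?x k + 1 / n - \<eta> / n .. ?x k + 1 / n}"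
      by (simp only: measure_Un_le sets_lborel borel_closed closed_atLeastAtMost)
    also have "\<dots> = \<eta> / n + \<eta> / n" using \<eta> by simp
    also have "\<dots> \<le> 2 * \<eta> / n + (if k \<in> Bad then 2 / n else 0)" using False by simp
    finally show ?thesis .
  qed
  have Af: "A \<in> fmeasurable lborel"
    using A by (intro fmeasurableI2[OF Icc_fmeasurable]) (auto simp: A_def)
  have "2 = measure lborel {-1..1::real}" by simp
  also have "\<dots> \<le> measure lborel (A \<union> (\<Union>k\<in>{..n}. C k))"
    using sub Af Cm by (intro measure_mono_fmeasurable fmeasurable.Un fmeasurable.finite_UN) auto
  also have "\<dots> \<le> measure lborel A + measure lborel (\<Union>k\<in>{..n}. C k)"
    using Af Cm by (intro measure_Un_le sets.finite_UN fmeasurableD) auto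
  also have "measure lborel (\<Union>k\<in>{..n}. C k) \<le> (\<Sum>k\<le>n. measure lborel (C k))"
    using Cm by (intro measure_UNION_le fmeasurableD) auto
  also have "\<dots> \<le> (\<Sum>k\<le>n. 2 * \<eta> / n + (if k \<in> Bad then 2 / n else 0))" by (intro sum_mono mC)
  also have "\<dots> = (real n + 1) * (2 * \<eta> / n) + card Bad * (2 / n)"
    using Bad by (simp add: sum.distrib sum.If_cases Int_absorb1 add.commute)
  also have "\<dots> \<le> 4 * \<eta> + card Bad * (2 / n)"
  proof -
    have "(real n + 1) * (2 * \<eta> / n) \<le> (2 * real n) * (2 * \<eta> / n)" using n \<eta> by (intro mult_right_mono) auto
    also have "\<dots> = 4 * \<eta>" using n by simp
    finally show ?thesis by simp
  qed
  finally have "2 - measure lborel A \<le> 4 * \<eta> + card Bad * (2 / n)" by linarith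
  moreover have "adv_risk f (1 / n) = measure lborel A / 2" by (simp add: adv_risk_def A_def)
  moreover have "card Bad * (2 / n) = 2 * (card Bad / n)" by simp
  ultimately show ?thesis by linarith
qed

lemma dip_near:
  assumes "n > 0" "dip_angle p n L l \<le> \<eta>"
  shows "\<bar>dip p n L k l - xtrain n k\<bar> \<le> \<eta> / n"
proof -
  have "\<bar>dip p n L k l - xtrain n k\<bar> = dip_angle p n L l / (n * pi)"
    using dip_angle_pos[of p n L l] assms by (simp add: dip_def)
  also have "\<dots> \<le> dip_angle p n L l / (n * 1)"
    using assms dip_angle_pos[of p n L l] pi_ge_two by (intro divide_left_mono mult_left_mono) auto
  also have "\<dots> \<le> \<eta> / n" using assms by (auto intro: divide_right_mono)
  finally show ?thesis .
qed

lemma adv_risk_fhat_tendsto_1: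
  assumes pq: "p > 1" "q > 1"
  shows "(\<lambda>n. adv_risk (fhat p q n) (1 / real n)) \<longlonglongrightarrow> 1"
proof -
  have "(\<lambda>n. 1 - 2 * dip_angle p n 1 1) \<longlonglongrightarrow> 1 - 2 * 0"
    by (intro tendsto_intros dip_angle_tendsto_0 pq)
  then have lim: "(\<lambda>n. 1 - 2 * dip_angle p n 1 1) \<longlonglongrightarrow> 1" by simp
  show ?thesis
  proof (rule tendsto_sandwich[OF _ _ lim tendsto_const])
    show "\<forall>\<^sub>F n in sequentially. 1 - 2 * dip_angle p n 1 1 \<le> adv_risk (fhat p q n) (1 / real n)"
      using eventually_regular[OF pq] eventually_fhat_dip_nonpos[OF pq, of 1 1]
    proof eventually_elim
      case (elim n)
      note r = regularD[OF elim(1)]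
      have "1 - adv_risk (fhat p q n) (1 / n) \<le> 2 * dip_angle p n 1 1 + card ({} :: nat set) / n"
        using elim(2) dip_near[OF r(1), of p 1 1 "dip_angle p n 1 1"] less_imp_le[OF dip_angle_pos]
        by (intro adv_risk_lower continuous_on_fhat r) (blast | simp)+
      then show ?case by simp
    qed
  qed (auto intro!: always_eventually adv_risk_le_1 continuous_on_fhat)
qed

section \<open>Outer probability and the random adversarial risk\<close>

lemma outer_prob_le:
  assumes "A \<in> sets M" "S \<inter> space M \<subseteq> A"
  shows "outer_prob M S \<le> measure M A"
  unfolding outer_prob_def using assms by (intro cInf_lower) (auto intro!: bdd_belowI[of _ 0])

lemma outer_prob_nonneg: "outer_prob M S \<ge> 0"
  unfolding outer_prob_def by (intro cInf_greatest) (auto intro!: exI[of _ "space M"])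

lemma conv_in_probI:
  assumes "\<And>e \<delta>. e > 0 \<Longrightarrow> \<delta> > 0 \<Longrightarrow> \<forall>\<^sub>F n in sequentially. \<exists>A\<in>sets (M n).
     {\<omega> \<in> space (M n). \<bar>X n \<omega> - L\<bar> > e} \<subseteq> A \<and> measure (M n) A < \<delta>"
  shows "conv_in_prob M X L"
  unfolding conv_in_prob_def
proof (intro allI impI order_tendstoI)
  fix e \<delta> :: real assume "e > 0" "\<delta> > 0"
  from assms[OF this]
  show "\<forall>\<^sub>F n in sequentially. outer_prob (M n) {\<omega> \<in> space (M n). \<bar>X n \<omega> - L\<bar> > e} < \<delta>"
  proof eventually_elim
    case (elim n)
    then obtain A where A: "A \<in> sets (M n)" "{\<omega> \<in> space (M n). \<bar>X n \<omega> - L\<bar> > e} \<subseteq> A" "measure (M n) A < \<delta>" by blast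
    then have "outer_prob (M n) {\<omega> \<in> space (M n). \<bar>X n \<omega> - L\<bar> > e} \<le> measure (M n) A"
      by (intro outer_prob_le) auto
    with A(3) show ?case by simp
  qed
next
  fix e a :: real assume "a < 0"
  then show "\<forall>\<^sub>F n in sequentially. a < outer_prob (M n) {\<omega> \<in> space (M n). \<bar>X n \<omega> - L\<bar> > e}"
    by (intro always_eventually allI less_le_trans[OF _ outer_prob_nonneg])
qed

lemma dimD_pos: "T > 0 \<Longrightarrow> n > 0 \<Longrightarrow> dimD T n > 0"
proof -
  assume "T > 0" "n > 0"
  then have "real n powr T \<ge> 1" by (intro ge_one_powr_ge_zero) auto
  then have "\<lfloor>real n powr T\<rfloor> \<ge> 1" by simp
  then show ?thesis by (simp add: dimD_def)
qed

text \<open>Each training input fails with probability at most \<open>294 / sqrt m\<close>. Markov's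
  inequality for the number of failures makes a given fraction of failures unlikely, whatever the
  dependence between different training inputs.\<close>

lemma adv_risk_ghat_conv:
  assumes pq: "p > 1" "q > 1" and T: "T > 0"
  shows "conv_in_prob (Zspace p q T) (\<lambda>n z. adv_risk (ghat p T n z) (1 / real n)) 1"
proof (rule conv_in_probI)
  fix e \<delta> :: real assume e: "e > 0" and \<delta>: "\<delta> > 0"
  \<comment> \<open>\<open>1176 = 2 * 2 * 294\<close>: one factor 2 from
    \<open>n + 1 \<le> 2 * n\<close>, the other from the threshold \<open>e * n / 2\<close>.\<close>
  obtain m :: nat where m: "m > 0" "1176 / (e * \<delta>) < sqrt m"
  proof -
    obtain m :: nat where "real m > (1176 / (e * \<delta>))\<^sup>2" using reals_Archimedean2 by blast
    then have "sqrt (real m) > \<bar>1176 / (e * \<delta>)\<bar>" by (metis real_sqrt_abs real_sqrt_less_mono)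
    then have "1176 / (e * \<delta>) < sqrt m" by linarith
    moreover have "m > 0"
      using \<open>real m > _\<close> zero_le_power2[of "1176 / (e * \<delta>)"] by (metis less_le_trans not_gr_zero of_nat_0 order_less_irrefl less_trans le_less_trans)
    ultimately show ?thesis by (rule that[rotated])
  qed
  \<comment> \<open>With this stride the two kernel estimates have the constants
    \<open>1 / (8 * m)\<close> and \<open>3 / (16 * m)^2\<close> that
    \<open>ghat_all_pos_event\<close> asks for.\<close>
  define L where "L = 16 * m"
  have L: "L > 0" using m by (simp add: L_def)
  have e4: "e / 4 > 0" using e by simp
  show "\<forall>\<^sub>F n in sequentially. \<exists>A\<in>sets (Zspace p q T n).
     {z \<in> space (Zspace p q T n). \<bar>adv_risk (ghat p T n z) (1 / real n) - 1\<bar> > e} \<subseteq> A \<and> measure (Zspace p q T n) A < \<delta>"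
    using eventually_regular[OF pq] eventually_fhat_dip_nonpos[OF pq, of m L]
      eventually_kern_dip_small[OF pq L, of m] eventually_kern_dip_train_small[OF pq L, of m]
      eventually_dip_angle_le[OF pq(1) e4, of m L]
  proof eventually_elim
    case (elim n)
    note r = regularD[OF elim(1)]
    interpret Z: prob_space "Zspace p q T n" by (rule prob_space_Zspace[OF r(6)])
    define N where "N = cfreq p q n * nfreq p n"
    have "\<exists>A\<in>sets (Zspace p q T n). {z \<in> space (Zspace p q T n). \<forall>l\<in>{1..m}. ghat p T n z (dip p n L k l) > 0} \<subseteq> A \<and>
       measure (Zspace p q T n) A \<le> 294 / sqrt m" for k
    proof (rule ghat_all_pos_event[OF elim(1) dimD_pos[OF T r(1)] m(1) N_def])
      show "fhat p q n (dip p n L k l) \<le> 0" if "l \<in> {1..m}" for l using elim(2) that by auto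
      show "\<bar>kern p q n (dip p n L k l) (dip p n L k l')\<bar> \<le> N / (8 * m)"
        if "l \<in> {1..m}" "l' \<in> {1..m}" "l \<noteq> l'" for l l'
        using elim(3)[rule_format, of l l' k] that by (simp add: N_def L_def)
      show "(\<Sum>i=1..n. (kern p q n (dip p n L k l) (xtrain n i))\<^sup>2) \<le> 3 / (real (16 * m))\<^sup>2 * N\<^sup>2"
        if "l \<in> {1..m}" for l
        using elim(4)[rule_format, of l k] that by (simp add: N_def L_def)
    qed
    then have "\<forall>k. \<exists>A. A \<in> sets (Zspace p q T n) \<and> {z \<in> space (Zspace p q T n). \<forall>l\<in>{1..m}. ghat p T n z (dip p n L k l) > 0} \<subseteq> A \<and>
       measure (Zspace p q T n) A \<le> 294 / sqrt m" by blast
    from choice[OF this] obtain A where A: "\<And>k. A k \<in> sets (Zspace p q T n)"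
      and Asub: "\<And>k. {z \<in> space (Zspace p q T n). \<forall>l\<in>{1..m}. ghat p T n z (dip p n L k l) > 0} \<subseteq> A k"
      and Am: "\<And>k. measure (Zspace p q T n) (A k) \<le> 294 / sqrt m" by blast
    define cnt where "cnt = (\<lambda>z. \<Sum>k\<le>n. indicator (A k) z :: real)"
    define F where "F = {z \<in> space (Zspace p q T n). cnt z \<ge> e * n / 2}"
    have cm: "cnt \<in> borel_measurable (Zspace p q T n)" unfolding cnt_def using A by measurable
    have Fm: "F \<in> sets (Zspace p q T n)" unfolding F_def using cm by measurable
    have "{z \<in> space (Zspace p q T n). \<bar>adv_risk (ghat p T n z) (1 / real n) - 1\<bar> > e} \<subseteq> F"
    proof
      fix z assume z: "z \<in> {z \<in> space (Zspace p q T n). \<bar>adv_risk (ghat p T n z) (1 / real n) - 1\<bar> > e}"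
      define Bad where "Bad = {k \<in> {..n}. z \<in> A k}"
      have c: "cnt z = card Bad"
        unfolding cnt_def Bad_def by (simp add: indicator_def sum.If_cases Int_def)
      \<comment> \<open>Dips within \<open>e / 4 / n\<close> of their training inputs lose at most
        \<open>e / 2\<close>, so an error above \<open>e\<close> forces at least
        \<open>e * n / 2\<close> bad indices.\<close>
      have "1 - adv_risk (ghat p T n z) (1 / n) \<le> 2 * (e / 4) + card Bad / n"
      proof (rule adv_risk_lower[OF continuous_on_ghat r(1)])
        fix k assume k: "k \<le> n" "k \<notin> Bad"
        then have "z \<notin> A k" by (simp add: Bad_def)
        then have "\<not> (\<forall>l\<in>{1..m}. ghat p T n z (dip p n L k l) > 0)" using Asub[of k] z by blast
        then obtain l where l: "l \<in> {1..m}" "ghat p T n z (dip p n L k l) \<le> 0" by (auto simp: not_less)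
        then show "\<exists>y. \<bar>y - xtrain n k\<bar> \<le> e / 4 / n \<and> ghat p T n z y \<le> 0"
          using elim(5) dip_near[OF r(1), of p L l "e / 4" k] by auto
      qed (use e in \<open>auto simp: Bad_def\<close>)
      moreover have "adv_risk (ghat p T n z) (1 / n) \<le> 1" by (intro adv_risk_le_1 continuous_on_ghat)
      moreover have "\<bar>adv_risk (ghat p T n z) (1 / n) - 1\<bar> > e" using z by simp
      ultimately have "card Bad / n \<ge> e / 2" by linarith
      then show "z \<in> F" using z r(1) c by (simp add: F_def field_simps)
    qed
    moreover have "measure (Zspace p q T n) F < \<delta>"
    proof -
      have int: "integrable (Zspace p q T n) cnt" unfolding cnt_def using A
        by (intro Bochner_Integration.integrable_sum integrable_real_indicator) (auto simp: Z.emeasure_eq_measure)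
      have "(\<integral>z. cnt z \<partial>Zspace p q T n) = (\<Sum>k\<le>n. measure (Zspace p q T n) (A k))"
        unfolding cnt_def using A
        by (subst Bochner_Integration.integral_sum)
           (auto simp: Int_absorb2 sets.sets_into_space Z.emeasure_eq_measure intro!: integrable_real_indicator)
      also have "\<dots> \<le> (\<Sum>k\<le>n. 294 / sqrt m)" by (intro sum_mono Am)
      also have "\<dots> = (real n + 1) * (294 / sqrt m)" by simp
      also have "\<dots> \<le> (2 * real n) * (294 / sqrt m)" using r(1) by (intro mult_right_mono) auto
      finally have E: "(\<integral>z. cnt z \<partial>Zspace p q T n) \<le> (2 * real n) * (294 / sqrt m)" .
      have "measure (Zspace p q T n) F \<le> (\<integral>z. cnt z \<partial>Zspace p q T n) / (e * n / 2)"
        unfolding F_def using int e r(1)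
        by (intro integral_Markov_inequality_measure[where A="{}"]) (auto simp: cnt_def intro!: sum_nonneg)
      also have "\<dots> \<le> (2 * real n) * (294 / sqrt m) / (e * n / 2)" using E e by (intro divide_right_mono) auto
      also have "\<dots> = 1176 / (e * sqrt m)" using r(1) by simp
      also have "\<dots> < \<delta>" using m e \<delta> by (simp add: field_simps)
      finally show ?thesis .
    qed
    ultimately show ?case using Fm by blast
  qed
qed

section \<open>Concentration of the empirical covariance\<close>

text \<open>Orthonormality removes all cross terms, and each squared functional has variance
  2.\<close>

lemma
  assumes I: "finite I" "I \<noteq> {}" and S: "finite S"
    and on: "\<And>i j. i \<in> S \<Longrightarrow> j \<in> S \<Longrightarrow> ip I (c i) (c j) = (if i = j then 1 else 0)"
  shows integrable_centered_chi2: "integrable (gaussPi I) (\<lambda>g. (\<Sum>i\<in>S. (ip I g (c i))\<^sup>2 - 1)\<^sup>2)" (is ?i)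
    and expectation_centered_chi2: "(\<integral>g. (\<Sum>i\<in>S. (ip I g (c i))\<^sup>2 - 1)\<^sup>2 \<partial>gaussPi I) = 2 * card S" (is ?e)
proof -
  interpret prob_space "gaussPi I" by (rule prob_space_gaussPi)
  let ?X = "\<lambda>l g. ip I g (c l)"
  have intX: "integrable (gaussPi I) (\<lambda>g. ?X l g ^ k)" for l k
    by (rule integrable_linear_gaussPi_power[OF I])
  have i4: "integrable (gaussPi I) (\<lambda>g. (?X l g)\<^sup>2 * (?X l' g)\<^sup>2)" for l l'
    by (rule integrable_gaussPi_mixed4[OF I])
  have eq: "(\<Sum>i\<in>S. (?X i g)\<^sup>2 - 1)\<^sup>2 = (\<Sum>l\<in>S. \<Sum>l'\<in>S. (?X l g)\<^sup>2 * (?X l' g)\<^sup>2 - (?X l g)\<^sup>2 - (?X l' g)\<^sup>2 + 1)" for g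
    unfolding power2_eq_square[of "sum _ _"] sum_product by (simp add: algebra_simps)
  show ?i unfolding eq by (intro Bochner_Integration.integrable_sum Bochner_Integration.integrable_add
      Bochner_Integration.integrable_diff i4 intX integrable_const)
  have one: "(\<integral>g. (?X l g)\<^sup>2 \<partial>gaussPi I) = 1" if "l \<in> S" for l
    using expectation_gaussPi_mixed2[OF I, of "c l" "c l"] on[OF that that] by (simp add: power2_eq_square)
  have e: "(\<integral>g. (?X l g)\<^sup>2 * (?X l' g)\<^sup>2 - (?X l g)\<^sup>2 - (?X l' g)\<^sup>2 + 1 \<partial>gaussPi I) = (if l = l' then 2 else 0)"
    if "l \<in> S" "l' \<in> S" for l l'
  proof -
    have "(\<integral>g. (?X l g)\<^sup>2 * (?X l' g)\<^sup>2 - (?X l g)\<^sup>2 - (?X l' g)\<^sup>2 + 1 \<partial>gaussPi I) =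
      (\<integral>g. (?X l g)\<^sup>2 * (?X l' g)\<^sup>2 \<partial>gaussPi I) - 1 - 1 + 1"
      using that i4 intX by (simp add: one prob_space)
    also have "\<dots> = (if l = l' then 2 else 0)"
      using that on by (simp add: expectation_gaussPi_mixed4[OF I])
    finally show ?thesis .
  qed
  have "(\<integral>g. (\<Sum>i\<in>S. (?X i g)\<^sup>2 - 1)\<^sup>2 \<partial>gaussPi I) =
    (\<Sum>l\<in>S. \<Sum>l'\<in>S. \<integral>g. (?X l g)\<^sup>2 * (?X l' g)\<^sup>2 - (?X l g)\<^sup>2 - (?X l' g)\<^sup>2 + 1 \<partial>gaussPi I)"
    unfolding eq
    by (subst Bochner_Integration.integral_sum, intro Bochner_Integration.integrable_sum Bochner_Integration.integrable_add
      Bochner_Integration.integrable_diff i4 intX integrable_const, intro sum.cong refl Bochner_Integration.integral_sum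
      Bochner_Integration.integrable_add Bochner_Integration.integrable_diff i4 intX integrable_const)
  also have "\<dots> = (\<Sum>l\<in>S. \<Sum>l'\<in>S. if l = l' then 2 else 0)" by (intro sum.cong refl e)
  finally show ?e using S by simp
qed

text \<open>A product of two distinct coordinates is half the difference of the squares of two
  normalised functionals, so an off-diagonal entry is half the difference of two centred chi-square
  sums, each with second moment \<open>2 * d\<close>. The square of that half difference is at most
  the mean of the two squares.\<close>

lemma
  fixes d B :: nat
  assumes dB: "d > 0" "j < B" "k < B"
  defines "I \<equiv> {..<d} \<times> {..<B}"
  shows integrable_empirical_cov: "integrable (gaussPi I) (\<lambda>g. ((\<Sum>i<d. g (i, j) * g (i, k)) - (if j = k then real d else 0))\<^sup>2)" (is ?i)
    and expectation_empirical_cov: "(\<integral>g. ((\<Sum>i<d. g (i, j) * g (i, k)) - (if j = k then real d else 0))\<^sup>2 \<partial>gaussPi I) \<le> 2 * d" (is ?e)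
proof -
  have I: "finite I" "I \<noteq> {}" using dB by (auto simp: I_def)
  define u where "u = (\<lambda>ij ij' :: nat \<times> nat. if ij' = ij then 1 else 0 :: real)"
  have coord: "ip I g (u ij) = g ij" if "ij \<in> I" for g ij
    using I that by (simp add: ip_def u_def if_distrib[where f="\<lambda>t. _ * t"] sum.delta cong: if_cong)
  have uu: "ip I (u a) (u b) = (if a = b then 1 else 0)" if "a \<in> I" "b \<in> I" for a b
    using coord[OF that(2), of "u a"] by (auto simp: u_def)
  have mem: "(i, j) \<in> I" "(i, k) \<in> I" if "i < d" for i using that dB by (auto simp: I_def)
  have "?i \<and> ?e"
  proof (cases "j = k")
    case True
    have on: "ip I (u (i, j)) (u (i', j)) = (if i = i' then 1 else 0)" if "i \<in> {..<d}" "i' \<in> {..<d}" for i i'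
      using uu[of "(i, j)" "(i', j)"] mem that by simp
    have eq: "((\<Sum>i<d. g (i, j) * g (i, k)) - (if j = k then real d else 0))\<^sup>2 = (\<Sum>i<d. (ip I g (u (i, j)))\<^sup>2 - 1)\<^sup>2" for g
      using True coord[OF mem(1)] by (simp add: sum_subtractf power2_eq_square)
    show ?thesis unfolding eq
      using integrable_centered_chi2[OF I finite_lessThan[of d], of "\<lambda>i. u (i, j)"]
        expectation_centered_chi2[OF I finite_lessThan[of d], of "\<lambda>i. u (i, j)"] on by simp
  next
    case False
    define a where "a = (\<lambda>i ij. (1 / sqrt 2) * (u (i, j) ij + u (i, k) ij))"
    define b where "b = (\<lambda>i ij. (1 / sqrt 2) * (u (i, j) ij - u (i, k) ij))"
    have on: "ip I (a i) (a i') = (if i = i' then 1 else 0)" "ip I (b i) (b i') = (if i = i' then 1 else 0)"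
      if "i \<in> {..<d}" "i' \<in> {..<d}" for i i'
      unfolding a_def b_def ip_scale_left ip_scale_right ip_add_left ip_add_right ip_diff_left ip_diff_right
      using that False mem by (auto simp: uu)
    let ?X = "\<lambda>g. \<Sum>i<d. (ip I g (a i))\<^sup>2 - 1" and ?Y = "\<lambda>g. \<Sum>i<d. (ip I g (b i))\<^sup>2 - 1"
    have X: "integrable (gaussPi I) (\<lambda>g. (?X g)\<^sup>2)" "(\<integral>g. (?X g)\<^sup>2 \<partial>gaussPi I) = 2 * d"
      using integrable_centered_chi2[OF I finite_lessThan[of d], of a] expectation_centered_chi2[OF I finite_lessThan[of d], of a] on by auto
    have Y: "integrable (gaussPi I) (\<lambda>g. (?Y g)\<^sup>2)" "(\<integral>g. (?Y g)\<^sup>2 \<partial>gaussPi I) = 2 * d"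
      using integrable_centered_chi2[OF I finite_lessThan[of d], of b] expectation_centered_chi2[OF I finite_lessThan[of d], of b] on by auto
    have eq: "((\<Sum>i<d. g (i, j) * g (i, k)) - (if j = k then real d else 0)) = (?X g - ?Y g) / 2" for g
    proof -
      have t: "g (i, j) * g (i, k) = ((ip I g (a i))\<^sup>2 - (ip I g (b i))\<^sup>2) / 2" if "i < d" for i
      proof -
        have "ip I g (a i) = (g (i, j) + g (i, k)) / sqrt 2" "ip I g (b i) = (g (i, j) - g (i, k)) / sqrt 2"
          unfolding a_def b_def ip_scale_right ip_add_right ip_diff_right using coord[OF mem(1)[OF that]] coord[OF mem(2)[OF that]] by simp_all
        moreover have "x * y = (((x + y) / sqrt 2)\<^sup>2 - ((x - y) / sqrt 2)\<^sup>2) / 2" for x y :: real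
          by (simp add: power_divide power2_eq_square field_simps)
        ultimately show ?thesis by simp
      qed
      have "(\<Sum>i<d. g (i, j) * g (i, k)) = (\<Sum>i<d. ((ip I g (a i))\<^sup>2 - (ip I g (b i))\<^sup>2) / 2)"
        by (intro sum.cong refl t) simp
      also have "\<dots> = (?X g - ?Y g) / 2"
        by (simp add: sum_subtractf flip: sum_divide_distrib)
      finally show ?thesis using False by simp
    qed
    have le: "((\<Sum>i<d. g (i, j) * g (i, k)) - (if j = k then real d else 0))\<^sup>2 \<le> ((?X g)\<^sup>2 + (?Y g)\<^sup>2) / 2" for g
    proof -
      have "0 \<le> (?X g + ?Y g)\<^sup>2" by simp
      then show ?thesis unfolding eq power_divide by (simp add: power2_sum power2_diff)
    qed
    have int: "integrable (gaussPi I) (\<lambda>g. ((?X g)\<^sup>2 + (?Y g)\<^sup>2) / 2)" using X Y by auto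
    have m: "(\<lambda>g. ((\<Sum>i<d. g (i, j) * g (i, k)) - (if j = k then real d else 0))\<^sup>2) \<in> borel_measurable (gaussPi I)"
    proof -
      have "(\<lambda>g. g ij) \<in> borel_measurable (gaussPi I)" if "ij \<in> I" for ij
        using measurable_component_singleton[OF that, of "\<lambda>_. std_normal_distribution"] by simp
      then show ?thesis
        using mem by (intro borel_measurable_power borel_measurable_diff borel_measurable_sum borel_measurable_times
          borel_measurable_const) auto
    qed
    have i: ?i by (rule Bochner_Integration.integrable_bound[OF int m]) (use le in auto)
    then have "(\<integral>g. ((\<Sum>i<d. g (i, j) * g (i, k)) - (if j = k then real d else 0))\<^sup>2 \<partial>gaussPi I) \<le>
      (\<integral>g. ((?X g)\<^sup>2 + (?Y g)\<^sup>2) / 2 \<partial>gaussPi I)"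
      using int le by (intro integral_mono) auto
    also have "\<dots> = 2 * d" using X Y by simp
    finally show ?thesis using i by blast
  qed
  then show ?i ?e by auto
qed

definition empcov :: "real \<Rightarrow> real \<Rightarrow> real \<Rightarrow> nat \<Rightarrow> (nat \<Rightarrow> nat \<Rightarrow> real) \<Rightarrow> nat \<Rightarrow> nat \<Rightarrow> real" where
  "empcov p q T n z j k = (\<Sum>i<dimD T n. z i j * z i k) / dimD T n - (if j = k then lam p q n j else 0)"

text \<open>The eigenvalues are normalised so that the trace of the covariance equals the dimension;
  moving mass to the constant feature does not change it.\<close>

lemma sum_lam:
  assumes "nfreq p n > 0"
  shows "(\<Sum>j<dimB p n. lam p q n j) = dimB p n"
proof -
  have "(\<Sum>f=1..nfreq p n. lam p q n (2 * f - Suc 0) + lam p q n (2 * f)) = (\<Sum>f=1..nfreq p n. 2 * cfreq p q n)"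
    by (intro sum.cong refl) (auto simp: lam_freq cfreq_def)
  then have "(\<Sum>j<dimB p n. lam p q n j) = gam q n * dimB p n + 2 * nfreq p n * cfreq p q n"
    unfolding sum_dimB by (simp add: lam_def)
  also have "2 * nfreq p n * cfreq p q n = (1 - gam q n) * dimB p n"
    using assms by (simp add: cfreq_def dimB_def)
  finally show ?thesis by (simp add: algebra_simps)
qed

text \<open>In whitened coordinates the squared entries carry the weights
  \<open>lam j * lam k / d^2\<close>, which sum to the squared trace over \<open>d^2\<close>. The
  expected squared Frobenius norm is therefore at most \<open>2 * B^2 / d\<close>, and Markov's
  inequality applies.\<close>

lemma empcov_frobenius_prob:
  assumes reg: "regular p q n" and T: "T > 0" and s: "s > 0"
  shows "\<exists>A\<in>sets (Zspace p q T n).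
     {z \<in> space (Zspace p q T n). (\<Sum>j<dimB p n. \<Sum>k<dimB p n. (empcov p q T n z j k)\<^sup>2) \<ge> s\<^sup>2 * (real (dimB p n))\<^sup>2 / dimD T n} \<subseteq> A
     \<and> measure (Zspace p q T n) A \<le> 2 / s\<^sup>2"
proof -
  note r = regularD[OF reg]
  let ?d = "dimD T n" and ?B = "dimB p n" and ?l = "lam p q n"
  have d: "?d > 0" by (rule dimD_pos[OF T r(1)])
  have B: "?B > 0" by (simp add: dimB_def)
  define I where "I = {..<?d} \<times> {..<?B}"
  define h where "h = (\<lambda>j k (g :: nat \<times> nat \<Rightarrow> real). ((\<Sum>i<?d. g (i, j) * g (i, k)) - (if j = k then real ?d else 0))\<^sup>2)"
  define F where "F = (\<lambda>g. \<Sum>j<?B. \<Sum>k<?B. ?l j * ?l k / (real ?d)\<^sup>2 * h j k g)"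
  have hi: "integrable (gaussPi I) (h j k)" and he: "(\<integral>g. h j k g \<partial>gaussPi I) \<le> 2 * ?d" if "j < ?B" "k < ?B" for j k
    using integrable_empirical_cov[OF d that] expectation_empirical_cov[OF d that] by (auto simp: h_def I_def)
  interpret G: prob_space "gaussPi I" by (rule prob_space_gaussPi)
  interpret Z: prob_space "Zspace p q T n" by (rule prob_space_Zspace[OF r(6)])
  define W where "W = whiten p q T n"
  have Wm: "W \<in> Zspace p q T n \<rightarrow>\<^sub>M gaussPi I" and Wd: "distr (Zspace p q T n) (gaussPi I) W = gaussPi I"
    using measurable_whiten[of p n q T] distr_whiten[of p n q T] r(6) by (auto simp: W_def I_def)
  have Fi: "integrable (gaussPi I) F"
    unfolding F_def using hi by (intro Bochner_Integration.integrable_sum integrable_mult_right) auto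
  have F0: "F g \<ge> 0" for g
    unfolding F_def h_def using r(6) by (intro sum_nonneg mult_nonneg_nonneg divide_nonneg_nonneg) (auto simp: less_imp_le)
  have "(\<integral>g. F g \<partial>gaussPi I) = (\<Sum>j<?B. \<Sum>k<?B. ?l j * ?l k / (real ?d)\<^sup>2 * (\<integral>g. h j k g \<partial>gaussPi I))"
    unfolding F_def using hi
    by (subst Bochner_Integration.integral_sum, intro Bochner_Integration.integrable_sum integrable_mult_right, simp,
        intro sum.cong refl, subst Bochner_Integration.integral_sum, intro integrable_mult_right, simp, simp)
  also have "\<dots> \<le> (\<Sum>j<?B. \<Sum>k<?B. ?l j * ?l k / (real ?d)\<^sup>2 * (2 * ?d))"
    using he r(6) by (intro sum_mono mult_left_mono divide_nonneg_nonneg mult_nonneg_nonneg) (auto simp: less_imp_le)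
  also have "\<dots> = (\<Sum>j<?B. \<Sum>k<?B. ?l j * ?l k) * (2 / ?d)"
    using d by (simp add: sum_distrib_right sum_divide_distrib power2_eq_square mult.assoc)
  also have "(\<Sum>j<?B. \<Sum>k<?B. ?l j * ?l k) = (real ?B)\<^sup>2"
    unfolding sum_product[symmetric] sum_lam[OF r(3)] by (simp add: power2_eq_square)
  finally have EF: "(\<integral>g. F g \<partial>gaussPi I) \<le> (real ?B)\<^sup>2 * (2 / ?d)" .
  have FW: "F (W z) = (\<Sum>j<?B. \<Sum>k<?B. (empcov p q T n z j k)\<^sup>2)" for z
    unfolding F_def
  proof (intro sum.cong refl)
    fix j k assume jk: "j \<in> {..<?B}" "k \<in> {..<?B}"
    then have l: "?l j > 0" "?l k > 0" using r(6) by auto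
    have "(\<Sum>i<?d. W z (i, j) * W z (i, k)) = (\<Sum>i<?d. z i j * z i k / (sqrt (?l j) * sqrt (?l k)))"
      using jk by (intro sum.cong) (auto simp: W_def whiten_def)
    also have "\<dots> = (\<Sum>i<?d. z i j * z i k) / (sqrt (?l j) * sqrt (?l k))" by (simp add: sum_divide_distrib)
    finally have "h j k (W z) = ((\<Sum>i<?d. z i j * z i k) / (sqrt (?l j) * sqrt (?l k)) - (if j = k then real ?d else 0))\<^sup>2"
      by (simp add: h_def)
    moreover have "?l j * ?l k = (sqrt (?l j) * sqrt (?l k))\<^sup>2" using l by (simp add: power_mult_distrib)
    ultimately have "?l j * ?l k / (real ?d)\<^sup>2 * h j k (W z) =
        ((sqrt (?l j) * sqrt (?l k)) / ?d * ((\<Sum>i<?d. z i j * z i k) / (sqrt (?l j) * sqrt (?l k)) - (if j = k then real ?d else 0)))\<^sup>2"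
      by (simp only: power_mult_distrib power_divide)
    also have "(sqrt (?l j) * sqrt (?l k)) / ?d * ((\<Sum>i<?d. z i j * z i k) / (sqrt (?l j) * sqrt (?l k)) - (if j = k then real ?d else 0)) =
       empcov p q T n z j k"
      using l d by (auto simp: empcov_def right_diff_distrib)
    finally show "?l j * ?l k / (real ?d)\<^sup>2 * h j k (W z) = (empcov p q T n z j k)\<^sup>2" .
  qed
  define t where "t = s\<^sup>2 * (real ?B)\<^sup>2 / ?d"
  have t: "t > 0" using s d B by (simp add: t_def)
  define A0 where "A0 = {g \<in> space (gaussPi I). F g \<ge> t}"
  have A0: "A0 \<in> sets (gaussPi I)" unfolding A0_def using borel_measurable_integrable[OF Fi] by measurable
  define A where "A = W -` A0 \<inter> space (Zspace p q T n)"
  have "A \<in> sets (Zspace p q T n)" unfolding A_def by (rule measurable_sets[OF Wm A0])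
  moreover have "{z \<in> space (Zspace p q T n). (\<Sum>j<?B. \<Sum>k<?B. (empcov p q T n z j k)\<^sup>2) \<ge> t} \<subseteq> A"
    using FW measurable_space[OF Wm] by (auto simp: A_def A0_def)
  moreover have "measure (Zspace p q T n) A \<le> 2 / s\<^sup>2"
  proof -
    have "measure (Zspace p q T n) A = measure (gaussPi I) A0"
      unfolding A_def using A0 Wm by (subst measure_distr[symmetric, of W _ "gaussPi I"]) (auto simp: Wd)
    also have "\<dots> \<le> (\<integral>g. F g \<partial>gaussPi I) / t"
      unfolding A0_def using Fi F0 t by (intro integral_Markov_inequality_measure[where A="{}"]) auto
    also have "\<dots> \<le> (real ?B)\<^sup>2 * (2 / ?d) / t" using EF t by (intro divide_right_mono) auto
    also have "\<dots> = 2 / s\<^sup>2" using d B s by (simp add: t_def)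
    finally show ?thesis .
  qed
  ultimately show ?thesis unfolding t_def by blast
qed

section \<open>From covariance error to interpolant error\<close>

definition mixfeat :: "nat \<Rightarrow> (nat \<Rightarrow> real) \<Rightarrow> nat \<Rightarrow> real" where
  "mixfeat n v j = (\<Sum>k=1..n. v k * phi (xtrain n k) j)"

lemma bilinear_frobenius_le:
  fixes B :: nat
  assumes "(\<Sum>j<B. \<Sum>k<B. (E j k)\<^sup>2) \<le> \<delta>\<^sup>2" "\<delta> \<ge> 0"
  shows "\<bar>\<Sum>j<B. \<Sum>k<B. a j * b k * E j k\<bar> \<le> \<delta> * sqrt (ip {..<B} a a) * sqrt (ip {..<B} b b)"
proof -
  have "(\<Sum>j<B. \<Sum>k<B. a j * b k * E j k)\<^sup>2 = (\<Sum>jk\<in>{..<B} \<times> {..<B}. (a (fst jk) * b (snd jk)) * E (fst jk) (snd jk))\<^sup>2"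
    by (simp add: sum.cartesian_product case_prod_beta')
  also have "\<dots> \<le> (\<Sum>jk\<in>{..<B} \<times> {..<B}. (a (fst jk) * b (snd jk))\<^sup>2) * (\<Sum>jk\<in>{..<B} \<times> {..<B}. (E (fst jk) (snd jk))\<^sup>2)"
    by (rule Cauchy_Schwarz_ineq_sum)
  also have "(\<Sum>jk\<in>{..<B} \<times> {..<B}. (a (fst jk) * b (snd jk))\<^sup>2) = ip {..<B} a a * ip {..<B} b b"
    by (simp add: ip_def sum_product sum.cartesian_product case_prod_beta' power2_eq_square algebra_simps)
  also have "(\<Sum>jk\<in>{..<B} \<times> {..<B}. (E (fst jk) (snd jk))\<^sup>2) = (\<Sum>j<B. \<Sum>k<B. (E j k)\<^sup>2)"
    by (simp add: sum.cartesian_product case_prod_beta')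
  also have "ip {..<B} a a * ip {..<B} b b * (\<Sum>j<B. \<Sum>k<B. (E j k)\<^sup>2) \<le> ip {..<B} a a * ip {..<B} b b * \<delta>\<^sup>2"
    using assms by (intro mult_left_mono) (auto simp: ip_self_nonneg)
  finally have "sqrt ((\<Sum>j<B. \<Sum>k<B. a j * b k * E j k)\<^sup>2) \<le> sqrt (ip {..<B} a a * ip {..<B} b b * \<delta>\<^sup>2)"
    by (rule real_sqrt_le_mono)
  then show ?thesis using assms(2) by (simp add: real_sqrt_mult mult_ac)
qed

text \<open>A deterministic estimate. \<open>H\<close> is the empirical bilinear form,
  \<open>\<Lambda>\<close> the exact one and \<open>Bf\<close> their difference, of size at most
  \<open>\<delta>\<close>. \<open>ghat\<close> is a dual combination with weights \<open>v\<close>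
  in the form \<open>H\<close>, and \<open>fhat\<close> one with constant weight \<open>b\<close> in
  the form \<open>\<Lambda>\<close>. Changing the form contributes 12 and changing the weights 216
  to the constant 228.\<close>

lemma ghat_fhat_perturbation:
  assumes reg: "regular p q n" and d: "dimD T n > 0" and nc: "real n * cnst p q n \<le> nfreq p n"
    and fro: "(\<Sum>j<dimB p n. \<Sum>k<dimB p n. (empcov p q T n z j k)\<^sup>2) \<le> \<delta>\<^sup>2" and \<delta>: "0 \<le> \<delta>" "\<delta> \<le> 1 / 12"
  shows "\<bar>ghat p T n z x - fhat p q n x\<bar> \<le> 228 * \<delta> * sqrt n"
proof -
  note r = regularD[OF reg]
  let ?B = "{..<dimB p n}" and ?d = "dimD T n" and ?l = "lam p q n" and ?c = "cfreq p q n"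
  define M where "M = real (nalias p n)"
  define E where "E = empcov p q T n z"
  define \<Lambda> where "\<Lambda> = (\<lambda>a b. \<Sum>j<dimB p n. ?l j * a j * b j)"
  define Bf where "Bf = (\<lambda>a b. \<Sum>j<dimB p n. \<Sum>k<dimB p n. a j * b k * E j k)"
  define Zf where "Zf = (\<lambda>i a. \<Sum>j<dimB p n. z i j * a j)"
  define H where "H = (\<lambda>a b. (\<Sum>i<?d. Zf i a * Zf i b) / ?d)"
  define nv where "nv = (\<lambda>v. sqrt (\<Sum>k=1..n. (v k)\<^sup>2))"
  define nf where "nf = (\<lambda>a. sqrt (ip ?B a a))"
  let ?f = "mixfeat n"
  define one :: "nat \<Rightarrow> real" where "one = (\<lambda>_. 1)"
  have M: "M \<ge> 1" using r(2) by (simp add: M_def)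
  have Mn: "M * n > 0" using M r(1) by simp
  have KM: "M * n \<le> nfreq p n" "real (nfreq p n) \<le> 2 * (M * n)"
  proof -
    have "real (nalias p n * n) \<le> real (nfreq p n)" using nalias_bounds(1)[OF r(1), of p] by (simp only: of_nat_le_iff)
    then show "M * n \<le> nfreq p n" by (simp add: M_def)
    have "real (nfreq p n) \<le> real ((nalias p n + 1) * n)" using nalias_bounds(2)[OF r(1), of p] by (simp only: of_nat_le_iff)
    also have "\<dots> = (M + 1) * n" by (simp add: M_def algebra_simps)
    also have "\<dots> \<le> (2 * M) * n" using M by (intro mult_right_mono) auto
    finally show "real (nfreq p n) \<le> 2 * (M * n)" by simp
  qed
  have n1: "real n \<ge> 1" using r(1) by simp
  have nv0: "nv v \<ge> 0" and nv2: "nv v * nv v = (\<Sum>k=1..n. (v k)\<^sup>2)" for v by (auto simp: nv_def sum_nonneg)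
  have sumle: "\<bar>\<Sum>k=1..n. v k\<bar> \<le> sqrt n * nv v" for v
  proof -
    have "(\<Sum>k=1..n. v k * 1)\<^sup>2 \<le> (\<Sum>k=1..n. (v k)\<^sup>2) * (\<Sum>k=1..n. 1\<^sup>2)" by (rule Cauchy_Schwarz_ineq_sum)
    then have "sqrt ((\<Sum>k=1..n. v k)\<^sup>2) \<le> sqrt ((\<Sum>k=1..n. (v k)\<^sup>2) * n)" by (intro real_sqrt_le_mono) simp
    then show ?thesis by (simp add: nv_def real_sqrt_mult mult.commute)
  qed
  have HB: "H a b = \<Lambda> a b + Bf a b" for a b
  proof -
    have "(\<Sum>i<?d. Zf i a * Zf i b) = (\<Sum>i<?d. \<Sum>j<dimB p n. \<Sum>k<dimB p n. a j * b k * (z i j * z i k))"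
      unfolding Zf_def sum_product by (intro sum.cong refl) (simp add: mult_ac)
    also have "\<dots> = (\<Sum>j<dimB p n. \<Sum>i<?d. \<Sum>k<dimB p n. a j * b k * (z i j * z i k))" by (rule sum.swap)
    also have "\<dots> = (\<Sum>j<dimB p n. \<Sum>k<dimB p n. \<Sum>i<?d. a j * b k * (z i j * z i k))" by (intro sum.cong refl sum.swap)
    also have "\<dots> = (\<Sum>j<dimB p n. \<Sum>k<dimB p n. a j * b k * (\<Sum>i<?d. z i j * z i k))" by (simp add: sum_distrib_left)
    finally have "H a b = (\<Sum>j<dimB p n. \<Sum>k<dimB p n. a j * b k * ((\<Sum>i<?d. z i j * z i k) / ?d))"
      unfolding H_def times_divide_eq_right sum_divide_distrib[symmetric] by simp
    also have "\<dots> = (\<Sum>j<dimB p n. \<Sum>k<dimB p n. a j * b k * E j k + (if k = j then a j * b k * ?l j else 0))"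
      by (intro sum.cong refl) (auto simp: E_def empcov_def algebra_simps)
    also have "\<dots> = Bf a b + \<Lambda> a b"
      by (simp add: sum.distrib Bf_def \<Lambda>_def mult_ac)
    finally show ?thesis by simp
  qed
  have Ble: "\<bar>Bf a b\<bar> \<le> \<delta> * nf a * nf b" for a b
    unfolding Bf_def nf_def E_def by (rule bilinear_frobenius_le[OF fro \<delta>(1)])
  have fmix: "nf (?f v) \<le> sqrt (3 * (M * n)) * nv v" for v
  proof -
    have "ip ?B (?f v) (?f v) \<le> (M + 2) * n * (\<Sum>k=1..n. (v k)\<^sup>2)"
      using quad_form_upper[OF r(1), where p=p and a=v] by (simp add: ip_def mixfeat_def M_def power2_eq_square)
    also have "\<dots> \<le> 3 * (M * n) * (\<Sum>k=1..n. (v k)\<^sup>2)"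
      using mult_right_mono[OF M, of "real n"] by (intro mult_right_mono sum_nonneg) (auto simp: algebra_simps)
    finally show ?thesis unfolding nf_def nv_def real_sqrt_mult[symmetric] by (rule real_sqrt_le_mono)
  qed
  have fphi: "nf (phi x) \<le> sqrt (3 * (M * n))" for x
  proof -
    have "ip ?B (phi x) (phi x) = 1 / 2 + nfreq p n" using sum_phi_squared[of x p n] by (simp add: ip_def power2_eq_square)
    also have "\<dots> \<le> 3 * (M * n)" using KM(2) mult_mono[OF M n1] M by simp
    finally show ?thesis unfolding nf_def by (rule real_sqrt_le_mono)
  qed
  have nf0: "nf a \<ge> 0" for a by (simp add: nf_def ip_self_nonneg)
  have BBmix: "\<bar>Bf (?f u) (?f v)\<bar> \<le> \<delta> * (3 * (M * n)) * (nv u * nv v)" for u v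
  proof -
    have "nf (?f u) * nf (?f v) \<le> (sqrt (3 * (M * n)) * nv u) * (sqrt (3 * (M * n)) * nv v)"
      using fmix nf0 nv0 Mn by (intro mult_mono) auto
    also have "\<dots> = (3 * (M * n)) * (nv u * nv v)" using Mn by (simp add: mult_ac flip: real_sqrt_mult)
    finally have "\<delta> * (nf (?f u) * nf (?f v)) \<le> \<delta> * ((3 * (M * n)) * (nv u * nv v))" using \<delta> by (intro mult_left_mono) auto
    then show ?thesis using Ble[of "?f u" "?f v"] by (simp add: mult_ac)
  qed
  have Hlow: "M * n / 4 * (nv v * nv v) \<le> H (?f v) (?f v)" for v
  proof -
    have "?c * (M * n) * (nv v * nv v) \<le> \<Lambda> (?f v) (?f v)"
      using quad_form_lower[OF r(1), where p=p and q=q and a=v] r(4) cnst_nonneg[of p q n]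
      by (simp add: \<Lambda>_def mixfeat_def M_def nv2 power2_eq_square mult_ac)
    moreover have "1 / 2 * (M * n) * (nv v * nv v) \<le> ?c * (M * n) * (nv v * nv v)"
      using r(4) Mn nv0 by (intro mult_right_mono) auto
    moreover have "\<delta> * (3 * (M * n)) * (nv v * nv v) \<le> 1 / 12 * (3 * (M * n)) * (nv v * nv v)"
      using \<delta> Mn nv0 by (intro mult_right_mono) auto
    ultimately show ?thesis using BBmix[of v v] unfolding HB by (simp add: algebra_simps)
  qed
  have Zmix: "Zf i (?f v) = (\<Sum>k=1..n. v k * phiRFS p n z (xtrain n k) i)" for i v
  proof -
    have "Zf i (?f v) = (\<Sum>j<dimB p n. \<Sum>k=1..n. v k * (z i j * phi (xtrain n k) j))"
      by (simp add: Zf_def mixfeat_def sum_distrib_left mult_ac)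
    also have "\<dots> = (\<Sum>k=1..n. \<Sum>j<dimB p n. v k * (z i j * phi (xtrain n k) j))" by (rule sum.swap)
    finally show ?thesis by (simp add: phiRFS_def sum_distrib_left)
  qed
  have Zphi: "Zf i (phi x) = phiRFS p n z x i" for i x by (simp add: Zf_def phiRFS_def)
  define U where "U = (\<lambda>k i. phiRFS p n z (xtrain n k) i)"
  \<comment> \<open>Coercivity makes the empirical Gram matrix positive definite, so on this event
    \<open>beta_hat\<close> is a genuine minimiser with an explicit dual form.\<close>
  have "\<exists>c. \<forall>k\<in>{1..n}. ip {..<?d} (U k) (\<lambda>i. \<Sum>j\<in>{1..n}. c j * U j i) = 1"
  proof (rule ip_gram_solvable)
    fix c k assume k: "k \<in> {1..n}" "c k \<noteq> (0 :: real)"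
    have "0 < (c k)\<^sup>2" using k by simp
    also have "\<dots> \<le> (\<Sum>k=1..n. (c k)\<^sup>2)" using k by (intro member_le_sum) auto
    finally have "0 < M * n / 4 * (nv c * nv c)" using Mn by (simp add: nv2)
    also have "\<dots> \<le> H (?f c) (?f c)" by (rule Hlow)
    also have "\<dots> = ip {..<?d} (\<lambda>i. \<Sum>j\<in>{1..n}. c j * U j i) (\<lambda>i. \<Sum>j\<in>{1..n}. c j * U j i) / ?d"
      by (simp add: H_def Zmix ip_def U_def)
    finally show "ip {..<?d} (\<lambda>i. \<Sum>j\<in>{1..n}. c j * U j i) (\<lambda>i. \<Sum>j\<in>{1..n}. c j * U j i) > 0"
      using d by (simp add: zero_less_divide_iff)
  qed auto
  then obtain w where w: "\<And>k. k \<in> {1..n} \<Longrightarrow> ip {..<?d} (U k) (\<lambda>i. \<Sum>j\<in>{1..n}. w j * U j i) = 1" by blast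
  define \<beta>0 where "\<beta>0 = (\<lambda>i. if i < ?d then 1 * (\<Sum>k\<in>{1..n}. w k * U k i) else 0)"
  have "beta_hat p T n z = \<beta>0"
  proof -
    have "(\<Sum>i<?d. U k i * \<beta>0 i) = 1" if "k \<in> {1..n}" for k
      using w[OF that] by (simp add: \<beta>0_def ip_def)
    then have "arg_min (\<lambda>\<beta>. \<Sum>i<?d. (\<beta> i)\<^sup>2 / 1) (\<lambda>\<beta>. (\<forall>k\<in>{1..n}. (\<Sum>i<?d. U k i * \<beta> i) = 1) \<and> (\<forall>i\<ge>?d. \<beta> i = 0)) = \<beta>0"
      by (intro arg_min_weighted_norm[where b=w]) (auto simp: \<beta>0_def)
    then show ?thesis by (simp add: beta_hat_def U_def)
  qed
  \<comment> \<open>\<open>H\<close> averages over the draws; scaling by their number makes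
    \<open>v\<close> comparable with the weight \<open>b\<close> of \<open>fhat\<close>.\<close>
  define v where "v = (\<lambda>k. ?d * w k)"
  have gH: "ghat p T n z x = H (phi x) (?f v)" for x
  proof -
    have "ghat p T n z x = (\<Sum>i<?d. (\<Sum>k\<in>{1..n}. w k * U k i) * phiRFS p n z x i)"
      unfolding ghat_def \<open>beta_hat p T n z = \<beta>0\<close> by (intro sum.cong) (auto simp: \<beta>0_def)
    also have "\<dots> = (\<Sum>i<?d. (\<Sum>k\<in>{1..n}. v k * U k i) * phiRFS p n z x i) / ?d"
      using d by (simp add: v_def sum_divide_distrib sum_distrib_left sum_distrib_right mult.assoc)
    finally show ?thesis by (simp add: H_def Zphi Zmix U_def mult.commute)
  qed
  have Hone: "H (phi (xtrain n k)) (?f v) = 1" if "k \<in> {1..n}" for k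
  proof -
    have "H (phi (xtrain n k)) (?f v) = (\<Sum>i<?d. U k i * (\<Sum>j\<in>{1..n}. ?d * (w j * U j i))) / ?d"
      by (simp add: H_def Zphi Zmix U_def v_def mult.assoc)
    also have "\<dots> = (\<Sum>i<?d. U k i * (\<Sum>j\<in>{1..n}. w j * U j i))"
      using d by (simp add: sum_divide_distrib flip: sum_distrib_left)
    finally show ?thesis using w[OF that] by (simp add: ip_def)
  qed
  have mix_left: "G (?f u) b = (\<Sum>k=1..n. u k * G (phi (xtrain n k)) b)"
    if "\<And>a. G a b = (\<Sum>j<dimB p n. a j * g j)" for G :: "(nat \<Rightarrow> real) \<Rightarrow> (nat \<Rightarrow> real) \<Rightarrow> real" and u b g
  proof -
    have "G (?f u) b = (\<Sum>j<dimB p n. \<Sum>k=1..n. u k * (phi (xtrain n k) j * g j))"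
      unfolding that by (simp add: mixfeat_def sum_distrib_right mult.assoc)
    also have "\<dots> = (\<Sum>k=1..n. \<Sum>j<dimB p n. u k * (phi (xtrain n k) j * g j))" by (rule sum.swap)
    finally show ?thesis unfolding that by (simp add: sum_distrib_left)
  qed
  have Llin: "\<Lambda> a b = (\<Sum>j<dimB p n. a j * (?l j * b j))" for a b by (simp add: \<Lambda>_def mult_ac)
  have Blin: "Bf a b = (\<Sum>j<dimB p n. a j * (\<Sum>k<dimB p n. b k * E j k))" for a b
    by (simp add: Bf_def sum_distrib_left mult_ac)
  have Hlin: "H a b = (\<Sum>j<dimB p n. a j * (?l j * b j + (\<Sum>k<dimB p n. b k * E j k)))" for a b
    unfolding HB Llin Blin by (simp add: sum.distrib distrib_left)
  have Hsym: "H a b = H b a" for a b by (simp add: H_def mult.commute)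
  have Hmix: "H (?f u) (?f v) = (\<Sum>k=1..n. u k)" for u
    using mix_left[of H "?f v", OF Hlin] Hone by simp
  have nvv: "nv v \<le> 4 * sqrt n / (M * n)"
  proof (cases "nv v = 0")
    case False
    then have pos: "nv v > 0" using nv0[of v] by linarith
    have "M * n / 4 * (nv v * nv v) \<le> (\<Sum>k=1..n. v k)" using Hlow[of v] Hmix[of v] by simp
    also have "\<dots> \<le> sqrt n * nv v" using sumle[of v] by linarith
    finally have "M * n / 4 * nv v \<le> sqrt n" using pos by simp
    then show ?thesis using Mn by (simp add: field_simps)
  qed (use Mn in simp)
  define b where "b = 1 / (real n * (cnst p q n + ?c * M))"
  have b0: "b > 0" using r(1,7) by (simp add: b_def M_def)
  have b1: "b \<le> 2 / (M * n)"
  proof -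
    have "1 / 2 * M \<le> ?c * M" using r(4) M by (intro mult_right_mono) auto
    then have "M / 2 \<le> cnst p q n + ?c * M" using cnst_nonneg[of p q n] by linarith
    then have "real n * (M / 2) \<le> real n * (cnst p q n + ?c * M)" by (intro mult_left_mono) auto
    then have "b \<le> 1 / (real n * (M / 2))" unfolding b_def using Mn M n1 by (intro divide_left_mono mult_pos_pos) (auto intro: add_nonneg_pos cnst_nonneg)
    then show ?thesis by (simp add: mult.commute)
  qed
  have L1: "\<Lambda> (phi y) (?f one) = (\<Sum>k=1..n. kern p q n y (xtrain n k))" for y
  proof -
    have "\<Lambda> (phi y) (?f one) = (\<Sum>j<dimB p n. \<Sum>k=1..n. ?l j * phi y j * phi (xtrain n k) j)"
      by (simp add: \<Lambda>_def mixfeat_def one_def sum_distrib_left)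
    also have "\<dots> = (\<Sum>k=1..n. \<Sum>j<dimB p n. ?l j * phi y j * phi (xtrain n k) j)" by (rule sum.swap)
    finally show ?thesis by (simp add: kern_def)
  qed
  have fL: "fhat p q n y = b * \<Lambda> (phi y) (?f one)" for y
    unfolding L1 sum_kern_xtrain[OF r(1)] regular_fhat_eq[OF reg] b_def M_def using r(1) by simp
  have Ltr: "b * \<Lambda> (phi (xtrain n k)) (?f one) = 1" for k
    unfolding L1 sum_kern_xtrain[OF r(1)] cos_xtrain_alias[OF r(1)] b_def M_def using r(1,7) by simp
  have Lmix: "b * \<Lambda> (?f u) (?f one) = (\<Sum>k=1..n. u k)" for u
  proof -
    have "\<Lambda> (?f u) (?f one) = (\<Sum>k=1..n. u k * \<Lambda> (phi (xtrain n k)) (?f one))"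
      by (rule mix_left[of \<Lambda>, OF Llin])
    then have "b * \<Lambda> (?f u) (?f one) = (\<Sum>k=1..n. u k * (b * \<Lambda> (phi (xtrain n k)) (?f one)))"
      by (simp add: sum_distrib_left mult_ac)
    then show ?thesis by (simp add: Ltr)
  qed
  define u where "u = (\<lambda>k. v k - b)"
  have fu: "?f u = (\<lambda>j. ?f v j - b * ?f one j)"
    by (simp add: u_def mixfeat_def one_def fun_eq_iff algebra_simps sum_subtractf sum_distrib_left)
  \<comment> \<open>Both interpolants take the value 1 at all training inputs, so pairing with
    \<open>?f u\<close> gives the sum of \<open>u\<close> in either form. The main terms cancel and
    only \<open>Bf\<close> remains.\<close>
  have Hu: "H (?f u) (?f u) = - b * Bf (?f u) (?f one)"
  proof -
    have "H (?f u) (?f u) = H (?f u) (?f v) - b * H (?f u) (?f one)"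
    proof -
      have "H (?f u) (?f u) = H (\<lambda>j. ?f v j - b * ?f one j) (?f u)" by (simp only: fu)
      also have "\<dots> = H (?f v) (?f u) - b * H (?f one) (?f u)"
        unfolding Hlin by (simp add: algebra_simps sum_subtractf sum_distrib_left)
      finally show ?thesis by (simp only: Hsym)
    qed
    then show ?thesis unfolding Hmix unfolding HB distrib_left Lmix by simp
  qed
  have nvo: "nv one = sqrt n" by (simp add: nv_def one_def)
  \<comment> \<open>The identity \<open>Hu\<close> bounds a quadratic expression in \<open>u\<close>
    by a linear one. The constant is \<open>24 = 4 * 6\<close>: the 4 from coercivity, the 6 from
    \<open>b \<le> 2 / (M * n)\<close> and the factor 3 in \<open>BBmix\<close>.\<close>
  have nvu: "nv u \<le> 24 * \<delta> * sqrt n / (M * n)"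
  proof (cases "nv u = 0")
    case False
    then have pos: "nv u > 0" using nv0[of u] by linarith
    have "M * n / 4 * (nv u * nv u) \<le> - b * Bf (?f u) (?f one)" using Hlow[of u] Hu by simp
    also have "\<dots> \<le> b * \<bar>Bf (?f u) (?f one)\<bar>"
      using b0 mult_left_mono[OF abs_ge_minus_self[of "Bf (?f u) (?f one)"], of b] by simp
    also have "\<dots> \<le> b * (\<delta> * (3 * (M * n)) * (nv u * sqrt n))"
      using b0 BBmix[of u one] nvo by (intro mult_left_mono) auto
    finally have "(M * n / 4 * nv u) * nv u \<le> (b * \<delta> * (3 * (M * n)) * sqrt n) * nv u" by (simp add: mult_ac)
    then have "M * n / 4 * nv u \<le> b * \<delta> * (3 * (M * n)) * sqrt n" using pos by (rule mult_right_le_imp_le)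
    also have "\<dots> = b * (\<delta> * (3 * (M * n)) * sqrt n)" by simp
    also have "\<dots> \<le> 2 / (M * n) * (\<delta> * (3 * (M * n)) * sqrt n)" using b1 \<delta> Mn by (intro mult_right_mono) auto
    also have "\<dots> = 6 * \<delta> * sqrt n" using Mn M r(1) by auto
    finally show ?thesis using Mn by (simp add: field_simps)
  qed (use Mn \<delta> in simp)
  have diff: "ghat p T n z x - fhat p q n x = Bf (phi x) (?f v) + \<Lambda> (phi x) (?f u)"
    unfolding gH fL HB fu by (simp add: \<Lambda>_def algebra_simps sum_subtractf sum_distrib_left)
  have t1: "\<bar>Bf (phi x) (?f v)\<bar> \<le> 12 * \<delta> * sqrt n"
  proof -
    have "nf (phi x) * nf (?f v) \<le> sqrt (3 * (M * n)) * (sqrt (3 * (M * n)) * (4 * sqrt n / (M * n)))"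
      using fphi fmix[of v] nvv nf0 Mn by (intro mult_mono order_trans[OF fmix[of v]] mult_left_mono) auto
    also have "\<dots> = (sqrt (3 * (M * n)) * sqrt (3 * (M * n))) * (4 * sqrt n / (M * n))" by simp
    also have "\<dots> = 12 * sqrt n" using Mn M r(1) by auto
    finally have "\<delta> * (nf (phi x) * nf (?f v)) \<le> \<delta> * (12 * sqrt n)" using \<delta> by (intro mult_left_mono) auto
    then show ?thesis using Ble[of "phi x" "?f v"] by (simp add: mult_ac)
  qed
  have t2: "\<bar>\<Lambda> (phi x) (?f u)\<bar> \<le> 216 * \<delta> * sqrt n"
  proof -
    \<comment> \<open>The eigenvalue of the constant feature can greatly exceed the common value
      \<open>?c\<close>, so its excess is split off. That part sees only the sum of
      \<open>u\<close>, and \<open>nc\<close> keeps its weight within a multiple of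
      \<open>M * n\<close>.\<close>
    have "\<Lambda> (phi x) (?f u) = (\<Sum>j<dimB p n. (if j = 0 then (?l 0 - ?c) * phi x 0 * ?f u 0 else 0) + ?c * (phi x j * ?f u j))"
      unfolding \<Lambda>_def by (intro sum.cong refl) (auto simp: lam_def cfreq_def algebra_simps)
    also have "\<dots> = (?l 0 - ?c) * phi x 0 * ?f u 0 + ?c * ip ?B (phi x) (?f u)"
    proof -
      have "0 < dimB p n" by (simp add: dimB_def)
      then show ?thesis by (simp add: sum.distrib ip_def sum_distrib_left)
    qed
    also have "(?l 0 - ?c) * phi x 0 * ?f u 0 = (cnst p q n - ?c / 2) * (\<Sum>k=1..n. u k)"
      by (simp add: mixfeat_def phi_simps lam_def cnst_def algebra_simps flip: sum_divide_distrib)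
    finally have eq: "\<Lambda> (phi x) (?f u) = (cnst p q n - ?c / 2) * (\<Sum>k=1..n. u k) + ?c * ip ?B (phi x) (?f u)" .
    have sn: "sqrt n \<le> real n" using n1 by (simp add: real_le_lsqrt power2_eq_square)
    have c1: "\<bar>cnst p q n - ?c / 2\<bar> \<le> cnst p q n + 1" using cnst_nonneg[of p q n] r(4,5) by linarith
    have "\<bar>(cnst p q n - ?c / 2) * (\<Sum>k=1..n. u k)\<bar> \<le> (cnst p q n + 1) * (real n * nv u)"
      unfolding abs_mult using c1 order_trans[OF sumle mult_right_mono[OF sn nv0]] cnst_nonneg[of p q n]
      by (intro mult_mono) auto
    also have "\<dots> = (real n * cnst p q n + real n) * nv u" by (simp add: algebra_simps)
    also have "\<dots> \<le> (2 * (M * n) + M * n) * nv u"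
    proof (intro mult_right_mono add_mono nv0)
      show "real n * cnst p q n \<le> 2 * (M * n)" using nc KM(2) by linarith
      show "real n \<le> M * n" using mult_right_mono[OF M, of "real n"] by simp
    qed
    finally have a1: "\<bar>(cnst p q n - ?c / 2) * (\<Sum>k=1..n. u k)\<bar> \<le> 3 * (M * n) * nv u" by (simp add: algebra_simps)
    have "\<bar>ip ?B (phi x) (?f u)\<bar> \<le> nf (phi x) * nf (?f u)" unfolding nf_def by (rule abs_ip_le)
    also have "\<dots> \<le> sqrt (3 * (M * n)) * (sqrt (3 * (M * n)) * nv u)"
      using fphi fmix[of u] nf0 Mn by (intro mult_mono) auto
    also have "\<dots> = 3 * (M * n) * nv u" using Mn by (simp flip: mult.assoc)
    finally have "\<bar>?c * ip ?B (phi x) (?f u)\<bar> \<le> 2 * (3 * (M * n) * nv u)"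
      unfolding abs_mult using r(4,5) by (intro mult_mono) auto
    then have "\<bar>\<Lambda> (phi x) (?f u)\<bar> \<le> 9 * (M * n) * nv u" using a1 unfolding eq by linarith
    also have "\<dots> \<le> 9 * (M * n) * (24 * \<delta> * sqrt n / (M * n))" using nvu Mn by (intro mult_left_mono) auto
    also have "\<dots> = 216 * \<delta> * sqrt n" using Mn M r(1) by auto
    finally show ?thesis .
  qed
  have "\<bar>ghat p T n z x - fhat p q n x\<bar> \<le> \<bar>Bf (phi x) (?f v)\<bar> + \<bar>\<Lambda> (phi x) (?f u)\<bar>" unfolding diff by (rule abs_triangle_ineq)
  then show ?thesis using t1 t2 by linarith
qed

section \<open>Sign measure of the Dirichlet kernel\<close>

lemma measure_lborel_affine_preimage:
  fixes c t :: real
  assumes A: "A \<in> sets borel" and c: "c \<noteq> 0"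
  shows "measure lborel {x. t + c * x \<in> A} = measure lborel A / \<bar>c\<bar>"
proof -
  have "emeasure lborel A = (\<integral>\<^sup>+x. indicator A x \<partial>lborel)" using A by simp
  also have "\<dots> = \<bar>c\<bar> * (\<integral>\<^sup>+x. indicator A (t + c * x) \<partial>lborel)"
    using A c by (intro nn_integral_real_affine) auto
  also have "(\<lambda>x. indicator A (t + c * x)) = (indicator {x. t + c * x \<in> A} :: real \<Rightarrow> ennreal)"
    by (auto simp: indicator_def)
  also have "(\<integral>\<^sup>+x. indicator {x. t + c * x \<in> A} x \<partial>lborel) = emeasure lborel {x. t + c * x \<in> A}"
  proof -
    have "(\<lambda>x. t + c * x) -` A \<inter> space borel \<in> sets borel" using A by measurable
    then show ?thesis by (simp add: vimage_def)
  qed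
  finally have "measure lborel A = \<bar>c\<bar> * measure lborel {x. t + c * x \<in> A}"
    unfolding measure_def by (simp add: enn2real_mult)
  then show ?thesis using c by simp
qed

lemma measure_periodic:
  fixes A :: "real set"
  assumes A: "A \<in> sets borel" and per: "\<And>y. y + 1 \<in> A \<longleftrightarrow> y \<in> A"
  shows "measure lborel (A \<inter> {0..<real n}) = n * measure lborel (A \<inter> {0..<1})"
proof (induction n)
  case (Suc n)
  have pern: "real m + y \<in> A \<longleftrightarrow> y \<in> A" for m y
  proof (induction m)
    case (Suc m)
    then show ?case using per[of "real m + y"] by (simp add: algebra_simps)
  qed simp
  have "{x. - real n + 1 * x \<in> A \<inter> {0..<1}} = A \<inter> {real n..<real (Suc n)}"
  proof -
    have "- real n + x \<in> A \<longleftrightarrow> x \<in> A" for x using pern[of n "x - real n"] by (simp add: algebra_simps)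
    then show ?thesis by auto
  qed
  then have tr: "measure lborel (A \<inter> {real n..<real (Suc n)}) = measure lborel (A \<inter> {0..<1})"
    using measure_lborel_affine_preimage[of "A \<inter> {0..<1}" 1 "- real n"] A by simp
  have fm: "A \<inter> {a..<b} \<in> fmeasurable lborel" for a b :: real
    using A by (intro fmeasurableI2[OF Icc_fmeasurable[of a b]]) auto
  have "A \<inter> {0..<real (Suc n)} = (A \<inter> {0..<real n}) \<union> (A \<inter> {real n..<real (Suc n)})" by auto
  then have "measure lborel (A \<inter> {0..<real (Suc n)}) = measure lborel (A \<inter> {0..<real n}) + measure lborel (A \<inter> {real n..<real (Suc n)})"
    using fm[THEN fmeasurableD] fm[THEN fmeasurableD2] by (simp only:) (intro measure_Union, auto)
  then show ?case using Suc tr by (simp add: algebra_simps)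
qed simp

lemma abs_sin_pi_ge:
  assumes "\<bar>s\<bar> \<le> 1 / 2"
  shows "\<bar>s\<bar> \<le> \<bar>sin (pi * s)\<bar>"
proof -
  define x where "x = pi * s"
  have "\<bar>sin x - (\<Sum>m<3. sin_coeff m * x ^ m)\<bar> \<le> inverse (fact 3) * \<bar>x\<bar> ^ 3"
    by (rule Maclaurin_sin_bound)
  also have "(\<Sum>m<3. sin_coeff m * x ^ m) = x" by (simp add: eval_nat_numeral sin_coeff_def)
  finally have 1: "\<bar>sin x - x\<bar> \<le> \<bar>x\<bar> ^ 3 / 6" by (simp add: fact_numeral)
  have "\<bar>x\<bar> \<le> pi * (1 / 2)" unfolding x_def abs_mult using assms by (intro mult_mono) auto
  moreover have "pi \<le> 16 / 5" by (rule order_trans[OF pi_approx(2)]) simp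
  ultimately have x: "\<bar>x\<bar> \<le> 8 / 5" by linarith
  have "\<bar>x\<bar> ^ 3 = \<bar>x\<bar> * \<bar>x\<bar> ^ 2" by (simp add: power3_eq_cube power2_eq_square)
  also have "\<dots> \<le> \<bar>x\<bar> * (8 / 5) ^ 2" using x by (intro mult_left_mono power_mono) auto
  finally have "\<bar>x\<bar> ^ 3 / 6 \<le> \<bar>x\<bar> / 2" by (simp add: power2_eq_square)
  then have "\<bar>x\<bar> / 2 \<le> \<bar>sin x\<bar>" using 1 by linarith
  moreover have "2 * \<bar>s\<bar> \<le> \<bar>x\<bar>" unfolding x_def abs_mult using pi_gt3 by (intro mult_right_mono) auto
  ultimately show ?thesis by (simp add: x_def)
qed

text \<open>The absolute value of \<open>sin (pi * t)\<close> is at least the distance from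
  \<open>t\<close> to the nearest integer, so the set lies in at most \<open>5 * \<kappa>\<close>
  intervals of length \<open>2 * \<delta> / \<kappa>\<close>. The frequency cancels, and the bound
  is uniform in frequency and phase.\<close>

lemma measure_small_sin:
  fixes \<kappa> \<omega> \<delta> :: real
  assumes \<kappa>: "\<kappa> \<ge> 1" and \<omega>: "0 \<le> \<omega>" "\<omega> \<le> 1" and \<delta>: "\<delta> \<ge> 0"
  shows "measure lborel {y \<in> {0..1}. \<bar>sin (pi * (\<kappa> * y + \<omega>))\<bar> \<le> \<delta>} \<le> 10 * \<delta>"
proof -
  define J where "J = nat \<lceil>\<kappa>\<rceil> + 1"
  define C where "C = (\<lambda>j::nat. {(j - \<omega> - \<delta>) / \<kappa> .. (j - \<omega> + \<delta>) / \<kappa>})"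
  have sub: "{y \<in> {0..1}. \<bar>sin (pi * (\<kappa> * y + \<omega>))\<bar> \<le> \<delta>} \<subseteq> (\<Union>j\<in>{..J}. C j)"
  proof
    fix y assume y: "y \<in> {y \<in> {0..1}. \<bar>sin (pi * (\<kappa> * y + \<omega>))\<bar> \<le> \<delta>}"
    define t where "t = \<kappa> * y + \<omega>"
    define j where "j = nat (round t)"
    have "\<kappa> * y \<le> \<kappa> * 1" using y \<kappa> by (intro mult_left_mono) auto
    then have "t \<le> \<kappa> + 1" using \<omega> unfolding t_def by linarith
    moreover have "0 \<le> \<kappa> * y" using y \<kappa> by simp
    ultimately have t: "0 \<le> t" "t \<le> \<kappa> + 1" using \<omega> by (auto simp: t_def)
    have r0: "round t \<ge> 0" using t(1) by (simp add: round_def)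
    have rj: "real j = of_int (round t)" using r0 by (simp add: j_def)
    have "t \<le> of_int (\<lceil>\<kappa>\<rceil> + 1)" using t(2) by (simp add: le_of_int_ceiling order_trans[OF _ add_right_mono[OF le_of_int_ceiling]])
    then have "round t \<le> \<lceil>\<kappa>\<rceil> + 1" using round_mono by (metis round_of_int)
    then have jJ: "j \<le> J" using \<kappa> by (simp add: j_def J_def nat_le_iff)
    define s where "s = t - real j"
    have s: "\<bar>s\<bar> \<le> 1 / 2" using of_int_round_abs_le[of t] unfolding s_def rj by linarith
    have "\<bar>sin (pi * t)\<bar> = \<bar>sin (pi * s)\<bar>"
    proof -
      have "pi * t = pi * s + pi * of_int (int j)" by (simp add: s_def algebra_simps)
      then have "sin (pi * t) = sin (pi * s) * cos (pi * of_int (int j)) + cos (pi * s) * sin (pi * of_int (int j))"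
        by (simp only: sin_add)
      moreover have z: "sin (pi * of_int (int j)) = 0" by (simp add: sin_zero_iff_int2 mult.commute)
      moreover have "\<bar>cos (pi * of_int (int j))\<bar> = 1"
        using sin_cos_squared_add[of "pi * of_int (int j)"] z by (simp add: power2_eq_1_iff abs_if split: if_splits)
      ultimately show ?thesis by (simp add: abs_mult)
    qed
    then have "\<bar>s\<bar> \<le> \<delta>" using abs_sin_pi_ge[OF s] y by (simp add: t_def)
    then have "y \<in> C j" using \<kappa> by (auto simp: C_def s_def t_def field_simps abs_le_iff)
    then show "y \<in> (\<Union>j\<in>{..J}. C j)" using jJ by blast
  qed
  have mC: "measure lborel (C j) = 2 * \<delta> / \<kappa>" for j
  proof -
    have "(j - \<omega> - \<delta>) / \<kappa> \<le> (j - \<omega> + \<delta>) / \<kappa>" using \<delta> \<kappa> by (intro divide_right_mono) auto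
    then show ?thesis by (simp add: C_def flip: diff_divide_distrib)
  qed
  have Cf: "C j \<in> fmeasurable lborel" for j by (simp add: C_def Icc_fmeasurable)
  have ms: "{y \<in> {0..1}. \<bar>sin (pi * (\<kappa> * y + \<omega>))\<bar> \<le> \<delta>} \<in> sets lborel"
    by measurable
  have "measure lborel {y \<in> {0..1}. \<bar>sin (pi * (\<kappa> * y + \<omega>))\<bar> \<le> \<delta>} \<le> measure lborel (\<Union>j\<in>{..J}. C j)"
    using sub ms Cf by (intro measure_mono_fmeasurable fmeasurable.finite_UN) auto
  also have "\<dots> \<le> (\<Sum>j\<le>J. measure lborel (C j))" using Cf by (intro measure_UNION_le fmeasurableD) auto
  also have "\<dots> = (real J + 1) * (2 * \<delta> / \<kappa>)" by (simp add: mC)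
  also have "\<dots> \<le> (5 * \<kappa>) * (2 * \<delta> / \<kappa>)"
  proof (intro mult_right_mono)
    have "real (nat \<lceil>\<kappa>\<rceil>) < \<kappa> + 1" using \<kappa> by linarith
    then show "real J + 1 \<le> 5 * \<kappa>" using \<kappa> by (simp add: J_def)
  qed (use \<delta> \<kappa> in auto)
  also have "\<dots> = 10 * \<delta>" using \<kappa> by simp
  finally show ?thesis .
qed

text \<open>The unit interval is one period of \<open>fhat\<close> in the variable \<open>y = n (x + 1) / 2\<close>.\<close>

definition mres :: "nat \<Rightarrow> real \<Rightarrow> real" where
  "mres M a = measure lborel {y \<in> {0..1}. sin (real (2 * M + 1) * pi * y) \<le> a * sin (pi * y)}"

text \<open>As the left-hand sine is at least -1, the inequality confines
  \<open>sin (pi * y)\<close> to at most \<open>1 / \<bar>a\<bar>\<close>.\<close>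

lemma mres_large_negative:
  assumes "a < 0"
  shows "mres M a \<le> 10 / \<bar>a\<bar>"
proof -
  have "mres M a \<le> measure lborel {y \<in> {0..1}. \<bar>sin (pi * (1 * y + 0))\<bar> \<le> 1 / \<bar>a\<bar>}"
    unfolding mres_def
  proof (rule measure_mono_fmeasurable)
    show "{y \<in> {0..1}. sin (real (2 * M + 1) * pi * y) \<le> a * sin (pi * y)} \<subseteq> {y \<in> {0..1}. \<bar>sin (pi * (1 * y + 0))\<bar> \<le> 1 / \<bar>a\<bar>}"
    proof safe
      fix y :: real assume y: "y \<in> {0..1}" "sin (real (2 * M + 1) * pi * y) \<le> a * sin (pi * y)"
      have s: "sin (pi * y) \<ge> 0" using y by (intro sin_ge_zero) (auto simp: mult_left_le)
      have "-1 \<le> a * sin (pi * y)" using y(2) sin_ge_minus_one[of "real (2 * M + 1) * pi * y"] by linarith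
      then have "\<bar>a\<bar> * sin (pi * y) \<le> 1" using assms by simp
      then show "\<bar>sin (pi * (1 * y + 0))\<bar> \<le> 1 / \<bar>a\<bar>" using assms s by (simp add: field_simps)
    qed
    show "{y \<in> {0..1}. \<bar>sin (pi * (1 * y + 0))\<bar> \<le> 1 / \<bar>a\<bar>} \<in> fmeasurable lborel"
      by (intro fmeasurableI2[OF Icc_fmeasurable[of 0 1]]) auto
  qed measurable
  also have "\<dots> \<le> 10 * (1 / \<bar>a\<bar>)" by (rule measure_small_sin) auto
  finally show ?thesis by simp
qed

text \<open>For \<open>a = 0\<close> and \<open>a = 1\<close> the right-hand side equals
  \<open>sin (a * pi * y)\<close>, so the difference of the two sides factors into a product of two
  sines, up to phase. If it is at most \<open>\<epsilon>\<close> in absolute value, one factor is at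
  most \<open>sqrt \<epsilon>\<close>, and \<open>measure_small_sin\<close> bounds the measure of
  such \<open>y\<close> uniformly in \<open>M\<close>.\<close>

lemma mres_perturb:
  fixes a a' :: real
  assumes M: "M > 0" and a: "a = 0 \<or> a = 1"
  shows "\<bar>mres M a' - mres M a\<bar> \<le> 20 * sqrt \<bar>a' - a\<bar>"
proof -
  let ?N = "real (2 * M + 1)"
  define \<epsilon> where "\<epsilon> = \<bar>a' - a\<bar>"
  define S where "S = (\<lambda>a. {y \<in> {0..1}. sin (?N * pi * y) \<le> a * sin (pi * y)})"
  define D where "D = {y \<in> {0..1}. \<bar>sin (?N * pi * y) - a * sin (pi * y)\<bar> \<le> \<epsilon>}"
  define D1 where "D1 = {y \<in> {0..1}. \<bar>sin (pi * ((?N + a) / 2 * y + 1 / 2))\<bar> \<le> sqrt \<epsilon>}"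
  define D2 where "D2 = {y \<in> {0..1}. \<bar>sin (pi * ((?N - a) / 2 * y + 0))\<bar> \<le> sqrt \<epsilon>}"
  have [measurable]: "S b \<in> sets borel" "D \<in> sets borel" "D1 \<in> sets borel" "D2 \<in> sets borel" for b
    unfolding S_def D_def D1_def D2_def by measurable
  have fm: "A \<in> fmeasurable lborel" if "A \<in> sets borel" "A \<subseteq> {0..1::real}" for A
    using that by (intro fmeasurableI2[OF Icc_fmeasurable[of 0 1]]) auto
  have Sf: "S b \<in> fmeasurable lborel" for b by (rule fm, measurable) (auto simp: S_def)
  have Df: "D \<in> fmeasurable lborel" "D1 \<in> fmeasurable lborel" "D2 \<in> fmeasurable lborel"
    by (rule fm, measurable, auto simp: D_def D1_def D2_def)+
  have close: "y \<in> D" if "y \<in> S b \<union> S c" "y \<notin> S b \<or> y \<notin> S c" "b = a" "c = a'" for y b c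
  proof -
    have y: "y \<in> {0..1}" using that by (auto simp: S_def)
    have s: "sin (pi * y) \<ge> 0" using y by (intro sin_ge_zero) (auto simp: mult_left_le)
    have "\<bar>a' * sin (pi * y) - a * sin (pi * y)\<bar> = \<bar>a' - a\<bar> * sin (pi * y)"
      using s by (simp add: abs_mult flip: left_diff_distrib)
    also have "\<dots> \<le> \<epsilon> * 1" unfolding \<epsilon>_def by (intro mult_left_mono) auto
    finally show ?thesis using that y by (auto simp: S_def D_def)
  qed
  have le1: "measure lborel (S a') \<le> measure lborel (S a) + measure lborel D"
  proof -
    have "measure lborel (S a') \<le> measure lborel (S a \<union> D)"
      using Sf Df close[of _ a a'] by (intro measure_mono_fmeasurable fmeasurable.Un) auto
    also have "\<dots> \<le> measure lborel (S a) + measure lborel D" by (intro measure_Un_le) auto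
    finally show ?thesis .
  qed
  have le2: "measure lborel (S a) \<le> measure lborel (S a') + measure lborel D"
  proof -
    have "measure lborel (S a) \<le> measure lborel (S a' \<union> D)"
      using Sf Df close[of _ a a'] by (intro measure_mono_fmeasurable fmeasurable.Un) auto
    also have "\<dots> \<le> measure lborel (S a') + measure lborel D" by (intro measure_Un_le) auto
    finally show ?thesis .
  qed
  have DD: "D \<subseteq> D1 \<union> D2"
  proof
    fix y assume y: "y \<in> D"
    have "a * sin (pi * y) = sin (a * pi * y)" using a by auto
    then have "sin (?N * pi * y) - a * sin (pi * y) = 2 * sin ((?N * pi * y - a * pi * y) / 2) * cos ((?N * pi * y + a * pi * y) / 2)"
      by (simp only: sin_diff_sin)
    also have "(?N * pi * y - a * pi * y) / 2 = pi * ((?N - a) / 2 * y + 0)" by (simp add: field_simps)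
    also have "cos ((?N * pi * y + a * pi * y) / 2) = sin (pi * ((?N + a) / 2 * y + 1 / 2))"
    proof -
      have "pi * ((?N + a) / 2 * y + 1 / 2) = (?N * pi * y + a * pi * y) / 2 + pi / 2" by (simp add: field_simps)
      then have "sin (pi * ((?N + a) / 2 * y + 1 / 2)) = sin ((?N * pi * y + a * pi * y) / 2 + pi / 2)" by (rule arg_cong)
      then show ?thesis unfolding sin_add by simp
    qed
    finally have p: "\<bar>2 * sin (pi * ((?N - a) / 2 * y + 0)) * sin (pi * ((?N + a) / 2 * y + 1 / 2))\<bar> \<le> \<epsilon>" (is "\<bar>2 * ?u * ?w\<bar> \<le> _")
      using y by (simp add: D_def)
    show "y \<in> D1 \<union> D2"
    proof (rule ccontr)
      assume "y \<notin> D1 \<union> D2"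
      then have "\<bar>?w\<bar> > sqrt \<epsilon>" "\<bar>?u\<bar> > sqrt \<epsilon>" using y by (auto simp: D1_def D2_def D_def)
      then have "\<bar>?u\<bar> * \<bar>?w\<bar> > sqrt \<epsilon> * sqrt \<epsilon>" by (intro mult_strict_mono') (auto simp: \<epsilon>_def)
      then have "\<bar>?u * ?w\<bar> > \<epsilon>" by (simp add: \<epsilon>_def abs_mult)
      moreover have "\<bar>2 * ?u * ?w\<bar> = 2 * \<bar>?u * ?w\<bar>" by (simp add: abs_mult)
      moreover have "\<epsilon> \<ge> 0" by (simp add: \<epsilon>_def)
      ultimately show False using p by linarith
    qed
  qed
  have "measure lborel D \<le> measure lborel (D1 \<union> D2)"
    using DD Df by (intro measure_mono_fmeasurable fmeasurable.Un) auto
  also have "\<dots> \<le> measure lborel D1 + measure lborel D2" by (intro measure_Un_le) auto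
  also have "\<dots> \<le> 10 * sqrt \<epsilon> + 10 * sqrt \<epsilon>"
    unfolding D1_def D2_def using M a by (intro add_mono measure_small_sin) (auto simp: \<epsilon>_def)
  finally show ?thesis using le1 le2 by (simp add: mres_def S_def \<epsilon>_def abs_le_iff)
qed

section \<open>Exact measures at the thresholds 0 and 1, and their limits\<close>

lemma sin_gt_sin_iff:
  fixes \<alpha> x :: real
  assumes \<alpha>: "0 \<le> \<alpha>" "\<alpha> \<le> pi / 2" and x: "x \<ge> 0"
  shows "sin x > sin \<alpha> \<longleftrightarrow> (\<exists>j::nat. 2 * pi * j + \<alpha> < x \<and> x < 2 * pi * j + pi - \<alpha>)"
proof
  assume "\<exists>j::nat. 2 * pi * j + \<alpha> < x \<and> x < 2 * pi * j + pi - \<alpha>"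
  then obtain j :: nat where j: "2 * pi * j + \<alpha> < x" "x < 2 * pi * j + pi - \<alpha>" by blast
  define t where "t = x - 2 * pi * j"
  have "x = t + 2 * pi * of_int (int j)" by (simp add: t_def)
  then have "sin x = sin t * cos (2 * pi * of_int (int j)) + cos t * sin (2 * pi * of_int (int j))" by (simp only: sin_add)
  then have st: "sin x = sin t" unfolding sin_int_2pin cos_int_2pin by simp
  have t: "\<alpha> < t" "t < pi - \<alpha>" using j by (auto simp: t_def)
  have "sin t - sin \<alpha> = 2 * sin ((t - \<alpha>) / 2) * cos ((t + \<alpha>) / 2)" by (rule sin_diff_sin)
  also have "\<dots> > 0" using t \<alpha> by (intro mult_pos_pos sin_gt_zero cos_gt_zero_pi) auto
  finally show "sin x > sin \<alpha>" using st by simp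
next
  assume gt: "sin x > sin \<alpha>"
  define j where "j = nat \<lfloor>x / (2 * pi)\<rfloor>"
  have rj: "real j = of_int \<lfloor>x / (2 * pi)\<rfloor>" using x by (simp add: j_def)
  define t where "t = x - 2 * pi * j"
  have "x = t + 2 * pi * of_int (int j)" by (simp add: t_def)
  then have "sin x = sin t * cos (2 * pi * of_int (int j)) + cos t * sin (2 * pi * of_int (int j))" by (simp only: sin_add)
  then have st: "sin x = sin t" unfolding sin_int_2pin cos_int_2pin by simp
  have "real j \<le> x / (2 * pi)" "x / (2 * pi) < real j + 1" unfolding rj by linarith+
  then have t: "0 \<le> t" "t < 2 * pi" by (auto simp: t_def field_simps)
  have s0: "sin \<alpha> \<ge> 0" using \<alpha> by (intro sin_ge_zero) auto
  have tpi: "t < pi"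
  proof (rule ccontr)
    assume "\<not> t < pi"
    then have "sin t \<le> 0" using t by (intro sin_le_zero) auto
    then show False using gt s0 st by simp
  qed
  have "\<alpha> < t"
  proof (rule ccontr)
    assume "\<not> \<alpha> < t"
    then have "sin t \<le> sin \<alpha>" using t \<alpha> by (intro sin_monotone_2pi_le) auto
    then show False using gt st by simp
  qed
  moreover have "t < pi - \<alpha>"
  proof (rule ccontr)
    assume "\<not> t < pi - \<alpha>"
    then have "sin (pi - t) \<le> sin \<alpha>" using t tpi \<alpha> by (intro sin_monotone_2pi_le) auto
    then show False using gt st by (simp add: sin_diff)
  qed
  ultimately show "\<exists>j::nat. 2 * pi * j + \<alpha> < x \<and> x < 2 * pi * j + pi - \<alpha>"
    by (intro exI[of _ j]) (auto simp: t_def)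
qed

text \<open>The inequality is solved explicitly, with one interval per arch of the faster sine. The
  condition \<open>a * E \<le> 1 / 2\<close> keeps \<open>a * pi * y\<close> in the range of
  \<open>sin_gt_sin_iff\<close>. The first \<open>J\<close> intervals end before \<open>E\<close> by
  \<open>J1\<close> and have ordered endpoints by \<open>J2\<close>; by \<open>J3\<close> the others
  start too late.\<close>

lemma measure_sin_gt_sin:
  fixes N a E :: real
  assumes a: "0 \<le> a" "a < N" and E: "a * E \<le> 1 / 2"
    and J1: "\<And>j. j < J \<Longrightarrow> (2 * real j + 1) / (N + a) \<le> E"
    and J2: "\<And>j. j < J \<Longrightarrow> 2 * real j / (N - a) \<le> (2 * real j + 1) / (N + a)"
    and J3: "\<And>j. j \<ge> J \<Longrightarrow> E \<le> 2 * real j / (N - a)"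
  shows "measure lborel {y \<in> {0<..<E}. sin (a * pi * y) < sin (N * pi * y)} =
    (\<Sum>j<J. (2 * real j + 1) / (N + a) - 2 * real j / (N - a))"
proof -
  define C where "C = (\<lambda>j::nat. {2 * real j / (N - a) <..< (2 * real j + 1) / (N + a)})"
  have "{y \<in> {0<..<E}. sin (a * pi * y) < sin (N * pi * y)} = (\<Union>j<J. C j)"
  proof (intro set_eqI)
    fix y
    have C: "y \<in> C j \<longleftrightarrow> 2 * pi * j + a * pi * y < N * pi * y \<and> N * pi * y < 2 * pi * j + pi - a * pi * y" for j
    proof -
      have "2 * pi * j + a * pi * y < N * pi * y \<longleftrightarrow> pi * (2 * real j) < pi * ((N - a) * y)" by (simp add: algebra_simps)
      also have "\<dots> \<longleftrightarrow> 2 * real j < (N - a) * y" by (simp only: mult_less_cancel_left_pos[OF pi_gt_zero])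
      also have "\<dots> \<longleftrightarrow> 2 * real j / (N - a) < y" using a by (simp add: field_simps)
      finally have 1: "2 * pi * j + a * pi * y < N * pi * y \<longleftrightarrow> 2 * real j / (N - a) < y" .
      have "N * pi * y < 2 * pi * j + pi - a * pi * y \<longleftrightarrow> pi * ((N + a) * y) < pi * (2 * real j + 1)" by (simp add: algebra_simps)
      also have "\<dots> \<longleftrightarrow> (N + a) * y < 2 * real j + 1" by (simp only: mult_less_cancel_left_pos[OF pi_gt_zero])
      also have "\<dots> \<longleftrightarrow> y < (2 * real j + 1) / (N + a)" using a by (simp add: field_simps)
      finally have 2: "N * pi * y < 2 * pi * j + pi - a * pi * y \<longleftrightarrow> y < (2 * real j + 1) / (N + a)" .
      show ?thesis unfolding C_def using 1 2 by auto
    qed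
    have iff: "sin (a * pi * y) < sin (N * pi * y) \<longleftrightarrow> (\<exists>j. y \<in> C j)" if y: "y \<in> {0<..<E}"
    proof -
      have "a * y \<le> a * E" using y a by (intro mult_left_mono) auto
      then have "a * y \<le> 1 / 2" using E by linarith
      then have "pi * (a * y) \<le> pi * (1 / 2)" by (intro mult_left_mono) auto
      then have "a * pi * y \<le> pi / 2" by (simp add: mult_ac)
      moreover have "0 \<le> a * pi * y" "0 \<le> N * pi * y" using y a by auto
      ultimately show ?thesis using sin_gt_sin_iff[of "a * pi * y" "N * pi * y"] unfolding C by simp
    qed
    have CE: "y \<in> {0<..<E}" if "y \<in> C j" "j < J" for j
    proof -
      have "0 \<le> 2 * real j / (N - a)" using a by simp
      then show ?thesis using that J1[OF that(2)] unfolding C_def by auto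
    qed
    have CJ: "j < J" if "y \<in> C j" "y \<in> {0<..<E}" for j
      using J3[of j] that by (force simp: C_def)
    show "y \<in> {y \<in> {0<..<E}. sin (a * pi * y) < sin (N * pi * y)} \<longleftrightarrow> y \<in> (\<Union>j<J. C j)"
      using iff CE CJ by blast
  qed
  also have "measure lborel (\<Union>j<J. C j) = (\<Sum>j<J. measure lborel (C j))"
  proof (rule measure_finite_Union)
    show "disjoint_family_on C {..<J}"
    proof -
      have lt: "C i \<inter> C j = {}" if "i < j" for i j
      proof -
        have "(2 * real i + 1) / (N + a) \<le> 2 * real j / (N + a)" using that a by (intro divide_right_mono) auto
        also have "\<dots> \<le> 2 * real j / (N - a)" using a by (intro divide_left_mono) auto
        finally show ?thesis unfolding C_def by auto
      qed
      show ?thesis unfolding disjoint_family_on_def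
        using lt by (metis Int_commute nat_neq_iff)
    qed
    show "emeasure lborel (C j) \<noteq> \<infinity>" if "j \<in> {..<J}" for j using that J2[of j] by (simp add: C_def)
  qed (auto simp: C_def)
  also have "\<dots> = (\<Sum>j<J. (2 * real j + 1) / (N + a) - 2 * real j / (N - a))"
    using J2 by (intro sum.cong refl) (auto simp: C_def)
  finally show ?thesis .
qed

lemma mres_complement:
  "mres M a = 1 - measure lborel {y \<in> {0<..<1}. a * sin (pi * y) < sin (real (2 * M + 1) * pi * y)}"
proof -
  let ?N = "real (2 * M + 1)"
  let ?P = "{y \<in> {0<..<1::real}. a * sin (pi * y) < sin (?N * pi * y)}"
  let ?R = "{y \<in> {0..1}. sin (?N * pi * y) \<le> a * sin (pi * y)}"
  have z: "sin (?N * pi) = 0" using sin_npi[of "2 * M + 1"] by simp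
  have "{0..1} = ?R \<union> ?P"
    using z by (auto simp: less_le not_le)
  moreover have "?R \<inter> ?P = {}" by auto
  moreover have m: "?R \<in> sets lborel" "?P \<in> sets lborel" by measurable
  moreover have "?R \<in> fmeasurable lborel"
    by (rule fmeasurableI2[OF Icc_fmeasurable[of 0 1] _ m(1)]) auto
  moreover have "?P \<in> fmeasurable lborel"
    by (rule fmeasurableI2[OF Icc_fmeasurable[of 0 1] _ m(2)]) auto
  ultimately have "emeasure lborel ?R \<noteq> \<infinity>" "emeasure lborel ?P \<noteq> \<infinity>" and eq: "{0..1} = ?R \<union> ?P" and "?R \<inter> ?P = {}"
    by (auto dest: fmeasurableD2)
  then have "measure lborel {0..1::real} = measure lborel ?R + measure lborel ?P"
    using m by (subst eq) (intro measure_Union)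
  then show ?thesis by (simp add: mres_def)
qed

text \<open>Of the \<open>2 * M + 1\<close> arches of the sine on the unit interval,
  \<open>M + 1\<close> are positive, and all have equal length.\<close>

lemma mres_0: "mres M 0 = 1 - (real M + 1) / (2 * real M + 1)"
proof -
  have "measure lborel {y \<in> {0<..<1}. sin (0 * pi * y) < sin (real (2 * M + 1) * pi * y)} =
    (\<Sum>j<M + 1. (2 * real j + 1) / (real (2 * M + 1) + 0) - 2 * real j / (real (2 * M + 1) - 0))"
    by (rule measure_sin_gt_sin) (auto simp: field_simps)
  also have "\<dots> = (\<Sum>j<M + 1. 1 / (2 * real M + 1))"
    by (intro sum.cong refl) (simp flip: diff_divide_distrib)
  also have "\<dots> = (real M + 1) / (2 * real M + 1)" by (simp add: add.commute)
  finally show ?thesis unfolding mres_complement by simp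
qed

text \<open>The explicit solution reaches only up to \<open>1 / 2\<close>. Replacing
  \<open>y\<close> by \<open>1 - y\<close> preserves both sines because \<open>2 * M + 1\<close> is
  odd, so the other half has the same measure.\<close>

lemma mres_1:
  assumes M: "M > 0"
  defines "J \<equiv> (M + 1) div 2"
  shows "mres M 1 = 1 - real J * (real M - real J + 1) / (real M * (real M + 1))"
proof -
  let ?N = "real (2 * M + 1)"
  define P where "P = {y \<in> {0<..<1/2}. sin (1 * pi * y) < sin (?N * pi * y)}"
  define A where "A = {y \<in> {0<..<1}. 1 * sin (pi * y) < sin (?N * pi * y)}"
  define P' where "P' = {x. 1 + (-1) * x \<in> P}"
  \<comment> \<open>The interval of index \<open>j\<close> has length proportional to
    \<open>M - 2 * j\<close>, so it is nonempty exactly when \<open>2 * j < M\<close>; these are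
    also the indices whose left endpoint lies below \<open>1 / 2\<close>.\<close>
  have Jlt: "j < J \<longleftrightarrow> 2 * j < M" for j unfolding J_def by linarith
  have Pm: "P \<in> sets borel" and Am: "A \<in> sets borel" unfolding P_def A_def by measurable
  have "measure lborel P = (\<Sum>j<J. (2 * real j + 1) / (?N + 1) - 2 * real j / (?N - 1))"
    unfolding P_def
  proof (rule measure_sin_gt_sin)
    fix j
    show "(2 * real j + 1) / (?N + 1) \<le> 1 / 2" if "j < J"
      using that Jlt[of j] by (simp add: field_simps)
    show "2 * real j / (?N - 1) \<le> (2 * real j + 1) / (?N + 1)" if "j < J"
    proof -
      have "2 * real j \<le> real M" using that Jlt[of j] by linarith
      then show ?thesis using M by (simp add: field_simps)
    qed
    show "1 / 2 \<le> 2 * real j / (?N - 1)" if "j \<ge> J"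
    proof -
      have "real M \<le> 2 * real j" using that Jlt[of j] by linarith
      then show ?thesis using M by (simp add: field_simps)
    qed
  qed (use M in auto)
  also have "\<dots> = (\<Sum>j<J. (real M - 2 * real j) / (2 * real M * (real M + 1)))"
    using M by (intro sum.cong refl) (simp add: field_simps)
  also have "\<dots> = (\<Sum>j<J. real M - 2 * real j) / (2 * real M * (real M + 1))" by (simp add: sum_divide_distrib)
  also have "(\<Sum>j<J. real M - 2 * real j) = real J * (real M - real J + 1)"
    by (induction J) (auto simp: algebra_simps)
  finally have mP: "measure lborel P = real J * (real M - real J + 1) / (2 * real M * (real M + 1))" .
  have mP': "measure lborel P' = measure lborel P"
    unfolding P'_def using measure_lborel_affine_preimage[OF Pm, of "-1" 1] by simp
  have reflect: "sin (?N * pi * (1 - y)) = sin (?N * pi * y)" "sin (pi * (1 - y)) = sin (pi * y)" for y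
  proof -
    have s: "sin (?N * pi) = 0" "cos (?N * pi) = -1" using sin_npi[of "2 * M + 1"] cos_npi[of "2 * M + 1"] by simp_all
    have "?N * pi * (1 - y) = ?N * pi - ?N * pi * y" by (simp add: algebra_simps)
    then have "sin (?N * pi * (1 - y)) = sin (?N * pi) * cos (?N * pi * y) - cos (?N * pi) * sin (?N * pi * y)"
      by (simp only: sin_diff)
    then show "sin (?N * pi * (1 - y)) = sin (?N * pi * y)" unfolding s by simp
    show "sin (pi * (1 - y)) = sin (pi * y)" by (simp add: right_diff_distrib sin_diff)
  qed
  have P'eq: "P' = {y \<in> {1/2<..<1}. 1 * sin (pi * y) < sin (?N * pi * y)}"
  proof -
    have "x \<in> P' \<longleftrightarrow> 1 - x \<in> {0<..<1/2} \<and> sin (pi * (1 - x)) < sin (?N * pi * (1 - x))" for x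
      by (simp add: P'_def P_def)
    then show ?thesis unfolding reflect by auto
  qed
  have P'm: "P' \<in> sets borel" unfolding P'eq by measurable
  have "measure lborel A = measure lborel (A - {1/2})"
    using Am by (intro measure_Diff_null_set[symmetric]) (auto intro: finite_imp_null_set_lborel)
  also have "A - {1/2} = P \<union> P'" unfolding P'eq by (auto simp: A_def P_def)
  also have "measure lborel (P \<union> P') = measure lborel P + measure lborel P'"
  proof -
    have "P \<in> fmeasurable lborel" "P' \<in> fmeasurable lborel"
      using Pm P'm unfolding P'eq by (auto intro!: fmeasurableI2[OF Icc_fmeasurable[of 0 1]] simp: P_def)
    moreover have "P \<inter> P' = {}" unfolding P'eq by (auto simp: P_def)
    ultimately show ?thesis by (intro measure_Union) (auto dest: fmeasurableD fmeasurableD2)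
  qed
  finally have "measure lborel A = real J * (real M - real J + 1) / (real M * (real M + 1))"
    unfolding mP' mP by simp
  then show ?thesis unfolding mres_complement A_def by simp
qed

lemma mres_0_tendsto: "(\<lambda>M. mres M 0) \<longlonglongrightarrow> 1 / 2"
  unfolding mres_0 by real_asymp

text \<open>\<open>J / M\<close> tends to 1/2, so the measure removed from 1 tends to 1/2 times
  1/2.\<close>

lemma mres_1_tendsto: "(\<lambda>M. mres M 1) \<longlonglongrightarrow> 3 / 4"
proof -
  define r where "r = (\<lambda>M. real (Suc M div 2) / real M)"
  have r: "r \<longlonglongrightarrow> 1 / 2"
  proof (rule tendsto_sandwich[where f="\<lambda>_. 1 / 2" and h="\<lambda>M. 1 / 2 + 1 / real M"])
    show "(\<lambda>M. 1 / 2 + 1 / real M) \<longlonglongrightarrow> 1 / 2" by real_asymp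
    show "\<forall>\<^sub>F M in sequentially. 1 / 2 \<le> r M"
      using eventually_gt_at_top[of 0]
    proof eventually_elim
      case (elim M)
      have "real M / 2 \<le> real (Suc M div 2)" by linarith
      then show ?case using elim by (simp add: r_def field_simps)
    qed
    show "\<forall>\<^sub>F M in sequentially. r M \<le> 1 / 2 + 1 / real M"
      using eventually_gt_at_top[of 0]
    proof eventually_elim
      case (elim M)
      have "real (Suc M div 2) \<le> real M / 2 + 1" by linarith
      then show ?case using elim by (simp add: r_def field_simps)
    qed
  qed simp
  have "(\<lambda>M. 1 - r M * (1 - r M + 1 / real M) / (1 + 1 / real M)) \<longlonglongrightarrow> 1 - 1 / 2 * (1 - 1 / 2 + 0) / (1 + 0)"
    using r by (intro tendsto_intros lim_1_over_n) auto
  moreover have "\<forall>\<^sub>F M in sequentially. 1 - r M * (1 - r M + 1 / real M) / (1 + 1 / real M) = mres M 1"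
    using eventually_gt_at_top[of 0]
  proof eventually_elim
    case (elim M)
    define J where "J = real (Suc M div 2)"
    have "r M = J / real M" "1 - r M + 1 / real M = (real M - J + 1) / real M" "1 + 1 / real M = (real M + 1) / real M"
      using elim by (simp_all add: r_def J_def field_simps)
    then have "r M * (1 - r M + 1 / real M) / (1 + 1 / real M) = J * (real M - J + 1) / (real M * (real M + 1))"
      using elim by simp
    then show ?case using mres_1[OF elim] by (simp add: J_def)
  qed
  ultimately show ?thesis by (simp add: tendsto_cong)
qed

text \<open>The perturbation bounds do not depend on \<open>M\<close>, so the limits in the number
  of terms and in the threshold can be taken together.\<close>

lemma mres_tendsto:
  fixes a :: "nat \<Rightarrow> real"
  assumes M: "filterlim M at_top sequentially"
  shows "a \<longlonglongrightarrow> 1 \<Longrightarrow> (\<lambda>n. mres (M n) (a n)) \<longlonglongrightarrow> 3 / 4"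
    and "a \<longlonglongrightarrow> 0 \<Longrightarrow> (\<lambda>n. mres (M n) (a n)) \<longlonglongrightarrow> 1 / 2"
    and "filterlim a at_bot sequentially \<Longrightarrow> (\<lambda>n. mres (M n) (a n)) \<longlonglongrightarrow> 0"
proof -
  have Mpos: "\<forall>\<^sub>F n in sequentially. M n > 0" using M eventually_gt_at_top[of "0::nat"] by (auto simp: filterlim_iff)
  have gen: "(\<lambda>n. mres (M n) (a n)) \<longlonglongrightarrow> L"
    if a: "a \<longlonglongrightarrow> b" and b: "b = 0 \<or> b = 1" and L: "(\<lambda>k. mres k b) \<longlonglongrightarrow> L" for b L
  proof -
    have "(\<lambda>n. 20 * sqrt \<bar>a n - b\<bar>) \<longlonglongrightarrow> 20 * sqrt \<bar>b - b\<bar>" using a by (intro tendsto_intros)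
    then have 0: "(\<lambda>n. 20 * sqrt \<bar>a n - b\<bar>) \<longlonglongrightarrow> 0" by simp
    have "(\<lambda>n. mres (M n) (a n) - mres (M n) b) \<longlonglongrightarrow> 0"
      by (rule Lim_null_comparison[OF _ 0]) (use Mpos in eventually_elim, use mres_perturb[OF _ b] in simp)
    from tendsto_add[OF this filterlim_compose[OF L M]] show ?thesis by simp
  qed
  show "a \<longlonglongrightarrow> 1 \<Longrightarrow> (\<lambda>n. mres (M n) (a n)) \<longlonglongrightarrow> 3 / 4" by (rule gen[OF _ _ mres_1_tendsto]) auto
  show "a \<longlonglongrightarrow> 0 \<Longrightarrow> (\<lambda>n. mres (M n) (a n)) \<longlonglongrightarrow> 1 / 2" by (rule gen[OF _ _ mres_0_tendsto]) auto
  assume a: "filterlim a at_bot sequentially"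
  have "filterlim (\<lambda>n. - a n) at_top sequentially" using a by (simp add: filterlim_uminus_at_top)
  from tendsto_mult[OF tendsto_const tendsto_inverse_0_at_top[OF this], of 10]
  have 0: "(\<lambda>n. 10 * inverse (- a n)) \<longlonglongrightarrow> 0" by simp
  have "\<forall>\<^sub>F n in sequentially. a n < 0" using a by (simp add: filterlim_at_bot_dense)
  then have "\<forall>\<^sub>F n in sequentially. norm (mres (M n) (a n)) \<le> 10 * inverse (- a n)"
  proof eventually_elim
    case (elim n)
    have "mres (M n) (a n) \<ge> 0" by (simp add: mres_def)
    then show ?case using mres_large_negative[OF elim, of "M n"] elim by (simp add: divide_inverse)
  qed
  then show "(\<lambda>n. mres (M n) (a n)) \<longlonglongrightarrow> 0" by (rule Lim_null_comparison[OF _ 0])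
qed

section \<open>Classification risk\<close>

text \<open>The condition \<open>fhat \<le> \<tau>\<close>, solved for the quotient of
  \<open>sin ((2 * M + 1) * pi * y)\<close> and \<open>sin (pi * y)\<close> by the closed form of
  the Dirichlet kernel, where \<open>M = nalias p n\<close>.\<close>

definition thr :: "real \<Rightarrow> real \<Rightarrow> nat \<Rightarrow> real \<Rightarrow> real" where
  "thr p q n \<tau> = 1 + 2 * (\<tau> * (cnst p q n + cfreq p q n * nalias p n) - cnst p q n) / cfreq p q n"

text \<open>In the variable \<open>y = n * (x + 1) / 2\<close> the test interval consists of
  \<open>n\<close> periods of \<open>fhat\<close>, and the change of scale cancels against their
  number and the normalisation by 2. The endpoints of a period, where the Dirichlet quotient is
  undefined, form a null set.\<close>

lemma measure_fhat_sublevel: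
  assumes reg: "regular p q n"
  shows "measure lborel {x \<in> {-1..1}. fhat p q n x \<le> \<tau>} / 2 = mres (nalias p n) (thr p q n \<tau>)"
proof -
  note r = regularD[OF reg]
  let ?M = "nalias p n" and ?c = "cfreq p q n" and ?C = "cnst p q n"
  define W where "W = ?C + ?c * ?M"
  have W: "W > 0" using r(7) by (simp add: W_def)
  define h where "h = (\<lambda>y. \<Sum>m=1..?M. cos (real m * (2 * pi * y)))"
  define A where "A = {y. ?C + ?c * h y \<le> \<tau> * W}"
  have hc: "continuous_on UNIV h" unfolding h_def by (intro continuous_intros)
  have "closed A" unfolding A_def by (intro closed_Collect_le continuous_intros continuous_on_subset[OF hc]) auto
  then have A: "A \<in> sets borel" by (rule borel_closed)
  have per: "y + 1 \<in> A \<longleftrightarrow> y \<in> A" for y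
  proof -
    have "cos (real m * (2 * pi * (y + 1))) = cos (real m * (2 * pi * y))" for m
    proof -
      have "real m * (2 * pi * (y + 1)) = real m * (2 * pi * y) + 2 * pi * of_int (int m)" by (simp add: algebra_simps)
      then have "cos (real m * (2 * pi * (y + 1))) = cos (real m * (2 * pi * y) + 2 * pi * of_int (int m))" by (rule arg_cong)
      then show ?thesis unfolding cos_add sin_int_2pin cos_int_2pin by simp
    qed
    then show ?thesis by (simp add: A_def h_def)
  qed
  define S where "S = {x \<in> {-1..1}. fhat p q n x \<le> \<tau>}"
  have f: "fhat p q n x \<le> \<tau> \<longleftrightarrow> n / 2 + n / 2 * x \<in> A" for x
  proof -
    have "h (n / 2 + n / 2 * x) = (\<Sum>m=1..?M. cos (real m * (real n * pi * (x + 1))))"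
    proof -
      have "2 * pi * (n / 2 + n / 2 * x) = real n * pi * (x + 1)" by (simp add: algebra_simps)
      then show ?thesis unfolding h_def by (simp only:)
    qed
    then have "fhat p q n x = (?C + ?c * h (n / 2 + n / 2 * x)) / W"
      unfolding regular_fhat_eq[OF reg] W_def by simp
    then show ?thesis using W by (simp add: A_def pos_divide_le_eq)
  qed
  have Sm: "S \<in> sets lborel"
  proof -
    have "closed ({-1..1} \<inter> {x. fhat p q n x \<le> \<tau>})"
      by (intro closed_Int closed_Collect_le continuous_on_fhat continuous_intros closed_atLeastAtMost)
    then show ?thesis by (simp add: S_def Int_def borel_closed)
  qed
  have "S - {1} = {x. n / 2 + n / 2 * x \<in> A \<inter> {0..<real n}}"
  proof -
    have "0 \<le> n / 2 + n / 2 * x \<longleftrightarrow> -1 \<le> x" "n / 2 + n / 2 * x < real n \<longleftrightarrow> x < 1" for x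
    proof -
      have e: "n / 2 + n / 2 * x = n / 2 * (x + 1)" by (simp add: algebra_simps)
      show "0 \<le> n / 2 + n / 2 * x \<longleftrightarrow> -1 \<le> x" unfolding e using r(1) by (auto simp: zero_le_mult_iff)
      have "n / 2 * (x + 1) < real n \<longleftrightarrow> n / 2 * (x + 1) < n / 2 * 2" by simp
      also have "\<dots> \<longleftrightarrow> x + 1 < 2" using r(1) by (intro mult_less_cancel_left_pos) simp
      finally show "n / 2 + n / 2 * x < real n \<longleftrightarrow> x < 1" unfolding e by simp
    qed
    then show ?thesis unfolding S_def f by auto
  qed
  moreover have "measure lborel S = measure lborel (S - {1})"
    using Sm by (intro measure_Diff_null_set[symmetric]) (auto intro: finite_imp_null_set_lborel)
  ultimately have "measure lborel S = measure lborel (A \<inter> {0..<real n}) / \<bar>n / 2\<bar>"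
    using measure_lborel_affine_preimage[of "A \<inter> {0..<real n}" "n / 2" "n / 2"] A r(1) by simp
  also have "\<dots> = 2 * measure lborel (A \<inter> {0..<1})"
    unfolding measure_periodic[OF A per] using r(1) by simp
  finally have 1: "measure lborel S / 2 = measure lborel (A \<inter> {0..<1})" by simp
  let ?R = "{y \<in> {0..1}. sin (real (2 * ?M + 1) * pi * y) \<le> thr p q n \<tau> * sin (pi * y)}"
  have iff: "y \<in> A \<longleftrightarrow> sin (real (2 * ?M + 1) * pi * y) \<le> thr p q n \<tau> * sin (pi * y)" if y: "0 < y" "y < 1" for y
  proof -
    have s: "sin (pi * y) > 0" using y by (intro sin_gt_zero) auto
    have "2 * sin (2 * pi * y / 2) * h y = sin ((real ?M + 1 / 2) * (2 * pi * y)) - sin (2 * pi * y / 2)"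
      unfolding h_def by (rule dirichlet_kernel_cos)
    moreover have "(real ?M + 1 / 2) * (2 * pi * y) = real (2 * ?M + 1) * pi * y" by (simp add: algebra_simps)
    ultimately have d: "2 * sin (pi * y) * h y = sin (real (2 * ?M + 1) * pi * y) - sin (pi * y)" by simp
    have "y \<in> A \<longleftrightarrow> h y \<le> (\<tau> * W - ?C) / ?c" using r(4) by (simp add: A_def field_simps)
    also have "\<dots> \<longleftrightarrow> 2 * sin (pi * y) * h y \<le> 2 * sin (pi * y) * ((\<tau> * W - ?C) / ?c)"
      using s by (intro mult_le_cancel_left_pos[symmetric]) simp
    also have "\<dots> \<longleftrightarrow> sin (real (2 * ?M + 1) * pi * y) \<le> (1 + 2 * ((\<tau> * W - ?C) / ?c)) * sin (pi * y)"
    proof -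
      have "u - v \<le> 2 * v * k \<longleftrightarrow> u \<le> (1 + 2 * k) * v" for u v k :: real by (auto simp: algebra_simps)
      then show ?thesis unfolding d .
    qed
    finally show ?thesis by (simp add: thr_def W_def)
  qed
  have "measure lborel (A \<inter> {0..<1}) = measure lborel (A \<inter> {0..<1} - {0, 1})"
    using A by (intro measure_Diff_null_set[symmetric]) (auto intro: finite_imp_null_set_lborel)
  also have "A \<inter> {0..<1} - {0, 1} = ?R - {0, 1}" using iff by auto
  also have "measure lborel \<dots> = measure lborel ?R"
    by (intro measure_Diff_null_set) (auto intro: finite_imp_null_set_lborel)
  finally show ?thesis using 1 by (simp add: S_def mres_def)
qed

lemma class_risk_sandwich:
  assumes f: "continuous_on UNIV f" and g: "continuous_on UNIV g" and close: "\<And>x. \<bar>g x - f x\<bar> \<le> \<tau>"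
  shows "measure lborel {x \<in> {-1..1}. f x \<le> - \<tau>} / 2 \<le> class_risk g"
    and "class_risk g \<le> measure lborel {x \<in> {-1..1}. f x \<le> \<tau>} / 2"
proof -
  have fm: "{x \<in> {-1..1}. u x \<le> c} \<in> fmeasurable lborel" if "continuous_on UNIV u" for u :: "real \<Rightarrow> real" and c
  proof (rule fmeasurableI2[OF Icc_fmeasurable[of "-1" 1]])
    have "closed ({-1..1} \<inter> {x. u x \<le> c})" using that by (intro closed_Int closed_Collect_le continuous_intros) auto
    then show "{x \<in> {-1..1}. u x \<le> c} \<in> sets lborel" by (simp add: Int_def borel_closed)
  qed auto
  have cr: "class_risk g = measure lborel {x \<in> {-1..1}. g x \<le> 0} / 2"
    unfolding class_risk_def sgn_neq_1_iff ..
  have 1: "{x \<in> {-1..1}. f x \<le> - \<tau>} \<subseteq> {x \<in> {-1..1}. g x \<le> 0}" and 2: "{x \<in> {-1..1}. g x \<le> 0} \<subseteq> {x \<in> {-1..1}. f x \<le> \<tau>}"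
  proof -
    have "g x \<le> 0" if "f x \<le> - \<tau>" for x using close[of x] that by linarith
    then show "{x \<in> {-1..1}. f x \<le> - \<tau>} \<subseteq> {x \<in> {-1..1}. g x \<le> 0}" by auto
    have "f x \<le> \<tau>" if "g x \<le> 0" for x using close[of x] that by linarith
    then show "{x \<in> {-1..1}. g x \<le> 0} \<subseteq> {x \<in> {-1..1}. f x \<le> \<tau>}" by auto
  qed
  show "measure lborel {x \<in> {-1..1}. f x \<le> - \<tau>} / 2 \<le> class_risk g"
    unfolding cr using 1 fm[OF g] fmeasurableD[OF fm[OF f]] by (intro divide_right_mono measure_mono_fmeasurable) auto
  show "class_risk g \<le> measure lborel {x \<in> {-1..1}. f x \<le> \<tau>} / 2"
    unfolding cr using 2 fm[OF f] fmeasurableD[OF fm[OF g]] by (intro divide_right_mono measure_mono_fmeasurable) auto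
qed

lemma cnst_bounds:
  "real n powr (- q) * (real n powr p - 1) / 2 \<le> cnst p q n"
  "cnst p q n \<le> real n powr (- q) * (real n powr p + 1) / 2"
  using nfreq_bounds(1)[of n p] nfreq_bounds(2)[of p n] by (auto simp: cnst_def gam_def dimB_def intro!: divide_right_mono mult_left_mono)

text \<open>One limit \<open>L\<close> serves every admissible \<open>\<tau>\<close>, which permits
  the choices 0, \<open>\<tau>\<close> and \<open>- \<tau>\<close> and thereby closes the sandwich
  around the random risk. The level enters \<open>thr\<close> only through its product with the
  normaliser of \<open>fhat\<close>, so the threshold is decided by \<open>cnst p q n\<close>, which
  tends to 0, 1/2 or infinity.\<close>

lemma thr_limit:
  assumes pq: "p > 1" "q > 1"
  shows "\<exists>L. \<forall>\<tau>. (\<lambda>n. \<tau> n * (cnst p q n + cfreq p q n * nalias p n)) \<longlonglongrightarrow> 0 \<longrightarrow>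
    (\<lambda>n. mres (nalias p n) (thr p q n (\<tau> n))) \<longlonglongrightarrow> L"
proof -
  have c: "cfreq p q \<longlonglongrightarrow> 1" using pq by (intro cfreq_tendsto_1) auto
  have M: "filterlim (nalias p) at_top sequentially"
    using filterlim_nalias[OF pq(1)] filterlim_sequentially_iff_filterlim_real by blast
  have thr: "(\<lambda>n. thr p q n (\<tau> n)) \<longlonglongrightarrow> 1 + 2 * (0 - c0) / 1"
    if "(\<lambda>n. \<tau> n * (cnst p q n + cfreq p q n * nalias p n)) \<longlonglongrightarrow> 0" "cnst p q \<longlonglongrightarrow> c0" for \<tau> c0
    unfolding thr_def using that c by (intro tendsto_intros) auto
  consider "p < q" | "p = q" | "q < p" by linarith
  then show ?thesis
  proof cases
    case 1
    have "cnst p q \<longlonglongrightarrow> 0"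
    proof (rule tendsto_sandwich)
      show "(\<lambda>n. real n powr (- q) * (real n powr p - 1) / 2) \<longlonglongrightarrow> 0" using 1 pq by real_asymp
      show "(\<lambda>n. real n powr (- q) * (real n powr p + 1) / 2) \<longlonglongrightarrow> 0" using 1 pq by real_asymp
    qed (intro always_eventually allI cnst_bounds)+
    then have "(\<lambda>n. thr p q n (\<tau> n)) \<longlonglongrightarrow> 1" if "(\<lambda>n. \<tau> n * (cnst p q n + cfreq p q n * nalias p n)) \<longlonglongrightarrow> 0" for \<tau>
      using thr[OF that, of 0] by simp
    then show ?thesis using mres_tendsto(1)[OF M] by blast
  next
    case 2
    have "cnst p q \<longlonglongrightarrow> 1 / 2"
    proof (rule tendsto_sandwich)
      show "(\<lambda>n. real n powr (- q) * (real n powr p - 1) / 2) \<longlonglongrightarrow> 1 / 2" unfolding 2 using pq by real_asymp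
      show "(\<lambda>n. real n powr (- q) * (real n powr p + 1) / 2) \<longlonglongrightarrow> 1 / 2" unfolding 2 using pq by real_asymp
    qed (intro always_eventually allI cnst_bounds)+
    then have "(\<lambda>n. thr p q n (\<tau> n)) \<longlonglongrightarrow> 0" if "(\<lambda>n. \<tau> n * (cnst p q n + cfreq p q n * nalias p n)) \<longlonglongrightarrow> 0" for \<tau>
      using thr[OF that, of "1/2"] by simp
    then show ?thesis using mres_tendsto(2)[OF M] by blast
  next
    case 3
    have cinf: "filterlim (cnst p q) at_top sequentially"
    proof (rule filterlim_at_top_mono)
      show "filterlim (\<lambda>n. real n powr (- q) * (real n powr p - 1) / 2) at_top sequentially" using 3 pq by real_asymp
    qed (intro always_eventually allI cnst_bounds)+
    have "filterlim (\<lambda>n. thr p q n (\<tau> n)) at_bot sequentially"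
      if t: "(\<lambda>n. \<tau> n * (cnst p q n + cfreq p q n * nalias p n)) \<longlonglongrightarrow> 0" for \<tau>
    proof -
      have "(\<lambda>n. 2 * inverse (cfreq p q n)) \<longlonglongrightarrow> 2 * inverse 1" using c by (intro tendsto_intros) auto
      then have "filterlim (\<lambda>n. (2 * inverse (cfreq p q n)) * cnst p q n) at_top sequentially"
        by (rule filterlim_tendsto_pos_mult_at_top[OF _ _ cinf]) simp
      moreover have "(\<lambda>n. - (1 + 2 * (\<tau> n * (cnst p q n + cfreq p q n * nalias p n)) / cfreq p q n)) \<longlonglongrightarrow> - (1 + 2 * 0 / 1)"
        using t c by (intro tendsto_intros) auto
      ultimately have "filterlim (\<lambda>n. - (1 + 2 * (\<tau> n * (cnst p q n + cfreq p q n * nalias p n)) / cfreq p q n) +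
         (2 * inverse (cfreq p q n)) * cnst p q n) at_top sequentially"
        by (intro filterlim_tendsto_add_at_top)
      moreover have "- (1 + 2 * (\<tau> n * (cnst p q n + cfreq p q n * nalias p n)) / cfreq p q n) +
         (2 * inverse (cfreq p q n)) * cnst p q n = - thr p q n (\<tau> n)" for n
        unfolding thr_def divide_inverse by (simp add: algebra_simps)
      ultimately have "filterlim (\<lambda>n. - thr p q n (\<tau> n)) at_top sequentially" by (simp only:)
      then show ?thesis by (simp add: filterlim_uminus_at_top)
    qed
    then show ?thesis using mres_tendsto(3)[OF M] by blast
  qed
qed

lemma eventually_dimB_over_sqrt_dimD:
  assumes "p > 1" "T > 0"
  shows "\<forall>\<^sub>F n in sequentially. real (dimB p n) / sqrt (real (dimD T n)) \<le> 4 * real n powr (p - T / 2)"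
proof -
  have 1: "\<forall>\<^sub>F n in sequentially. real n powr T \<ge> 2" using assms by real_asymp
  have 2: "\<forall>\<^sub>F n in sequentially. real n powr p \<ge> 1" using assms by real_asymp
  from 1 2 eventually_gt_at_top[of 0] show ?thesis
  proof eventually_elim
    case (elim n)
    have B: "real (dimB p n) \<le> 2 * real n powr p" using nfreq_bounds(2)[of p n] elim by (simp add: dimB_def)
    have "real (dimD T n) \<ge> real n powr T - 1" unfolding dimD_def by linarith
    then have "real (dimD T n) \<ge> real n powr T / 2" using elim(1) by linarith
    then have "real (dimD T n) \<ge> real n powr T / 4" using elim(1) by linarith
    then have "sqrt (real (dimD T n)) \<ge> sqrt (real n powr T / 4)" by (rule real_sqrt_le_mono)
    also have "sqrt (real n powr T / 4) = real n powr (T / 2) / 2"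
      using elim(3) by (simp add: real_sqrt_divide powr_half_sqrt[symmetric] powr_powr)
    finally have d: "real n powr (T / 2) / 2 \<le> sqrt (real (dimD T n))" .
    have "real (dimB p n) / sqrt (real (dimD T n)) \<le> 2 * real n powr p / (real n powr (T / 2) / 2)"
      using B d elim(3) by (intro frac_le) auto
    also have "\<dots> = 4 * real n powr (p - T / 2)" using elim(3) by (simp add: powr_diff)
    finally show ?case .
  qed
qed

text \<open>The Frobenius error is at most of order \<open>n powr (p - T / 2)\<close>, the
  perturbation lemma adds a factor \<open>sqrt n\<close>, and the normaliser of \<open>fhat\<close>
  is at most of order \<open>n powr (p - 1)\<close>. The resulting exponent
  \<open>2 * p - 1 / 2 - T / 2\<close> is negative under the assumption on \<open>T\<close>.\<close>

lemma class_risk_conv: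
  assumes pq: "p > 1" "q > 1" and T: "T > 6 * p - 1"
  shows "\<exists>L. (\<lambda>n. class_risk (fhat p q n)) \<longlonglongrightarrow> L \<and>
    conv_in_prob (Zspace p q T) (\<lambda>n z. class_risk (ghat p T n z)) L"
proof -
  obtain L where L: "\<And>\<tau>. (\<lambda>n. \<tau> n * (cnst p q n + cfreq p q n * nalias p n)) \<longlonglongrightarrow> 0 \<Longrightarrow>
    (\<lambda>n. mres (nalias p n) (thr p q n (\<tau> n))) \<longlonglongrightarrow> L"
    using thr_limit[OF pq] by blast
  have T0: "T > 0" using T pq by simp
  have "(\<lambda>n. class_risk (fhat p q n)) \<longlonglongrightarrow> L"
  proof -
    have "(\<lambda>n. mres (nalias p n) (thr p q n 0)) \<longlonglongrightarrow> L" using L[of "\<lambda>_. 0"] by simp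
    moreover have "\<forall>\<^sub>F n in sequentially. mres (nalias p n) (thr p q n 0) = class_risk (fhat p q n)"
      using eventually_regular[OF pq]
      by eventually_elim (simp only: measure_fhat_sublevel[symmetric] class_risk_def sgn_neq_1_iff)
    ultimately show ?thesis by (simp add: tendsto_cong)
  qed
  moreover have "conv_in_prob (Zspace p q T) (\<lambda>n z. class_risk (ghat p T n z)) L"
  proof (rule conv_in_probI)
    fix e \<epsilon> :: real assume e: "e > 0" and \<epsilon>: "\<epsilon> > 0"
    \<comment> \<open>Makes the failure probability \<open>2 / s^2\<close> equal to
      \<open>\<epsilon> / 2\<close>.\<close>
    define s where "s = sqrt (4 / \<epsilon>)"
    have s: "s > 0" "2 / s\<^sup>2 < \<epsilon>" using \<epsilon> by (auto simp: s_def)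
    define \<delta> where "\<delta> = (\<lambda>n. s * (real (dimB p n) / sqrt (real (dimD T n))))"
    define \<tau> where "\<tau> = (\<lambda>n. 228 * \<delta> n * sqrt (real n))"
    have \<delta>0: "\<delta> n \<ge> 0" for n using s by (simp add: \<delta>_def)
    have \<delta>le: "\<forall>\<^sub>F n in sequentially. \<delta> n \<le> 4 * s * real n powr (p - T / 2)"
      using eventually_dimB_over_sqrt_dimD[OF pq(1) T0]
    proof eventually_elim
      case (elim n)
      then have "s * (real (dimB p n) / sqrt (real (dimD T n))) \<le> s * (4 * real n powr (p - T / 2))"
        using s by (intro mult_left_mono) auto
      then show ?case by (simp add: \<delta>_def mult_ac)
    qed
    have pow0: "(\<lambda>n. C * real n powr x) \<longlonglongrightarrow> 0" if "x < 0" for C x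
    proof -
      have "(\<lambda>n. C * real n powr x) \<longlonglongrightarrow> C * 0"
        using that by (intro tendsto_intros tendsto_neg_powr filterlim_real_sequentially)
      then show ?thesis by simp
    qed
    have "\<forall>\<^sub>F n in sequentially. 4 * s * real n powr (p - T / 2) < 1 / 12"
      using T pq by (intro order_tendstoD(2)[OF pow0]) auto
    with \<delta>le have \<delta>small: "\<forall>\<^sub>F n in sequentially. \<delta> n \<le> 1 / 12" by eventually_elim linarith
    have cM: "\<forall>\<^sub>F n in sequentially. cnst p q n / real (nalias p n) < 1"
      by (rule order_tendstoD(2)[OF cnst_over_nalias_tendsto_0[OF pq]]) simp
    have lim: "(\<lambda>n. \<tau> n * (cnst p q n + cfreq p q n * nalias p n)) \<longlonglongrightarrow> 0"
    proof (rule Lim_null_comparison)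
      \<comment> \<open>\<open>2736 = 228 * 4 * 3\<close>: the perturbation constant, the bound on
        \<open>dimB / sqrt dimD\<close>, and the bound \<open>3 * nalias p n\<close> on the
        normaliser.\<close>
      show "(\<lambda>n. 2736 * s * real n powr (2 * p - 1 / 2 - T / 2)) \<longlonglongrightarrow> 0"
        using T pq by (intro pow0) auto
      show "\<forall>\<^sub>F n in sequentially. norm (\<tau> n * (cnst p q n + cfreq p q n * nalias p n)) \<le>
          2736 * s * real n powr (2 * p - 1 / 2 - T / 2)"
        using \<delta>le cM eventually_regular[OF pq]
      proof eventually_elim
        case (elim n)
        note r = regularD[OF elim(3)]
        have "cnst p q n \<le> real (nalias p n)" using elim(2) r(2) by (simp add: field_simps)
        moreover have "cfreq p q n * nalias p n \<le> 2 * real (nalias p n)" using r(5) by (intro mult_right_mono) auto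
        ultimately have W: "cnst p q n + cfreq p q n * nalias p n \<le> 3 * real (nalias p n)" by linarith
        have "real (nalias p n) * real n \<le> real n powr p"
        proof -
          have "real (nalias p n * n) \<le> real (nfreq p n)" using nalias_bounds(1)[OF r(1), of p] by (simp only: of_nat_le_iff)
          also have "\<dots> \<le> real n powr p / 2" by (rule nfreq_bounds)
          also have "\<dots> \<le> real n powr p" by simp
          finally show ?thesis by simp
        qed
        then have "real (nalias p n) \<le> real n powr p / real n" using r(1) by (simp add: field_simps)
        also have "\<dots> = real n powr (p - 1)" using r(1) by (simp add: powr_diff)
        finally have M: "real (nalias p n) \<le> real n powr (p - 1)" .
        have "\<tau> n * (cnst p q n + cfreq p q n * nalias p n) \<le>
          (228 * (4 * s * real n powr (p - T / 2)) * real n powr (1 / 2)) * (3 * real n powr (p - 1))"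
        proof (intro mult_mono)
          show "\<tau> n \<le> 228 * (4 * s * real n powr (p - T / 2)) * real n powr (1 / 2)"
            unfolding \<tau>_def using elim(1) r(1) by (simp add: powr_half_sqrt)
          show "cnst p q n + cfreq p q n * nalias p n \<le> 3 * real n powr (p - 1)" using W M by linarith
        qed (use s r(7) in auto)
        also have "\<dots> = 2736 * s * (real n powr (p - T / 2) * real n powr (1 / 2) * real n powr (p - 1))" by simp
        also have "real n powr (p - T / 2) * real n powr (1 / 2) * real n powr (p - 1) = real n powr (2 * p - 1 / 2 - T / 2)"
          unfolding powr_add[symmetric] by (rule arg_cong[where f="\<lambda>x. real n powr x"]) simp
        finally show ?case using r(7) \<delta>0[of n] by (simp add: \<tau>_def abs_mult)
      qed
    qed
    have "(\<lambda>n. - \<tau> n * (cnst p q n + cfreq p q n * nalias p n)) \<longlonglongrightarrow> - 0"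
      using tendsto_minus[OF lim] by simp
    then have Lm: "(\<lambda>n. mres (nalias p n) (thr p q n (- \<tau> n))) \<longlonglongrightarrow> L" using L[of "\<lambda>n. - \<tau> n"] by simp
    have Lp: "(\<lambda>n. mres (nalias p n) (thr p q n (\<tau> n))) \<longlonglongrightarrow> L" by (rule L[OF lim])
    have nc: "\<forall>\<^sub>F n in sequentially. real n * cnst p q n / real (nfreq p n) < 1"
      using pq by (intro order_tendstoD(2)[OF n_cnst_over_nfreq_tendsto_0]) auto
    have ev1: "\<forall>\<^sub>F n in sequentially. mres (nalias p n) (thr p q n (- \<tau> n)) > L - e"
      using e by (intro order_tendstoD(1)[OF Lm]) auto
    have ev2: "\<forall>\<^sub>F n in sequentially. mres (nalias p n) (thr p q n (\<tau> n)) < L + e"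
      using e by (intro order_tendstoD(2)[OF Lp]) auto
    show "\<forall>\<^sub>F n in sequentially. \<exists>A\<in>sets (Zspace p q T n).
       {z \<in> space (Zspace p q T n). \<bar>class_risk (ghat p T n z) - L\<bar> > e} \<subseteq> A \<and> measure (Zspace p q T n) A < \<epsilon>"
      using eventually_regular[OF pq] \<delta>small nc ev1 ev2
    proof eventually_elim
      case (elim n)
      note r = regularD[OF elim(1)]
      have d: "dimD T n > 0" by (rule dimD_pos[OF T0 r(1)])
      have nc': "real n * cnst p q n \<le> nfreq p n" using elim(3) r(3) by (simp add: field_simps)
      obtain A where A: "A \<in> sets (Zspace p q T n)"
        "{z \<in> space (Zspace p q T n). (\<Sum>j<dimB p n. \<Sum>k<dimB p n. (empcov p q T n z j k)\<^sup>2) \<ge> s\<^sup>2 * (real (dimB p n))\<^sup>2 / dimD T n} \<subseteq> A"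
        "measure (Zspace p q T n) A \<le> 2 / s\<^sup>2"
        using empcov_frobenius_prob[OF elim(1) T0 s(1)] by blast
      have \<delta>2: "(\<delta> n)\<^sup>2 = s\<^sup>2 * (real (dimB p n))\<^sup>2 / dimD T n"
        by (simp add: \<delta>_def power_mult_distrib power_divide)
      have "\<bar>class_risk (ghat p T n z) - L\<bar> \<le> e" if z: "z \<in> space (Zspace p q T n)" "z \<notin> A" for z
      proof -
        have "(\<Sum>j<dimB p n. \<Sum>k<dimB p n. (empcov p q T n z j k)\<^sup>2) < (\<delta> n)\<^sup>2"
          unfolding \<delta>2 using A(2) z by (force simp: not_le[symmetric])
        then have close: "\<bar>ghat p T n z x - fhat p q n x\<bar> \<le> \<tau> n" for x
          unfolding \<tau>_def using elim(2) \<delta>0 by (intro ghat_fhat_perturbation[OF elim(1) d nc']) auto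
        note sw = class_risk_sandwich[OF continuous_on_fhat continuous_on_ghat close]
        show ?thesis using sw[unfolded measure_fhat_sublevel[OF elim(1)]] elim(4,5) by linarith
      qed
      then have "{z \<in> space (Zspace p q T n). \<bar>class_risk (ghat p T n z) - L\<bar> > e} \<subseteq> A" by force
      moreover have "measure (Zspace p q T n) A < \<epsilon>" using A(3) s(2) by linarith
      ultimately show ?case using A(1) by blast
    qed
  qed
  ultimately show ?thesis by blast
qed

theorem theorem2:
  fixes p q T :: real
  assumes "p > 1" and "q > 1" and "T > 0"
  shows "(T > 6 * p - 1 \<longrightarrow>
           (\<exists>L. (\<lambda>n. class_risk (fhat p q n)) \<longlonglongrightarrow> L \<and>
                conv_in_prob (Zspace p q T) (\<lambda>n z. class_risk (ghat p T n z)) L))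
       \<and> (T > 6 * p + 1 - 2 * q \<longrightarrow>
           (\<exists>L. (\<lambda>n. adv_risk (fhat p q n) (1 / real n)) \<longlonglongrightarrow> L \<and>
                conv_in_prob (Zspace p q T) (\<lambda>n z. adv_risk (ghat p T n z) (1 / real n)) L))"
  using class_risk_conv[OF assms(1,2)] adv_risk_fhat_tendsto_1[OF assms(1,2)] adv_risk_ghat_conv[OF assms] by blast

end
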